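(* Suppose that $g:\mathbb{N}\to(0,\infty)$ is a completely multiplicative function taking only positive values and that $g(n)\to\infty$ when $n\to\infty$. For $x\ge1$ let $P_{g,x}$ be the projection $$P_{g,x}\Big(\sum_{n=1}^\infty a_nn^{-s}\Big):=\sum_{g(n)\le x}a_nn^{-s}.$$ Then, for $1<q<\infty$, $$\sup_{x\ge1}\|P_{g,x}\|_{\mathcal{H}^q}=\frac1{\sin(\pi/q)},$$ where $\|P_{g,x}\|_{\mathcal{H}^q}$ is the norm of $P_{g,x}$ as an operator on $\mathcal{H}^q$.
   Context: $g$ is completely multiplicative if $g(mn)=g(m)g(n)$ for all integers $m,n\ge1$. For a Dirichlet series $f(s)=\sum_{n\ge1}a_nn^{-s}$, the Bohr lift is $\mathcal{B}f(z):=\sum_{n\ge1}a_nz^{\kappa(n)}$, where $\kappa(n)=(\kappa_1,\dots,\kappa_j,0,0,\dots)$ is the multi-index with $n=p_1^{\kappa_1}\cdots p_j^{\kappa_j}$ and $p_j$ is the $j$th prime. $\mathcal{H}^q$ is the space of Dirichlet series $f$ such that $\mathcal{B}f\in H^q(\mathbb{T}^\infty)$, with norm $\|f\|_{\mathcal{H}^q}:=\|\mathcal{B}f\|_{L^q(\mathbb{T}^\infty)}$. Here $\mathbb{T}^\infty$ is the countable product of unit circles with its Haar measure (the product of normalized Lebesgue measures), and for $q\ge1$, $H^q(\mathbb{T}^\infty)$ is the subspace of $L^q(\mathbb{T}^\infty)$ of functions whose Fourier coefficients vanish except at multi-indices (with finitely many non-zero entries) all of whose entries are $\ge0$. *)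

theory Defs
  imports "HOL-Probability.Probability" "HOL-Computational_Algebra.Primes"
begin

definition circle_measure :: "complex measure" where
  "circle_measure =
     distr (uniform_measure lborel {0..2 * pi}) (restrict_space borel (sphere 0 1)) cis"

text \<open>The underlying space of this product is the set of all sequences of unimodular numbers.\<close>

definition polytorus :: "(nat \<Rightarrow> complex) measure" where
  "polytorus = PiM UNIV (\<lambda>_. circle_measure)"

text \<open>Multi-indices are functions \<^typ>\<open>nat \<Rightarrow> int\<close> with finite support; outside of that case the
  product below is over an infinite set and has no meaning.\<close>

definition monomial :: "(nat \<Rightarrow> int) \<Rightarrow> (nat \<Rightarrow> complex) \<Rightarrow> complex" where
  "monomial \<kappa> z = (\<Prod>j\<in>{j. \<kappa> j \<noteq> 0}. z j powi \<kappa> j)"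

definition fourier_coeff :: "((nat \<Rightarrow> complex) \<Rightarrow> complex) \<Rightarrow> (nat \<Rightarrow> int) \<Rightarrow> complex" where
  "fourier_coeff F \<kappa> = (LINT z|polytorus. F z * cnj (monomial \<kappa> z))"

text \<open>Elements of \<open>L\<^sup>q\<close> are represented by functions, not by classes modulo null sets.\<close>

definition Lq_torus :: "real \<Rightarrow> ((nat \<Rightarrow> complex) \<Rightarrow> complex) set" where
  "Lq_torus q = {F. F \<in> borel_measurable polytorus \<and>
                    integrable polytorus (\<lambda>z. norm (F z) powr q)}"

definition Lq_norm :: "real \<Rightarrow> ((nat \<Rightarrow> complex) \<Rightarrow> complex) \<Rightarrow> real" where
  "Lq_norm q F = (LINT z|polytorus. norm (F z) powr q) powr (1 / q)"

definition Hq_torus :: "real \<Rightarrow> ((nat \<Rightarrow> complex) \<Rightarrow> complex) set" where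
  "Hq_torus q = {F \<in> Lq_torus q.
     \<forall>\<kappa>. finite {j. \<kappa> j \<noteq> 0} \<and> (\<exists>j. \<kappa> j < 0) \<longrightarrow> fourier_coeff F \<kappa> = 0}"

text \<open>Primes and coordinates are numbered from 0, so \<open>kappa n j\<close> is the exponent of the
  \<open>(j + 1)\<close>-st prime in \<open>n\<close>.\<close>

definition kappa :: "nat \<Rightarrow> nat \<Rightarrow> int" where
  "kappa n j = int (multiplicity (enumerate {p. prime p} j) n)"

text \<open>A Dirichlet series is given by its coefficient sequence \<open>a\<close>; the value \<open>a 0\<close> is ignored
  throughout. The lift of \<open>a\<close> is a formal series in the monomials with non-negative exponents,
  and that it is \<open>F\<close> means that it is the Fourier series of \<open>F\<close>. For \<open>q \<ge> 1\<close> this determines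
  \<open>F \<in> Hq_torus q\<close> up to a null set, since \<^term>\<open>kappa\<close> maps the positive integers onto the
  finitely supported multi-indices with non-negative entries. So the norm below does not depend on
  the choice of \<open>F\<close>.\<close>

definition is_bohr_lift ::
    "real \<Rightarrow> (nat \<Rightarrow> complex) \<Rightarrow> ((nat \<Rightarrow> complex) \<Rightarrow> complex) \<Rightarrow> bool" where
  "is_bohr_lift q a F \<longleftrightarrow> F \<in> Hq_torus q \<and> (\<forall>n\<ge>1. fourier_coeff F (kappa n) = a n)"

definition Hq_dirichlet :: "real \<Rightarrow> (nat \<Rightarrow> complex) set" where
  "Hq_dirichlet q = {a. \<exists>F. is_bohr_lift q a F}"

text \<open>The norm is infinite outside of the space, so that a linear operator of finite norm maps the space
  into itself.\<close>

definition Hq_norm :: "real \<Rightarrow> (nat \<Rightarrow> complex) \<Rightarrow> ennreal" where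
  "Hq_norm q a =
     (if a \<in> Hq_dirichlet q then ennreal (Lq_norm q (SOME F. is_bohr_lift q a F)) else \<infinity>)"

definition Hq_opnorm :: "real \<Rightarrow> ((nat \<Rightarrow> complex) \<Rightarrow> nat \<Rightarrow> complex) \<Rightarrow> ennreal" where
  "Hq_opnorm q T = (SUP a\<in>{a \<in> Hq_dirichlet q. Hq_norm q a \<le> 1}. Hq_norm q (T a))"

definition proj :: "(nat \<Rightarrow> real) \<Rightarrow> real \<Rightarrow> (nat \<Rightarrow> complex) \<Rightarrow> nat \<Rightarrow> complex" where
  "proj g x a n = (if g n \<le> x then a n else 0)"

end

theory Submission
  imports Defs "HOL-Complex_Analysis.Complex_Analysis" "HOL-Real_Asymp.Real_Asymp"
begin

text \<open>The map \<open>\<kappa> \<mapsto> \<Sum>\<^sub>j \<kappa>\<^sub>j ln g(p\<^sub>j)\<close> turns the projection into the projection to a half-space of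
  frequencies on the polytorus. On finitely many frequencies the half-space can be taken to be
  integral, and on the orbits of the corresponding circle action the projection is the Riesz
  projection. For \<open>1 < q \<le> 2\<close> the bound follows, as in Hollenbeck and Verbitsky, from the inequality
  \<open>\<bar>w\<bar>\<^sup>q \<le> sin(\<pi>/q)\<^sup>-\<^sup>q \<bar>w + cnj z\<bar>\<^sup>q - b Re (w z)\<^sup>q\<^sup>/\<^sup>2\<close>, whose last term has non-negative mean because the
  principal branch of \<open>Re u\<^sup>q\<^sup>/\<^sup>2\<close> is subharmonic. Duality gives the other exponents and the passage
  from polynomials to the whole space.

  The bound is approached already on the powers of the prime 2, where the projections are
  the partial sums of a power series. There the functions \<open>cnj f - cos(\<pi>/q) f\<close> with
  \<open>f(\<zeta>) = ((1 + r \<zeta>)/(1 - r \<zeta>))\<^sup>1\<^sup>/\<^sup>q\<close> and \<open>r \<longlongrightarrow> 1\<close> are extremal: the values of \<open>f\<close> concentrate near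
  the rays of argument \<open>\<plusminus>\<pi>/(2 q)\<close>, on which \<open>\<bar>cnj f - cos(\<pi>/q) f\<bar> = sin(\<pi>/q) \<bar>f\<bar>\<close>, while the projection
  changes the norm of \<open>cnj f\<close> by a bounded amount only.\<close>

section \<open>The sharp pointwise inequality\<close>

text \<open>The two bounds meet because they share one extremal configuration. For
  \<open>q < 2\<close> the pointwise inequality is an equality when
  \<open>norm z = - cos (pi / q) * norm w\<close> and \<open>w * z\<close> has argument
  \<open>pi / q\<close> up to sign; with \<open>w = cnj f\<close> and
  \<open>cnj z = - cos (pi / q) * f\<close> the test functions of the lower bound consist of such
  pairs on the two rays. The conjugate in \<open>w + cnj z\<close> makes both factors of
  \<open>w * z\<close> analytic along the orbits, and the strict inequality for the discarded
  frequencies makes the product vanish at the centre. Subharmonicity across the cut uses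
  \<open>q / 2 \<le> 1\<close>, so exponents above 2 have to come from duality. As
  \<open>g n\<close> tends to infinity, every projected series is a polynomial. In the duality
  argument a given \<open>F\<close> is only paired with polynomials, so no approximation of
  \<open>F\<close> itself is needed. The norm of a series is taken of a chosen lift, so it requires
  uniqueness of Fourier coefficients for integrable functions on the infinite torus.\<close>

lemma mult_cos_less_sin:
  fixes t :: real
  assumes "0 < t" "t < pi"
  shows "t * cos t < sin t"
proof -
  have "(\<lambda>t. sin t - t * cos t) 0 < (\<lambda>t. sin t - t * cos t) t"
  proof (rule DERIV_pos_imp_increasing_open[OF assms(1)])
    fix x assume x: "0 < x" "x < t"
    have "((\<lambda>t. sin t - t * cos t) has_real_derivative x * sin x) (at x)"
      by (auto intro!: derivative_eq_intros simp: algebra_simps)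
    moreover have "x * sin x > 0" using x assms by (intro mult_pos_pos sin_gt_zero) auto
    ultimately show "\<exists>y. ((\<lambda>t. sin t - t * cos t) has_real_derivative y) (at x) \<and> 0 < y" by blast
  qed (intro continuous_intros)
  thus ?thesis by simp
qed

lemma mult_sin_less_mult_sin:
  fixes x y :: real
  assumes "0 < x" "x < y" "y < pi"
  shows "x * sin y < y * sin x"
proof -
  have "sin y / y < sin x / x"
  proof (rule DERIV_neg_imp_decreasing[OF assms(2)])
    fix t assume t: "x \<le> t" "t \<le> y"
    have "((\<lambda>t. sin t / t) has_real_derivative (t * cos t - sin t) / t^2) (at t)"
      using t assms by (auto intro!: derivative_eq_intros simp: power2_eq_square field_simps)
    moreover have "(t * cos t - sin t) / t^2 < 0"
      using mult_cos_less_sin[of t] t assms by (auto simp: divide_neg_pos)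
    ultimately show "\<exists>y. ((\<lambda>t. sin t / t) has_real_derivative y) (at t) \<and> y < 0" by blast
  qed
  thus ?thesis using assms by (simp add: field_simps)
qed

text \<open>Multiplied by the positive number \<open>sin x * sin y * sin (x + y)\<close> the left
  side becomes \<open>x^2 * (sin y)^2 - y^2 * (sin x)^2\<close>, which is negative because
  \<open>sin t / t\<close> decreases. With \<open>x = (1 - s) * v\<close> and
  \<open>y = s * v\<close> it is \<open>v^2\<close> times the derivative of
  \<open>crit_log s\<close> at \<open>v\<close>.\<close>

lemma cot_combination_neg:
  fixes x y :: real
  assumes "0 < x" "x < y" "x + y < pi"
  shows "x^2 * cot x - y^2 * cot y + (y^2 - x^2) * cot (x + y) < 0"
proof -
  have sx: "sin x > 0" "sin y > 0" "sin (x + y) > 0"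
    using assms by (auto intro!: sin_gt_zero)
  have "(x * sin y)^2 < (y * sin x)^2"
    using mult_sin_less_mult_sin[of x y] assms sx by (intro power_strict_mono) auto
  hence "0 < y^2 * (sin x)^2 - x^2 * (sin y)^2" by (simp add: power_mult_distrib)
  moreover have "(x^2 * cot x - y^2 * cot y + (y^2 - x^2) * cot (x + y)) * (sin x * sin y * sin (x + y))
     = - (y^2 * (sin x)^2 - x^2 * (sin y)^2)"
  proof -
    have "(x^2 * cot x - y^2 * cot y + (y^2 - x^2) * cot (x + y)) * (sin x * sin y * sin (x + y))
      = x^2 * (cos x * sin y - 0) * sin (x + y) - y^2 * cos y * sin x * sin (x + y)
        + (y^2 - x^2) * cos (x + y) * sin x * sin y"
      using sx by (simp add: cot_def field_simps)
    also have "\<dots> = x^2 * (sin y * cos y * cos x * sin x + sin y^2 * cos x^2 - cos x * cos y * sin x * sin y + sin x^2 * sin y^2)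
       - y^2 * (sin x * cos x * cos y * sin y + sin x^2 * cos y^2 - cos x * cos y * sin x * sin y + sin x^2 * sin y^2)"
      by (simp add: sin_add cos_add algebra_simps power2_eq_square)
    also have "\<dots> = x^2 * (sin y^2 * (cos x^2 + sin x^2)) - y^2 * (sin x^2 * (cos y^2 + sin y^2))"
      by algebra
    finally show ?thesis by simp
  qed
  ultimately have "(x^2 * cot x - y^2 * cot y + (y^2 - x^2) * cot (x + y)) * (sin x * sin y * sin (x + y)) < 0"
    by simp
  thus ?thesis using sx by (simp add: mult_less_0_iff)
qed

lemma mult_less_pi: "c * v < pi" if "c \<le> 1" "0 < v" "v < pi" for c v :: real
proof -
  have "c * v \<le> 1 * v" using that by (intro mult_right_mono) auto
  thus ?thesis using that by linarith
qed

text \<open>At a critical point \<open>(R, t)\<close> of the function \<open>riesz_gap s a K\<close> below, \<open>ln K\<close> has this value.\<close>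

definition crit_log :: "real \<Rightarrow> real \<Rightarrow> real" where
  "crit_log s t = (1 - s) * ln (sin ((1 - s) * t)) - s * ln (sin (s * t)) + (2 * s - 1) * ln (sin t)"

lemma crit_log_less:
  assumes s: "1/2 < s" "s < 1" and t: "0 < t" "t < u" "u < pi"
  shows "crit_log s u < crit_log s t"
proof (rule DERIV_neg_imp_decreasing[OF t(2)])
  fix v assume v: "t \<le> v" "v \<le> u"
  have v0: "0 < v" "v < pi" using v t by auto
  have "s * v < pi" "(1 - s) * v < pi"
    using s v0 by (auto intro!: mult_less_pi)
  hence sp: "sin v > 0" "sin (s * v) > 0" "sin ((1 - s) * v) > 0"
    using v0 s by (auto intro!: sin_gt_zero)
  let ?D = "(1 - s)^2 * cot ((1 - s) * v) - s^2 * cot (s * v) + (2 * s - 1) * cot v"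
  have "(crit_log s has_real_derivative ?D) (at v)"
    unfolding crit_log_def
    using sp by (auto intro!: derivative_eq_intros simp: cot_def power2_eq_square mult_ac)
  moreover have "?D < 0"
  proof -
    have "v^2 * ?D = ((1 - s) * v)^2 * cot ((1 - s) * v) - (s * v)^2 * cot (s * v)
        + ((s * v)^2 - ((1 - s) * v)^2) * cot ((1 - s) * v + s * v)"
      by (simp add: algebra_simps power2_eq_square)
    also have "\<dots> < 0" by (rule cot_combination_neg) (use s v0 in \<open>auto simp: algebra_simps\<close>)
    finally show ?thesis using v0 by (simp add: mult_less_0_iff)
  qed
  ultimately show "\<exists>y. (crit_log s has_real_derivative y) (at v) \<and> y < 0" by blast
qed

text \<open>The coefficients \<open>1 - s\<close>, \<open>- s\<close>, \<open>2 * s - 1\<close> add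
  up to 0, so every sine may be divided by \<open>t\<close> without changing the sum. The limit
  later excludes a minimum at \<open>t = 0\<close>.\<close>

lemma crit_log_limit:
  assumes s: "1/2 < s" "s < 1"
  shows "(crit_log s \<longlongrightarrow> (1 - s) * ln (1 - s) - s * ln s) (at_right 0)"
proof -
  have l: "((\<lambda>t. sin (c * t) / t) \<longlongrightarrow> c) (at_right 0)" if "c > 0" for c :: real
    by real_asymp
  have "((\<lambda>t. (1 - s) * ln (sin ((1 - s) * t) / t) - s * ln (sin (s * t) / t) + (2 * s - 1) * ln (sin (1 * t) / t))
     \<longlongrightarrow> (1 - s) * ln (1 - s) - s * ln s + (2 * s - 1) * ln 1) (at_right 0)"
    using s by (intro tendsto_intros l) auto
  moreover have "eventually (\<lambda>t. (1 - s) * ln (sin ((1 - s) * t) / t) - s * ln (sin (s * t) / t) + (2 * s - 1) * ln (sin (1 * t) / t)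
     = crit_log s t) (at_right 0)"
    unfolding eventually_at_right_field
  proof (intro exI[of _ pi] conjI allI impI)
    fix v :: real assume v0: "0 < v" "v < pi"
    have "s * v < pi" "(1 - s) * v < pi"
      using s v0 by (auto intro!: mult_less_pi)
    hence sp: "sin v > 0" "sin (s * v) > 0" "sin ((1 - s) * v) > 0"
      using v0 s by (auto intro!: sin_gt_zero)
    show "(1 - s) * ln (sin ((1 - s) * v) / v) - s * ln (sin (s * v) / v) + (2 * s - 1) * ln (sin (1 * v) / v)
      = crit_log s v"
      using sp v0 by (simp add: crit_log_def ln_div algebra_simps)
  qed auto
  ultimately show ?thesis by (simp add: filterlim_cong[OF refl refl] tendsto_cong)
qed

lemma crit_log_less_limit:
  assumes s: "1/2 < s" "s < 1" and t: "0 < t" "t < pi"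
  shows "crit_log s t < (1 - s) * ln (1 - s) - s * ln s"
proof -
  \<comment> \<open>The detour through \<open>t / 2\<close> keeps the inequality strict; the limit
    alone would give only a weak one.\<close>
  have "crit_log s t < crit_log s (t/2)" by (rule crit_log_less) (use assms in auto)
  also have "\<dots> \<le> (1 - s) * ln (1 - s) - s * ln s"
  proof (rule tendsto_lowerbound[OF crit_log_limit[OF s]])
    show "\<forall>\<^sub>F u in at_right 0. crit_log s (t / 2) \<le> crit_log s u"
      unfolding eventually_at_right_field
      using t by (intro exI[of _ "t/2"]) (auto intro!: less_imp_le[OF crit_log_less[OF s]])
  qed simp
  finally show ?thesis .
qed

text \<open>With \<open>R = norm z / norm w\<close> and \<open>t\<close> the angle of \<open>w * z\<close>, this is \<open>norm w powr (- 2 * s)\<close> times the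
  difference of the two sides of \<open>riesz_pointwise\<close> for \<open>p = 2 * s\<close>.\<close>

definition riesz_gap :: "real \<Rightarrow> real \<Rightarrow> real \<Rightarrow> real \<Rightarrow> real \<Rightarrow> real" where
  "riesz_gap s a K R t = a * (1 + R^2 + 2 * R * cos t) powr s - 2 * a * K * R powr s * cos (s * t) - 1"

section \<open>Minimisation of the gap function\<close>

lemma quadratic_cos_pos:
  fixes R t :: real
  assumes "sin t \<noteq> 0"
  shows "0 < 1 + R^2 + 2 * R * cos t" "(sin t)^2 \<le> 1 + R^2 + 2 * R * cos t"
proof -
  \<comment> \<open>The expression is the squared modulus of \<open>R + cis t\<close>, whose
    imaginary part is \<open>sin t\<close> for every \<open>R\<close>.\<close>
  have *: "1 + R^2 + 2 * R * cos t = (R + cos t)^2 + (sin t)^2"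
    unfolding sin_squared_eq by (simp add: power2_eq_square algebra_simps)
  show "(sin t)^2 \<le> 1 + R^2 + 2 * R * cos t" unfolding * by simp
  have "0 < (sin t)^2" using assms by simp
  thus "0 < 1 + R^2 + 2 * R * cos t" unfolding * by (smt (verit) zero_le_power2)
qed

lemma quadratic_cos_nonneg:
  fixes R t :: real
  shows "0 \<le> 1 + R^2 + 2 * R * cos t"
proof -
  have "1 + R^2 + 2 * R * cos t = (R + cos t)^2 + (sin t)^2"
    unfolding sin_squared_eq by (simp add: power2_eq_square algebra_simps)
  thus ?thesis by simp
qed

lemma DERIV_riesz_gap_R:
  assumes "0 < R" "0 < 1 + R^2 + 2 * R * cos t"
  shows "((\<lambda>R. riesz_gap s a K R t) has_real_derivative
     2 * a * s * ((1 + R^2 + 2 * R * cos t) powr (s - 1) * (R + cos t) - K * R powr (s - 1) * cos (s * t))) (at R)"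
proof -
  have 1: "((\<lambda>R. (1 + R^2 + 2 * R * cos t) powr s) has_real_derivative
      s * (1 + R^2 + 2 * R * cos t) powr (s - 1) * (2 * R + 2 * cos t)) (at R)"
    using assms DERIV_fun_powr[of "\<lambda>R. 1 + R^2 + 2 * R * cos t" "2 * R + 2 * cos t" R s]
    by (auto intro!: derivative_eq_intros)
  have 2: "((\<lambda>R. R powr s) has_real_derivative s * R powr (s - 1)) (at R)"
    using assms(1) by (rule has_real_derivative_powr)
  show ?thesis unfolding riesz_gap_def
    by (rule derivative_eq_intros 1 2 refl)+ (simp add: algebra_simps)
qed

lemma DERIV_riesz_gap_t:
  assumes "0 \<le> R" "0 < 1 + R^2 + 2 * R * cos t"
  shows "((\<lambda>t. riesz_gap s a K R t) has_real_derivative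
     2 * a * s * (K * R powr s * sin (s * t) - (1 + R^2 + 2 * R * cos t) powr (s - 1) * R * sin t)) (at t)"
proof -
  have 1: "((\<lambda>t. (1 + R^2 + 2 * R * cos t) powr s) has_real_derivative
      s * (1 + R^2 + 2 * R * cos t) powr (s - 1) * (- 2 * R * sin t)) (at t)"
    using assms DERIV_fun_powr[of "\<lambda>t. 1 + R^2 + 2 * R * cos t" "- 2 * R * sin t" t s]
    by (auto intro!: derivative_eq_intros)
  show ?thesis unfolding riesz_gap_def
    by (rule derivative_eq_intros 1 refl)+ (simp add: algebra_simps)
qed

lemma continuous_on_riesz_gap:
  assumes "0 < s" 
  shows "continuous_on ({0..} \<times> T) (\<lambda>(R, t). riesz_gap s a K R t)"
  unfolding riesz_gap_def case_prod_beta
  using assms by (intro continuous_intros continuous_on_powr') (auto simp: quadratic_cos_nonneg)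

text \<open>For \<open>R = 1\<close> the power with exponent \<open>s - 1\<close> in the
  \<open>t\<close>-derivative is unbounded as \<open>t\<close> approaches \<open>pi\<close>.
  Bounding its base from below by \<open>(sin t)^2\<close> leaves
  \<open>R * sin t powr (2 * s - 1)\<close>, which tends to 0 because \<open>1 < 2 * s\<close>,
  whereas \<open>K * R powr s * sin (s * t)\<close> has a positive limit. So the gap increases
  strictly just before \<open>pi\<close>.\<close>

lemma riesz_gap_not_min_pi:
  assumes s: "1/2 < s" "s < 1" and "a > 0" "K > 0" "R > 0"
  shows "\<exists>t\<in>{0..pi}. riesz_gap s a K R t < riesz_gap s a K R pi"
proof -
  have lim: "((\<lambda>t. K * R powr s * sin (s * t) - R * sin t powr (2 * s - 1)) \<longlongrightarrow>
      K * R powr s * sin (s * pi) - R * 0 powr (2 * s - 1)) (at_left pi)"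
  proof (intro tendsto_intros tendsto_powr')
    show "(sin \<longlongrightarrow> 0) (at_left pi)" using tendsto_sin[OF tendsto_ident_at, of pi "{..<pi}"] by simp
    show "0 \<noteq> (0::real) \<or> 0 < 2 * s - 1 \<and> (\<forall>\<^sub>F x in at_left pi. 0 \<le> sin x)"
      using s unfolding eventually_at_left_field by (auto intro!: exI[of _ 0] sin_ge_zero)
  qed
  have "s * pi < 1 * pi" using s by (intro mult_strict_right_mono) auto
  hence "sin (s * pi) > 0" using s by (intro sin_gt_zero) auto
  hence "\<forall>\<^sub>F t in at_left pi. 0 < K * R powr s * sin (s * t) - R * sin t powr (2 * s - 1)"
    using assms by (intro order_tendstoD(1)[OF lim]) auto
  then obtain b where b: "b < pi" "\<And>t. b < t \<Longrightarrow> t < pi \<Longrightarrow> 0 < K * R powr s * sin (s * t) - R * sin t powr (2 * s - 1)"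
    unfolding eventually_at_left_field by blast
  define c where "c = max b (pi/2)"
  have c: "b \<le> c" "0 < c" "c < pi" using b pi_gt_zero by (auto simp: c_def less_max_iff_disj)
  have "riesz_gap s a K R c < riesz_gap s a K R pi"
  proof (rule DERIV_pos_imp_increasing_open[OF c(3)])
    fix t assume t: "c < t" "t < pi"
    have st: "sin t > 0" using t c by (intro sin_gt_zero) auto
    let ?Y = "1 + R^2 + 2 * R * cos t"
    have Y: "?Y > 0" "(sin t)^2 \<le> ?Y" using quadratic_cos_pos[of t R] st by auto
    have "?Y powr (s - 1) \<le> ((sin t)^2) powr (s - 1)"
      using Y st s by (intro powr_mono2') auto
    also have "\<dots> = sin t powr (2 * (s - 1))" using st by (simp add: powr_powr flip: powr_numeral)
    finally have "?Y powr (s - 1) * sin t \<le> sin t powr (2 * (s - 1)) * sin t powr 1"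
      using st by (auto intro: mult_right_mono)
    also have "\<dots> = sin t powr (2 * s - 1)" by (subst powr_add[symmetric]) (simp add: algebra_simps)
    finally have "R * (?Y powr (s - 1) * sin t) \<le> R * sin t powr (2 * s - 1)"
      using assms by (intro mult_left_mono) auto
    hence "K * R powr s * sin (s * t) - ?Y powr (s - 1) * R * sin t > 0"
      using b(2)[of t] t c by (auto simp: algebra_simps)
    hence "2 * a * s * (K * R powr s * sin (s * t) - ?Y powr (s - 1) * R * sin t) > 0"
      using assms by (intro mult_pos_pos) auto
    with DERIV_riesz_gap_t[OF less_imp_le[OF \<open>R > 0\<close>] Y(1)]
    show "\<exists>y. (riesz_gap s a K R has_real_derivative y) (at t) \<and> 0 < y" by blast
  next
    show "continuous_on {c..pi} (riesz_gap s a K R)"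
      unfolding riesz_gap_def
      using assms by (intro continuous_intros continuous_on_powr') (auto simp: quadratic_cos_nonneg)
  qed
  thus ?thesis using c by (intro bexI[of _ c]) auto
qed

text \<open>The assumption on \<open>K\<close> says that \<open>R\<close> is stationary at
  \<open>t = 0\<close>. Inserted into the \<open>t\<close>-derivative it reduces the sign near 0 to
  the comparison of \<open>(1 + R) * sin (s * t)\<close> with \<open>sin t\<close>, hence to
  \<open>s * (1 + R) < 1\<close>, which is the assumption on \<open>R\<close>.\<close>

lemma riesz_gap_not_min_0:
  assumes s: "1/2 < s" "s < 1" and "a > 0" "R > 0"
    and K: "(1 + R) powr (2 * s - 1) * R powr (1 - s) = K" and R: "R < (1 - s) / s"
  shows "\<exists>t\<in>{0..pi}. riesz_gap s a K R t < riesz_gap s a K R 0"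
proof -
  have "s * (1 + R) < 1" using R s by (simp add: field_simps)
  have lim: "((\<lambda>t. sin t / t) \<longlongrightarrow> 1) (at_right (0::real))" by real_asymp
  have "\<forall>\<^sub>F t in at_right 0. s * (1 + R) < sin t / t"
    by (rule order_tendstoD(1)[OF lim]) fact
  then obtain b where b: "b > 0" "\<And>t. 0 < t \<Longrightarrow> t < b \<Longrightarrow> s * (1 + R) < sin t / t"
    unfolding eventually_at_right_field by blast
  define c where "c = min b (pi/2)"
  have c: "c \<le> b" "0 < c" "c < pi" using b pi_gt_zero by (auto simp: c_def min_def)
  have "riesz_gap s a K R c < riesz_gap s a K R 0"
  proof (rule DERIV_neg_imp_decreasing_open[OF c(2)])
    fix t assume t: "0 < t" "t < c"
    have st: "sin t > 0" using t c by (intro sin_gt_zero) auto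
    let ?Y = "1 + R^2 + 2 * R * cos t"
    have Y: "?Y > 0" using quadratic_cos_pos[of t R] st by auto
    have "2 * R * cos t \<le> 2 * R * 1" using assms by (intro mult_left_mono) auto
    hence "?Y \<le> (1 + R)^2" by (simp add: power2_eq_square algebra_simps)
    hence "((1 + R)^2) powr (s - 1) \<le> ?Y powr (s - 1)"
      using Y s by (intro powr_mono2') auto
    also have "((1 + R)^2) powr (s - 1) = (1 + R) powr (2 * s - 2)"
      using assms by (simp add: powr_powr algebra_simps flip: powr_numeral)
    finally have 1: "(1 + R) powr (2 * s - 2) * R * sin t \<le> ?Y powr (s - 1) * R * sin t"
      using st assms by (auto intro: mult_right_mono)
    have "sin (s * t) \<le> s * t" using t s by (intro sin_x_le_x) auto
    hence "(1 + R) * sin (s * t) \<le> (1 + R) * (s * t)"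
      using assms by (intro mult_left_mono) auto
    also have "\<dots> < sin t" using b(2)[of t] t c by (auto simp: field_simps)
    finally have "(1 + R) powr (2 * s - 2) * R * ((1 + R) * sin (s * t)) < (1 + R) powr (2 * s - 2) * R * sin t"
      using assms by (intro mult_strict_left_mono) auto
    also have "(1 + R) powr (2 * s - 2) * R * ((1 + R) * sin (s * t)) = K * R powr s * sin (s * t)"
    proof -
      have "R powr (1 - s) * R powr s = R" using assms by (simp flip: powr_add)
      moreover have "(1 + R) powr (2 * s - 1) = (1 + R) powr (2 * s - 2) * (1 + R)"
        using assms powr_add[of "1 + R" "2 * s - 2" 1] by (simp add: algebra_simps)
      moreover have "K * R powr s * sin (s * t) =
          (1 + R) powr (2 * s - 1) * (R powr (1 - s) * R powr s) * sin (s * t)"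
        unfolding K[symmetric] by (simp only: mult_ac)
      ultimately show ?thesis by (simp only: mult_ac)
    qed
    finally have "K * R powr s * sin (s * t) - ?Y powr (s - 1) * R * sin t < 0"
      using 1 by linarith
    hence "2 * a * s * (K * R powr s * sin (s * t) - ?Y powr (s - 1) * R * sin t) < 0"
      using assms by (intro mult_pos_neg mult_pos_pos) auto
    with DERIV_riesz_gap_t[OF less_imp_le[OF \<open>R > 0\<close>] Y]
    show "\<exists>y. (riesz_gap s a K R has_real_derivative y) (at t) \<and> y < 0" by blast
  next
    show "continuous_on {0..c} (riesz_gap s a K R)"
      unfolding riesz_gap_def
      using assms by (intro continuous_intros continuous_on_powr') (auto simp: quadratic_cos_nonneg)
  qed
  thus ?thesis using c by (intro bexI[of _ c]) auto
qed

text \<open>Dividing the two stationarity equations removes \<open>K\<close> and the powers and says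
  that \<open>R + cis t\<close> has argument \<open>s * t\<close>. The first two conclusions are
  then the law of sines in the triangle with vertices 0, \<open>R\<close>, \<open>R + cis t\<close>,
  whose angles at 0 and at the third vertex are \<open>s * t\<close> and \<open>(1 - s) * t\<close>;
  the last one follows by inserting them into one of the equations.\<close>

lemma riesz_gap_critical:
  assumes s: "1/2 < s" "s < 1" and "a > 0" "K > 0" "R > 0" and t: "0 < t" "t < pi"
    and dR: "(1 + R^2 + 2 * R * cos t) powr (s - 1) * (R + cos t) = K * R powr (s - 1) * cos (s * t)"
    and dt: "(1 + R^2 + 2 * R * cos t) powr (s - 1) * R * sin t = K * R powr s * sin (s * t)"
  shows "R * sin (s * t) = sin ((1 - s) * t)" 
    "(1 + R^2 + 2 * R * cos t) * (sin (s * t))^2 = (sin t)^2"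
    "ln K = crit_log s t"
proof -
  let ?Y = "1 + R^2 + 2 * R * cos t"
  have st: "s * t < pi" "(1 - s) * t < pi" using s t by (auto intro!: mult_less_pi)
  hence sp: "sin t > 0" "sin (s * t) > 0" "sin ((1 - s) * t) > 0"
    using t s by (auto intro!: sin_gt_zero)
  have Y: "?Y > 0" using quadratic_cos_pos[of t R] sp by auto
  have Rs: "R powr s = R * R powr (s - 1)" using \<open>R > 0\<close> by (simp add: powr_diff)
  have dt': "?Y powr (s - 1) * sin t = K * R powr (s - 1) * sin (s * t)"
    using dt \<open>R > 0\<close> unfolding Rs by simp
  have "(?Y powr (s - 1) * (K * R powr (s - 1))) * ((R + cos t) * sin (s * t)) =
      (?Y powr (s - 1) * (R + cos t)) * (K * R powr (s - 1) * sin (s * t))" by (simp add: mult_ac)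
  also have "\<dots> = (?Y powr (s - 1) * (K * R powr (s - 1))) * (cos (s * t) * sin t)"
    unfolding dR dt'[symmetric] by (simp add: mult_ac)
  finally have e: "(R + cos t) * sin (s * t) = cos (s * t) * sin t"
    using Y \<open>K > 0\<close> \<open>R > 0\<close> by simp
  have "sin ((1 - s) * t) = sin (t - s * t)" by (simp add: algebra_simps)
  also have "\<dots> = sin t * cos (s * t) - cos t * sin (s * t)" by (simp add: sin_diff)
  finally show R: "R * sin (s * t) = sin ((1 - s) * t)" using e by (simp add: algebra_simps)
  have "?Y * (sin (s * t))^2 = ((R + cos t) * sin (s * t))^2 + (sin t)^2 * (sin (s * t))^2"
  proof -
    have "?Y = (R + cos t)^2 + (sin t)^2"
      unfolding sin_squared_eq by (simp add: power2_eq_square algebra_simps)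
    thus ?thesis by algebra
  qed
  also have "\<dots> = (sin t)^2 * ((cos (s * t))^2 + (sin (s * t))^2)"
    unfolding e by algebra
  finally show Y2: "?Y * (sin (s * t))^2 = (sin t)^2" by simp
  have lR: "ln R = ln (sin ((1 - s) * t)) - ln (sin (s * t))"
  proof -
    have "R = sin ((1 - s) * t) / sin (s * t)" using R sp by (simp add: field_simps)
    thus ?thesis using sp by (simp add: ln_div)
  qed
  have lY: "ln ?Y = 2 * ln (sin t) - 2 * ln (sin (s * t))"
  proof -
    have "?Y = (sin t)^2 / (sin (s * t))^2" using Y2 sp by (simp add: field_simps)
    thus ?thesis using sp by (simp add: ln_div ln_realpow)
  qed
  have "ln (?Y powr (s - 1) * sin t) = ln (K * R powr (s - 1) * sin (s * t))"
    by (simp only: dt')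
  hence "(s - 1) * ln ?Y + ln (sin t) = ln K + (s - 1) * ln R + ln (sin (s * t))"
    using Y sp \<open>K > 0\<close> \<open>R > 0\<close> by (simp add: ln_mult ln_powr)
  thus "ln K = crit_log s t" unfolding lR lY crit_log_def by (simp add: algebra_simps)
qed

text \<open>Since \<open>crit_log s\<close> is injective, the only critical point is the one with \<open>t = pi / (2 * s)\<close>, where
  the gap vanishes; a negative minimum could not be attained anywhere else.\<close>

lemma riesz_gap_nonneg:
  assumes s: "1/2 < s" "s < 1" and R: "R \<ge> 0" and t: "0 \<le> t" "t \<le> pi"
    and K: "K = (- cos (pi / (2 * s))) powr (1 - s) * sin (pi / (2 * s)) powr (2 * s - 1)"
    and a: "a = sin (pi / (2 * s)) powr (- 2 * s)"
  shows "0 \<le> riesz_gap s a K R t"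
proof -
  define \<theta> where "\<theta> = pi / (2 * s)"
  have th: "pi / 2 < \<theta>" "\<theta> < pi" "s * \<theta> = pi / 2" "(1 - s) * \<theta> = \<theta> - pi / 2"
    using s by (auto simp: \<theta>_def field_simps)
  have cs: "cos \<theta> < 0" "sin \<theta> > 0"
    using th(1,2) cos_lt_zero_pi[of \<theta>] by (auto intro!: sin_gt_zero)
  have sin1: "sin ((1 - s) * \<theta>) = - cos \<theta>" unfolding th(4) by (simp add: sin_diff)
  have K': "K = (- cos \<theta>) powr (1 - s) * sin \<theta> powr (2 * s - 1)" and a': "a = sin \<theta> powr (- 2 * s)"
    using K a by (auto simp: \<theta>_def)
  have Kpos: "K > 0" and apos: "a > 0" using cs by (auto simp: K' a')
  have a1: "a \<ge> 1"
  proof -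
    have "sin \<theta> powr (- 2 * s) \<ge> 1 powr (- 2 * s)" using cs s by (intro powr_mono2') auto
    thus ?thesis by (simp add: a')
  qed
  have lnK: "ln K = crit_log s \<theta>"
    using cs unfolding K' crit_log_def th(3) sin1 by (simp add: ln_mult ln_powr)
  define b where "b = 2 * a * K"
  have bpos: "b > 0" using Kpos apos by (simp add: b_def)
  \<comment> \<open>A bound for the radii to be searched: at \<open>R = M\<close> the power in the
    gap is at least \<open>b * M powr s + 1\<close> and outweighs the other two terms, so a negative
    minimum over the box does not lie on that edge. The given \<open>R\<close> stays inside.\<close>
  define M where "M = max (R + 1) (max 2 ((4 * (b + 1)) powr (1 / s)))"
  have M: "M \<ge> 2" "M > R" "M powr s \<ge> 4 * (b + 1)"
  proof -
    have "((4 * (b + 1)) powr (1 / s)) powr s \<le> M powr s"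
      using s by (intro powr_mono2) (auto simp: M_def)
    thus "M powr s \<ge> 4 * (b + 1)" using s bpos by (simp add: powr_powr)
  qed (auto simp: M_def)
  have "compact ({0..M} \<times> {0..pi})" by (intro compact_Times compact_Icc)
  moreover have "continuous_on ({0..M} \<times> {0..pi}) (\<lambda>(R, t). riesz_gap s a K R t)"
    by (rule continuous_on_subset[OF continuous_on_riesz_gap]) (use s in auto)
  ultimately obtain z where z: "z \<in> {0..M} \<times> {0..pi}"
    "\<forall>y\<in>{0..M} \<times> {0..pi}. (\<lambda>(R, t). riesz_gap s a K R t) z \<le> (\<lambda>(R, t). riesz_gap s a K R t) y"
    using continuous_attains_inf[of "{0..M} \<times> {0..pi}" "\<lambda>(R, t). riesz_gap s a K R t"] M by force
  obtain r u where zz: "z = (r, u)" by (cases z)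
  have ru: "0 \<le> r" "r \<le> M" "0 \<le> u" "u \<le> pi" using z zz by auto
  have min: "riesz_gap s a K r u \<le> riesz_gap s a K R' t'" if "0 \<le> R'" "R' \<le> M" "0 \<le> t'" "t' \<le> pi" for R' t'
    using z(2) that unfolding zz by auto
  have "0 \<le> riesz_gap s a K r u"
  proof (rule ccontr)
    assume neg: "\<not> 0 \<le> riesz_gap s a K r u"
    have r0: "r \<noteq> 0" using neg s a1 by (auto simp: riesz_gap_def)
    have rM: "r \<noteq> M"
    proof
      assume "r = M"
      have "(M - 1)^2 \<le> 1 + M^2 + 2 * M * cos u"
      proof -
        have "2 * M * cos u \<ge> 2 * M * (-1)" using M by (intro mult_left_mono) auto
        thus ?thesis by (simp add: power2_eq_square algebra_simps)
      qed
      moreover have "(M / 2)^2 \<le> (M - 1)^2" using M by (intro power_mono) auto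
      ultimately have "((M / 2)^2) powr s \<le> (1 + M^2 + 2 * M * cos u) powr s"
        using s by (intro powr_mono2) auto
      moreover have "((M / 2)^2) powr s = M powr s * M powr s / 4 powr s"
        using M by (simp add: powr_divide power_divide powr_powr power2_eq_square powr_mult)
      moreover have "M powr s * M powr s / 4 powr s \<ge> M powr s * (4 * (b + 1)) / 4"
      proof -
        have "4 powr s \<le> 4 powr (1::real)" using s by (intro powr_mono) auto
        hence "4 powr s \<le> (4::real)" by simp
        thus ?thesis using M s bpos by (intro frac_le mult_left_mono) auto
      qed
      ultimately have "(1 + M^2 + 2 * M * cos u) powr s \<ge> M powr s * (4 * (b + 1)) / 4"
        by linarith
      hence "(1 + M^2 + 2 * M * cos u) powr s \<ge> M powr s * (b + 1)" by (simp add: algebra_simps)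
      moreover have "M powr s \<ge> 1" using M bpos by simp
      ultimately have "(1 + M^2 + 2 * M * cos u) powr s \<ge> M powr s * b + 1" by (simp add: algebra_simps)
      moreover have "a * (1 + M^2 + 2 * M * cos u) powr s \<ge> 1 * (1 + M^2 + 2 * M * cos u) powr s"
        using a1 by (intro mult_right_mono) auto
      moreover have "b * (M powr s * cos (s * u)) \<le> b * (M powr s * 1)"
        using bpos by (intro mult_left_mono) auto
      ultimately have "0 \<le> riesz_gap s a K M u"
        by (simp add: riesz_gap_def b_def algebra_simps)
      thus False using neg \<open>r = M\<close> by simp
    qed
    have r: "0 < r" "r < M" using ru r0 rM by auto
    have u_pi: "u \<noteq> pi"
      using riesz_gap_not_min_pi[OF s apos Kpos r(1)] min ru by (auto simp: not_less[symmetric])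
    have local_R: "D = 0" if "((\<lambda>R. riesz_gap s a K R u) has_real_derivative D) (at r)" for D
    proof (rule DERIV_local_min[OF that, of "min r (M - r)"])
      show "\<forall>y. \<bar>r - y\<bar> < min r (M - r) \<longrightarrow> riesz_gap s a K r u \<le> riesz_gap s a K y u"
        using ru by (auto intro!: min)
    qed (use r in auto)
    have u_0: "u \<noteq> 0"
    proof
      assume u: "u = 0"
      have "2 * a * s * ((1 + r^2 + 2 * r * cos 0) powr (s - 1) * (r + cos 0) - K * r powr (s - 1) * cos (s * 0)) = 0"
      proof (rule local_R)
        have "0 < 1 + r^2 + 2 * r * cos 0" using r by (simp add: add_pos_pos)
        from DERIV_riesz_gap_R[OF r(1) this] show "((\<lambda>R. riesz_gap s a K R u) has_real_derivative
            2 * a * s * ((1 + r^2 + 2 * r * cos 0) powr (s - 1) * (r + cos 0) - K * r powr (s - 1) * cos (s * 0))) (at r)"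
          unfolding u .
      qed
      hence "(1 + r^2 + 2 * r * cos 0) powr (s - 1) * (r + cos 0) = K * r powr (s - 1) * cos (s * 0)"
        using apos s by simp
      moreover have "1 + r^2 + 2 * r * cos 0 = (1 + r)^2"
        by (simp add: power2_eq_square algebra_simps)
      ultimately have "((1 + r)^2) powr (s - 1) * (1 + r) = K * r powr (s - 1)"
        by (simp add: add.commute)
      moreover have "((1 + r)^2) powr (s - 1) * (1 + r) = (1 + r) powr (2 * s - 1)"
        using r powr_add[of "1 + r" "2 * s - 2" 1] by (simp add: powr_powr algebra_simps flip: powr_numeral)
      ultimately have e: "(1 + r) powr (2 * s - 1) * r powr (1 - s) = K"
        using r by (simp add: mult.assoc flip: powr_add)
      \<comment> \<open>The function \<open>(1 + r) powr (2 * s - 1) * r powr (1 - s)\<close>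
        increases with \<open>r\<close>, and at \<open>r = (1 - s) / s\<close> its logarithm is the
        limit of \<open>crit_log s\<close> at 0. As \<open>ln K\<close> lies below this limit,
        \<open>r\<close> lies below \<open>(1 - s) / s\<close>.\<close>
      have lt: "ln K < (1 - s) * ln (1 - s) - s * ln s"
        unfolding lnK by (rule crit_log_less_limit) (use s th(1,2) pi_gt_zero in \<open>auto intro: less_trans[of 0 "pi/2"]\<close>)
      have "r < (1 - s) / s"
      proof (rule ccontr)
        assume "\<not> r < (1 - s) / s"
        hence ge: "(1 - s) / s \<le> r" by simp
        have "ln ((1 - s) / s) \<le> ln r" using ge s by (subst ln_le_cancel_iff) (use r in auto)
        moreover have "ln (1 / s) \<le> ln (1 + r)"
          using ge s r by (subst ln_le_cancel_iff) (auto simp: field_simps)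
        ultimately have "(2 * s - 1) * ln (1 / s) + (1 - s) * ln ((1 - s) / s) \<le> (2 * s - 1) * ln (1 + r) + (1 - s) * ln r"
          using s by (intro add_mono mult_left_mono) auto
        also have "\<dots> = ln K" using r by (simp add: ln_mult ln_powr flip: e)
        finally show False using lt s by (simp add: ln_div algebra_simps)
      qed
      from riesz_gap_not_min_0[OF s apos r(1) e this] show False
        using min ru u by (auto simp: not_less[symmetric])
    qed
    have u: "0 < u" "u < pi" using ru u_0 u_pi by auto
    hence su: "sin u > 0" by (intro sin_gt_zero)
    have Y: "0 < 1 + r^2 + 2 * r * cos u" using quadratic_cos_pos[of u r] su by auto
    have "2 * a * s * ((1 + r^2 + 2 * r * cos u) powr (s - 1) * (r + cos u) - K * r powr (s - 1) * cos (s * u)) = 0"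
      by (rule local_R) (rule DERIV_riesz_gap_R[OF r(1) Y])
    hence dR: "(1 + r^2 + 2 * r * cos u) powr (s - 1) * (r + cos u) = K * r powr (s - 1) * cos (s * u)"
      using apos s by simp
    have "2 * a * s * (K * r powr s * sin (s * u) - (1 + r^2 + 2 * r * cos u) powr (s - 1) * r * sin u) = 0"
    proof (rule DERIV_local_min[OF DERIV_riesz_gap_t[OF ru(1) Y], of "min u (pi - u)"])
      show "\<forall>y. \<bar>u - y\<bar> < min u (pi - u) \<longrightarrow> riesz_gap s a K r u \<le> riesz_gap s a K r y"
        using ru by (auto intro!: min)
    qed (use u in auto)
    hence dt: "(1 + r^2 + 2 * r * cos u) powr (s - 1) * r * sin u = K * r powr s * sin (s * u)"
      using apos s by simp
    note crit = riesz_gap_critical[OF s apos Kpos r(1) u dR dt]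
    have "u = \<theta>"
      using crit(3) lnK crit_log_less[OF s u(1), of \<theta>] crit_log_less[OF s, of \<theta> u] th(1,2) pi_gt_zero u
      by (cases u \<theta> rule: linorder_cases) auto
    hence "1 + r^2 + 2 * r * cos u = (sin \<theta>)^2" "cos (s * u) = 0"
      using crit(2) unfolding \<open>u = \<theta>\<close> th(3) by auto
    hence "riesz_gap s a K r u = 0"
      using cs by (simp add: riesz_gap_def a' powr_powr powr_add[symmetric] flip: powr_numeral)
    thus False using neg by simp
  qed
  also have "riesz_gap s a K r u \<le> riesz_gap s a K R t"
    by (rule min) (use R M t in auto)
  finally show ?thesis .
qed

text \<open>The real part of the principal branch of \<open>u\<^sup>s\<close>: \<open>arccos (Re u / norm u)\<close> is the modulus of the
  argument of \<open>u\<close>.\<close>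

definition Re_powr :: "real \<Rightarrow> complex \<Rightarrow> real" where
  "Re_powr s u = norm u powr s * cos (s * arccos (Re u / norm u))"

text \<open>Both sides are homogeneous of degree \<open>p\<close> and depend only on the two moduli
  and the angle of \<open>w * z\<close>, so division by \<open>norm w powr p\<close> leaves
  \<open>riesz_gap\<close>. The size of \<open>b\<close> is irrelevant later, only its sign matters.
  For \<open>p = 2\<close>, outside the range \<open>s < 1\<close> of the general argument, the
  claim is the expansion of the square of \<open>norm (w + cnj z)\<close>, with
  \<open>b = 2\<close>.\<close>

lemma riesz_pointwise:
  assumes p: "1 < p" "p \<le> 2"
  shows "\<exists>b\<ge>0. \<forall>w z. norm w powr p \<le> (1 / sin (pi / p)) powr p * norm (w + cnj z) powr p - b * Re_powr (p / 2) (w * z)"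
proof -
  have abs_div: "\<bar>Re u / norm u\<bar> \<le> 1" for u :: complex
    using abs_Re_le_cmod[of u] by (auto simp: divide_le_eq_1)
  have norm_sum: "(norm (w + cnj z))^2 = norm w^2 + norm z^2 + 2 * Re (w * z)" for w z
    unfolding cmod_power2 by (simp add: power2_eq_square algebra_simps)
  show ?thesis
  proof (cases "p = 2")
    case True
    have "norm w powr 2 \<le> 1 * norm (w + cnj z) powr 2 - 2 * Re_powr 1 (w * z)" for w z :: complex
    proof -
      have "Re_powr 1 (w * z) = Re (w * z)"
        using abs_div[of "w * z"] by (auto simp: Re_powr_def cos_arccos_abs)
      thus ?thesis using norm_sum[of w z] by simp
    qed
    thus ?thesis using True by (intro exI[of _ 2]) auto
  next
    case False
    define s where "s = p / 2"
    have s: "1/2 < s" "s < 1" "2 * s = p" using p False by (auto simp: s_def)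
    define K where "K = (- cos (pi / (2 * s))) powr (1 - s) * sin (pi / (2 * s)) powr (2 * s - 1)"
    define a where "a = sin (pi / (2 * s)) powr (- 2 * s)"
    have "sin (pi / p) > 0" using p by (intro sin_gt_zero) (auto simp: field_simps)
    hence a: "a = (1 / sin (pi / p)) powr p" "a \<ge> 1"
      using p s by (auto simp: a_def powr_minus_divide powr_divide intro!: powr_le1)
    have K0: "K \<ge> 0" by (simp add: K_def)
    have "norm w powr p \<le> a * norm (w + cnj z) powr p - 2 * a * K * Re_powr s (w * z)" for w z :: complex
    proof (cases "w = 0")
      case True
      thus ?thesis using p a by (simp add: Re_powr_def)
    next
      case False
      define R where "R = norm z / norm w"
      define t where "t = arccos (Re (w * z) / norm (w * z))"
      have t: "0 \<le> t" "t \<le> pi" and ct: "cos t = Re (w * z) / norm (w * z)"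
        using abs_div[of "w * z"] unfolding t_def
        by (simp_all only: arccos_lbound arccos_ubound cos_arccos_abs abs_le_iff minus_le_iff)
      have "0 \<le> riesz_gap s a K R t"
        by (rule riesz_gap_nonneg[OF s(1,2) _ t K_def a_def]) (simp add: R_def)
      hence "0 \<le> norm w powr p * riesz_gap s a K R t" by simp
      also have "\<dots> = a * (norm w powr p * (1 + R^2 + 2 * R * cos t) powr s) - 2 * a * K * (norm w powr p * R powr s * cos (s * t)) - norm w powr p"
        by (simp add: riesz_gap_def algebra_simps)
      also have "norm w powr p * (1 + R^2 + 2 * R * cos t) powr s = norm (w + cnj z) powr p"
      proof -
        have e: "norm w^2 * (1 + R^2 + 2 * R * cos t) = norm (w + cnj z)^2"
        proof -
          have "norm w^2 * (2 * R * (x / norm (w * z))) = 2 * x" if "z = 0 \<longrightarrow> x = 0" for x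
            using False that unfolding R_def by (cases "z = 0") (auto simp: field_simps power2_eq_square norm_mult)
          from this[of "Re (w * z)"] have "norm w^2 * (2 * R * cos t) = 2 * Re (w * z)"
            unfolding ct by simp
          moreover have "norm w^2 * R^2 = norm z^2" using False by (simp add: R_def power_divide)
          ultimately show ?thesis unfolding norm_sum by (simp only: distrib_left mult_1_right)
        qed
        have "norm w powr p = (norm w^2) powr s" "norm (w + cnj z) powr p = (norm (w + cnj z)^2) powr s"
          by (auto simp: powr_powr s(3) simp flip: powr_numeral)
        thus ?thesis unfolding e[symmetric] using quadratic_cos_nonneg[of R t] by (simp add: powr_mult)
      qed
      also have "norm w powr p * R powr s * cos (s * t) = Re_powr s (w * z)"
      proof -
        have "norm w powr p = norm w powr s * norm w powr s"
          unfolding s(3)[symmetric] by (simp flip: powr_add)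
        moreover have "norm w powr s \<noteq> 0" using False by simp
        ultimately show ?thesis unfolding Re_powr_def t_def[symmetric] R_def
          by (simp add: powr_divide norm_mult powr_mult)
      qed
      finally show ?thesis by simp
    qed
    thus ?thesis unfolding a s_def using K0 a by (intro exI[of _ "2 * a * K"]) auto
  qed
qed

section \<open>Subharmonicity of the real power\<close>

text \<open>Among the arguments of a number the one of least modulus, here
  \<open>arccos (cos t)\<close>, gives the largest cosine after multiplication by \<open>s\<close>.
  This uses \<open>s \<le> 1\<close>: the competing angles \<open>s * v\<close> and
  \<open>s * (2 * pi - v)\<close> add up to at most \<open>2 * pi\<close>. The range of
  \<open>t\<close> is that of a sum of two principal arguments.\<close>

lemma cos_mult_le_cos_mult_arccos_cos:
  fixes s t :: real
  assumes s: "0 < s" "s \<le> 1" and t: "\<bar>t\<bar> \<le> 2 * pi"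
  shows "cos (s * t) \<le> cos (s * arccos (cos t))"
proof (cases "\<bar>t\<bar> \<le> pi")
  case True
  hence "arccos (cos t) = \<bar>t\<bar>" using arccos_cos[of "\<bar>t\<bar>"] by simp
  moreover have "cos (s * \<bar>t\<bar>) = cos (s * t)" by (simp add: abs_if)
  ultimately show ?thesis by simp
next
  case False
  define v where "v = \<bar>t\<bar>"
  have v: "pi < v" "v \<le> 2 * pi" using False t by (auto simp: v_def)
  have "cos t = cos (2 * pi - v)" by (simp add: v_def cos_diff)
  hence ac: "arccos (cos t) = 2 * pi - v" using v arccos_cos[of "2 * pi - v"] by simp
  have ct: "cos (s * t) = cos (s * v)"
    by (simp add: v_def abs_if)
  have sv: "s * (2 * pi - v) \<le> s * v" "s * (2 * pi - v) + s * v \<le> 2 * pi" "0 \<le> s * (2 * pi - v)"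
    using s v by (auto simp: algebra_simps)
  show ?thesis
  proof (cases "s * v \<le> pi")
    case True
    thus ?thesis unfolding ac ct using sv by (intro cos_monotone_0_pi_le) auto
  next
    case False
    have "cos (s * v) = cos (2 * pi - s * v)" by (simp add: cos_diff)
    also have "\<dots> \<le> cos (s * (2 * pi - v))"
      using sv False by (intro cos_monotone_0_pi_le) auto
    finally show ?thesis unfolding ac ct .
  qed
qed

lemma Re_powr_exp:
  "Re_powr s (exp l) = exp (s * Re l) * cos (s * arccos (cos (Im l)))"
  by (simp add: Re_powr_def norm_exp_eq_Re Re_exp exp_powr_real mult.commute)

lemma Re_exp_mult_le_Re_powr:
  assumes "0 < s" "s \<le> 1" "\<bar>Im l\<bar> \<le> 2 * pi"
  shows "Re (exp (of_real s * l)) \<le> Re_powr s (exp l)"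
  using cos_mult_le_cos_mult_arccos_cos[OF assms] by (simp add: Re_powr_exp Re_exp)

lemma Re_powr_exp_eq:
  assumes "\<bar>Im l\<bar> \<le> pi"
  shows "Re_powr s (exp l) = Re (exp (of_real s * l))"
proof -
  have "arccos (cos (Im l)) = \<bar>Im l\<bar>" using assms arccos_cos[of "\<bar>Im l\<bar>"] by simp
  moreover have "cos (s * \<bar>Im l\<bar>) = cos (s * Im l)" by (simp add: abs_if)
  ultimately show ?thesis by (simp add: Re_powr_exp Re_exp)
qed

lemma abs_Re_powr_le: "\<bar>Re_powr s u\<bar> \<le> norm u powr s"
  by (simp add: Re_powr_def abs_mult mult_left_le)

lemma Re_powr_0 [simp]: "Re_powr s 0 = 0"
  by (simp add: Re_powr_def)

text \<open>Only the modulus of the argument enters, so nothing jumps across the negative axis; at 0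
  the bound by \<open>norm u powr s\<close> decides.\<close>

lemma continuous_on_Re_powr:
  assumes "0 < s"
  shows "continuous_on A (Re_powr s)"
proof -
  have "isCont (Re_powr s) u" for u
  proof (cases "u = 0")
    case True
    have "((\<lambda>u::complex. norm u powr s) \<longlongrightarrow> norm (0::complex) powr s) (at 0)"
      using assms by (intro tendsto_powr' tendsto_intros) auto
    hence "((\<lambda>u::complex. norm u powr s) \<longlongrightarrow> 0) (at 0)" by simp
    hence "(Re_powr s \<longlongrightarrow> 0) (at 0)"
      by (rule Lim_null_comparison[rotated]) (simp add: abs_Re_powr_le)
    thus ?thesis using True by (simp add: isCont_def)
  next
    case False
    have "continuous_on (- {0}) (Re_powr s)"
      unfolding Re_powr_def using assms
      by (intro continuous_intros continuous_on_powr' ballI)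
         (use abs_Re_le_cmod in \<open>auto simp: divide_le_eq le_divide_eq abs_le_iff minus_le_iff\<close>)
    thus ?thesis using False by (simp add: continuous_on_eq_continuous_at open_Compl)
  qed
  thus ?thesis by (simp add: continuous_at_imp_continuous_on)
qed

text \<open>At a zero-free point, \<open>Re_powr s (h z)\<close> dominates the real part of a local holomorphic
  branch of \<open>h powr s\<close> and agrees with it at the point itself, so adding the strictly convex term
  \<open>\<eta> * (norm z)\<^sup>2\<close> excludes a local maximum.\<close>

lemma no_interior_max_Re_powr:
  assumes s: "0 < s" "s \<le> 1" and \<eta>: "\<eta> > 0"
    and h: "h holomorphic_on UNIV" and p: "p holomorphic_on UNIV" and z0: "h z0 \<noteq> 0" and r: "r > 0"
  shows "\<exists>z\<in>ball z0 r. h z \<noteq> 0 \<and>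
    Re_powr s (h z0) - Re (p z0) + \<eta> * (norm z0)^2 + \<delta> * ln (norm (h z0)) <
    Re_powr s (h z) - Re (p z) + \<eta> * (norm z)^2 + \<delta> * ln (norm (h z))"
proof (rule ccontr)
  assume contra: "\<not> ?thesis"
  define V where "V z = Re_powr s (h z) - Re (p z) + \<eta> * (norm z)^2 + \<delta> * ln (norm (h z))" for z
  have V_le: "V z \<le> V z0" if "z \<in> ball z0 r" "h z \<noteq> 0" for z
    using contra that by (auto simp: V_def not_less[symmetric])
  have cont: "continuous_on UNIV h" using h by (rule holomorphic_on_imp_continuous_on)
  hence "isCont h z0" by (simp add: continuous_on_eq_continuous_at)
  hence "isCont (\<lambda>z. Re (h z / h z0)) z0"
    using z0 by (auto intro!: continuous_intros)
  hence "((\<lambda>z. Re (h z / h z0)) \<longlongrightarrow> Re (h z0 / h z0)) (nhds z0)"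
    by (simp only: isCont_def tendsto_at_iff_tendsto_nhds[of "\<lambda>z. Re (h z / h z0)" z0])
  hence "\<forall>\<^sub>F z in nhds z0. 0 < Re (h z / h z0)"
    by (rule order_tendstoD(1)) (use z0 in simp)
  then obtain r' where r': "r' > 0" "\<And>z. dist z z0 < r' \<Longrightarrow> 0 < Re (h z / h z0)"
    unfolding eventually_nhds_metric by blast
  define B where "B = ball z0 (min r r')"
  have B: "z0 \<in> B" "B \<subseteq> ball z0 r" "\<And>z. z \<in> B \<Longrightarrow> 0 < Re (h z / h z0)" "open B" "connected B"
    using r r' by (auto simp: B_def dist_commute)
  have hB: "h z \<noteq> 0" if "z \<in> B" for z using B(3)[OF that] by auto
  \<comment> \<open>Near \<open>z0\<close> the quotient \<open>h z / h z0\<close> stays in the right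
    half-plane, so its principal logarithm is holomorphic, which \<open>Ln (h z)\<close> might not
    be. The price is an imaginary part of modulus up to \<open>2 * pi\<close>.\<close>
  define l where "l z = Ln (h z / h z0) + Ln (h z0)" for z
  have expl: "exp (l z) = h z" if "z \<in> B" for z
    using z0 hB[OF that] by (simp add: l_def exp_add)
  have Iml: "\<bar>Im (l z)\<bar> \<le> 2 * pi" if "z \<in> B" for z
  proof -
    have "\<bar>Im (Ln (h z / h z0))\<bar> \<le> pi" "\<bar>Im (Ln (h z0))\<bar> \<le> pi"
      using z0 hB[OF that] mpi_less_Im_Ln[of "h z / h z0"] Im_Ln_le_pi[of "h z / h z0"]
        mpi_less_Im_Ln[of "h z0"] Im_Ln_le_pi[of "h z0"] by (auto simp: abs_le_iff)
    thus ?thesis by (simp add: l_def)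
  qed
  have Iml0: "\<bar>Im (l z0)\<bar> \<le> pi"
    using z0 mpi_less_Im_Ln[OF z0] Im_Ln_le_pi[OF z0] by (simp add: l_def)
  have holl: "l holomorphic_on B"
    unfolding l_def using z0 B(3)
    by (intro holomorphic_intros holomorphic_on_subset[OF h]) (force simp: complex_nonpos_Reals_iff)+
  \<comment> \<open>In \<open>(norm z)^2 - (norm z0)^2 = 2 * Re (cnj z0 * (z - z0)) + (norm (z -
    z0))^2\<close> the linear part is harmonic and is absorbed into the holomorphic
    \<open>c\<close>. The quadratic rest contradicts the constancy of \<open>exp (c z)\<close> that
    the maximum modulus principle yields.\<close>
  define c where "c z = exp (of_real s * l z) - p z + of_real \<delta> * l z + of_real (2 * \<eta>) * cnj z0 * (z - z0)" for z
  have Rec_le: "Re (c z) + \<eta> * (norm (z - z0))^2 \<le> Re (c z0)" if z: "z \<in> B" for z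
  proof -
    have Rel: "Re (l w) = ln (norm (h w))" if "w \<in> B" for w
      using expl[OF that] by (metis norm_exp_eq_Re ln_exp)
    define D where "D = Re (cnj z0 * (z - z0))"
    have "(norm z)^2 - (norm z0)^2 = 2 * D + (norm (z - z0))^2"
      unfolding cmod_power2 D_def by (simp add: power2_eq_square algebra_simps)
    moreover have "Re (c z) = Re (exp (of_real s * l z)) - Re (p z) + \<delta> * ln (norm (h z)) + 2 * \<eta> * D"
      by (simp add: c_def D_def Rel[OF z] algebra_simps)
    ultimately have "Re (c z) + \<eta> * (norm (z - z0))^2 =
      Re (exp (of_real s * l z)) - Re (p z) + \<delta> * ln (norm (h z)) + \<eta> * ((norm z)^2 - (norm z0)^2)"
      by (simp add: distrib_left)
    also have "\<dots> \<le> V z - \<eta> * (norm z0)^2"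
      using Re_exp_mult_le_Re_powr[OF s Iml[OF z]] by (simp add: V_def expl[OF z] algebra_simps)
    also have "\<dots> \<le> V z0 - \<eta> * (norm z0)^2" using V_le B hB z by auto
    also have "\<dots> = Re (c z0)"
      using Re_powr_exp_eq[OF Iml0, of s] by (simp add: V_def c_def expl[OF B(1)] Rel[OF B(1)])
    finally show ?thesis .
  qed
  have "(\<lambda>z. exp (c z)) constant_on B"
  proof (rule maximum_modulus_principle[OF _ B(4,5) B(4) subset_refl B(1)])
    show "(\<lambda>z. exp (c z)) holomorphic_on B"
      unfolding c_def by (intro holomorphic_intros holl holomorphic_on_subset[OF p]) auto
    show "norm (exp (c z)) \<le> norm (exp (c z0))" if "z \<in> B" for z
      using Rec_le[OF that] \<eta> by (simp add: norm_exp_eq_Re) (smt (verit) zero_le_mult_iff zero_le_power2)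
  qed
  then obtain k where k: "\<And>z. z \<in> B \<Longrightarrow> exp (c z) = k" by (auto simp: constant_on_def)
  define z where "z = z0 + of_real (min r r' / 2)"
  have z: "z \<in> B" "z \<noteq> z0" using r r' by (auto simp: B_def z_def dist_norm)
  have "Re (c z) = Re (c z0)" using k[OF z(1)] k[OF B(1)] by (metis norm_exp_eq_Re ln_exp)
  moreover have "0 < \<eta> * (norm (z - z0))^2" using z \<eta> by simp
  ultimately show False using Rec_le[OF z(1)] by simp
qed

text \<open>\<open>Re_powr s\<close> of \<open>h\<close> is 0 at the origin, so this is the maximum
  principle for its difference from \<open>Re (p z)\<close>. At zeros of \<open>h\<close> there is
  no holomorphic branch; adding \<open>\<delta> * ln (norm (h z))\<close> keeps the maximum away
  from them, at a cost that vanishes with \<open>\<delta>\<close>. The origin is itself a zero and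
  is reached by continuity, zeros being isolated.\<close>

lemma Re_powr_submean:
  assumes s: "0 < s" "s \<le> 1" and h: "h holomorphic_on UNIV" and p: "p holomorphic_on UNIV"
    and h0: "h 0 = 0" and le: "\<And>z. norm z = 1 \<Longrightarrow> Re_powr s (h z) \<le> Re (p z) + \<epsilon>"
  shows "- \<epsilon> \<le> Re (p 0)"
proof (cases "\<forall>z\<in>ball 0 1. h z = 0")
  case True
  have "h z = 0" if "z \<in> cball 0 1" for z
  proof (rule continuous_constant_on_closure[of "ball 0 1" h 0 z])
    show "continuous_on (closure (ball 0 1)) h"
      using h by (meson holomorphic_on_imp_continuous_on continuous_on_subset subset_UNIV)
  qed (use that True in auto)
  hence fr: "- Re (p z) \<le> \<epsilon>" if "norm z = 1" for z using le[OF that] that by auto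
  have "Re (- p 0) \<le> \<epsilon>"
  proof (rule maximum_real_frontier[of "\<lambda>z. - p z" "cball 0 1"])
    have "(\<lambda>z. - p z) holomorphic_on UNIV" using p by (intro holomorphic_intros)
    thus "(\<lambda>z. - p z) holomorphic_on interior (cball 0 1)" "continuous_on (closure (cball 0 1)) (\<lambda>z. - p z)"
      by (meson holomorphic_on_imp_continuous_on continuous_on_subset holomorphic_on_subset subset_UNIV)+
    show "Re (- p z) \<le> \<epsilon>" if "z \<in> frontier (cball 0 1)" for z
      using fr[of z] that by simp
  qed auto
  thus ?thesis by simp
next
  case False
  then obtain z1 where z1: "z1 \<in> ball 0 1" "h z1 \<noteq> 0" by auto
  have conth: "continuous_on A h" and contp: "continuous_on A p" for A
    using h p by (meson holomorphic_on_imp_continuous_on continuous_on_subset subset_UNIV)+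
  define V where "V z = Re_powr s (h z) - Re (p z)" for z
  have contV: "continuous_on A V" for A
    unfolding V_def
    by (intro continuous_intros conth contp continuous_on_compose2[OF continuous_on_Re_powr[OF s(1)] conth]) auto
  obtain K where K: "\<And>z. z \<in> cball 0 1 \<Longrightarrow> norm (h z) \<le> K"
    using compact_imp_bounded[OF compact_continuous_image[OF conth compact_cball[of 0 1]]]
    by (metis bounded_iff image_eqI)
  have K0: "K > 0" using K[of z1] z1 by (auto intro: less_le_trans[of 0 "norm (h z1)"])
  have bound: "V z + \<delta> * ln (norm (h z)) \<le> \<epsilon> + \<eta> + \<delta> * ln K"
    if z: "z \<in> cball 0 1" "h z \<noteq> 0" and de: "\<delta> > 0" "\<eta> > 0" for z \<delta> \<eta>
  proof -
    \<comment> \<open>Exponentiating turns the logarithmic singularities at the zeros of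
      \<open>h\<close> into the continuous value 0. So a maximum over the disc exists, and since
      \<open>h z \<noteq> 0\<close> it is positive and not attained at a zero.\<close>
    define E where "E z = exp (V z + \<eta> * (norm z)^2) * norm (h z) powr \<delta>" for z
    have "continuous_on (cball 0 1) E"
      unfolding E_def using de(1) by (intro continuous_intros contV conth continuous_on_powr') auto
    then obtain z0 where z0: "z0 \<in> cball 0 1" "\<And>z. z \<in> cball 0 1 \<Longrightarrow> E z \<le> E z0"
      using continuous_attains_sup[of "cball 0 1" E] by auto
    have hz0: "h z0 \<noteq> 0"
      using z0(2)[OF z(1)] z(2) by (auto simp: E_def mult_le_0_iff)
    have E: "E w = exp (V w + \<eta> * (norm w)^2 + \<delta> * ln (norm (h w)))" if "h w \<noteq> 0" for w
      using that by (simp add: E_def powr_def exp_add)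
    have "norm z0 = 1"
    proof (rule ccontr)
      assume "norm z0 \<noteq> 1"
      hence r: "1 - norm z0 > 0" using z0(1) by simp
      obtain w where w: "w \<in> ball z0 (1 - norm z0)" "h w \<noteq> 0"
        "Re_powr s (h z0) - Re (p z0) + \<eta> * (norm z0)^2 + \<delta> * ln (norm (h z0)) <
         Re_powr s (h w) - Re (p w) + \<eta> * (norm w)^2 + \<delta> * ln (norm (h w))"
        using no_interior_max_Re_powr[OF s de(2) h p hz0 r] by blast
      have "norm w \<le> norm z0 + dist z0 w" by (metis dist_commute dist_norm norm_triangle_sub)
      hence "w \<in> cball 0 1" using w(1) by simp
      thus False using z0(2)[of w] w(2,3) by (simp add: E hz0 V_def)
    qed
    have "E z \<le> E z0" by (rule z0(2)[OF z(1)])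
    hence "V z + \<eta> * (norm z)^2 + \<delta> * ln (norm (h z)) \<le> V z0 + \<eta> * (norm z0)^2 + \<delta> * ln (norm (h z0))"
      using z hz0 by (simp add: E)
    also have "\<dots> \<le> \<epsilon> + \<eta> + \<delta> * ln K"
      using le[OF \<open>norm z0 = 1\<close>] K[OF z0(1)] K0 hz0 de \<open>norm z0 = 1\<close> by (simp add: V_def add_mono)
    finally show ?thesis using de by (smt (verit) zero_le_power2 mult_nonneg_nonneg)
  qed
  have V_le: "V z \<le> \<epsilon>" if z: "z \<in> cball 0 1" "h z \<noteq> 0" for z
  proof (rule tendsto_lowerbound)
    have "((\<lambda>\<delta>. \<epsilon> + \<delta> + \<delta> * ln K - \<delta> * ln (norm (h z))) \<longlongrightarrow> \<epsilon> + 0 + 0 * ln K - 0 * ln (norm (h z))) (at_right 0)"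
      by (intro tendsto_intros)
    thus "((\<lambda>\<delta>. \<epsilon> + \<delta> + \<delta> * ln K - \<delta> * ln (norm (h z))) \<longlongrightarrow> \<epsilon>) (at_right 0)" by simp
    show "\<forall>\<^sub>F \<delta> in at_right 0. V z \<le> \<epsilon> + \<delta> + \<delta> * ln K - \<delta> * ln (norm (h z))"
      using bound[OF z] by (intro eventually_at_right_less[THEN eventually_mono]) (fastforce simp: algebra_simps)
  qed auto
  obtain r where r: "0 < r" "\<And>z. z \<in> ball 0 r - {0} \<Longrightarrow> h z \<noteq> 0"
    using isolated_zeros[OF h open_UNIV connected_UNIV _ h0 _ z1(2)] by auto
  have "V 0 \<le> \<epsilon>"
  proof (rule tendsto_upperbound)
    show "(V \<longlongrightarrow> V 0) (at 0)" using contV[of UNIV] by (simp add: continuous_on_def)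
    show "\<forall>\<^sub>F z in at 0. V z \<le> \<epsilon>"
      unfolding eventually_at using r by (intro exI[of _ "min r 1"]) (auto intro!: V_le)
  qed simp
  thus ?thesis by (simp add: V_def h0)
qed

section \<open>Haar measure and monomials on the polytorus\<close>

definition torus :: "(nat \<Rightarrow> complex) set" where
  "torus = {z. \<forall>j. norm (z j) = 1}"

definition fin_supp :: "(nat \<Rightarrow> int) set" where
  "fin_supp = {\<kappa>. finite {j. \<kappa> j \<noteq> 0}}"

lemma sets_circle_measure [measurable_cong]:
  "sets circle_measure = sets (restrict_space borel (sphere 0 1))"
  by (simp add: circle_measure_def)

lemma space_circle_measure: "space circle_measure = sphere 0 1"
  by (simp add: circle_measure_def space_restrict_space)

lemma measurable_cis_circle:
  "cis \<in> measurable (uniform_measure lborel {0..2 * pi}) (restrict_space borel (sphere 0 1))"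
proof (rule measurable_restrict_space2)
  show "cis \<in> borel_measurable (uniform_measure lborel {0..2 * pi})"
    using borel_measurable_continuous_onI[OF continuous_on_cis[OF continuous_on_id]] by simp
qed auto

lemma prob_space_circle_measure: "prob_space circle_measure"
  unfolding circle_measure_def
proof (rule prob_space.prob_space_distr[OF _ measurable_cis_circle])
  show "prob_space (uniform_measure lborel {0..2 * pi})"
    by (rule prob_space_uniform_measure) auto
qed

lemma integral_circle_measure:
  fixes f :: "complex \<Rightarrow> 'a::euclidean_space"
  assumes "continuous_on (sphere 0 1) f"
  shows "integral\<^sup>L circle_measure f = integral {0..2 * pi} (\<lambda>t. f (cis t)) /\<^sub>R (2 * pi)"
    "integrable circle_measure f"
proof -
  have f: "f \<in> borel_measurable (restrict_space borel (sphere 0 1))"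
    using assms by (rule borel_measurable_continuous_on_restrict)
  have cont: "continuous_on {0..2 * pi} (\<lambda>t. f (cis t))"
    by (rule continuous_on_compose2[OF assms]) (auto intro!: continuous_intros)
  hence int: "set_integrable lborel {0..2 * pi} (\<lambda>t. f (cis t))"
    unfolding set_integrable_def by (intro borel_integrable_compact) auto
  have um: "uniform_measure lborel {0..2 * pi} =
      density lborel (\<lambda>x. ennreal (indicator {0..2 * pi} x / (2 * pi)))"
    unfolding uniform_measure_def
    by (intro arg_cong2[where f = density] refl ext) (auto simp: indicator_def divide_ennreal[symmetric])
  have meas: "(\<lambda>t. f (cis t)) \<in> borel_measurable lborel"
    using measurable_compose[OF measurable_cis_circle f] by simp
  have "integral\<^sup>L circle_measure f = (LINT t|uniform_measure lborel {0..2 * pi}. f (cis t))"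
    unfolding circle_measure_def by (rule integral_distr[OF measurable_cis_circle f])
  also have "\<dots> = (LINT t|lborel. (indicator {0..2 * pi} t / (2 * pi)) *\<^sub>R f (cis t))"
    unfolding um by (rule integral_density) (use meas in auto)
  also have "\<dots> = (LINT t|lborel. indicator {0..2 * pi} t *\<^sub>R f (cis t)) /\<^sub>R (2 * pi)"
    by (subst integral_scaleR_right[symmetric]) (auto intro!: Bochner_Integration.integral_cong simp: field_simps)
  also have "(LINT t|lborel. indicator {0..2 * pi} t *\<^sub>R f (cis t)) = integral {0..2 * pi} (\<lambda>t. f (cis t))"
    using set_borel_integral_eq_integral(2)[OF int] by (simp add: set_lebesgue_integral_def)
  finally show "integral\<^sup>L circle_measure f = integral {0..2 * pi} (\<lambda>t. f (cis t)) /\<^sub>R (2 * pi)" .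
  have "integrable (uniform_measure lborel {0..2 * pi}) (\<lambda>t. f (cis t))"
    unfolding um
  proof (subst integrable_density)
    have "integrable lborel (\<lambda>t. (1 / (2 * pi)) *\<^sub>R indicator {0..2 * pi} t *\<^sub>R f (cis t))"
      using int by (intro integrable_scaleR_right) (simp add: set_integrable_def)
    thus "integrable lborel (\<lambda>t. (indicator {0..2 * pi} t / (2 * pi)) *\<^sub>R f (cis t))"
      by (simp add: field_simps)
  qed (use meas in auto)
  thus "integrable circle_measure f"
    unfolding circle_measure_def by (subst integrable_distr_eq[OF measurable_cis_circle f])
qed

lemma integral_circle_powi:
  "(LINT z|circle_measure. z powi k) = (if k = 0 then 1 else 0)"
proof (cases "k = 0")
  case True
  interpret prob_space circle_measure by (rule prob_space_circle_measure)
  show ?thesis using True by (simp add: prob_space)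
next
  case False
  have cont: "continuous_on (sphere 0 1) (\<lambda>z::complex. z powi k)"
    by (intro continuous_intros) auto
  have powi: "cis t powi k = cis (of_int k * t)" for t by (simp add: cis_power_int)
  have "((\<lambda>t. cis (of_int k * t)) has_integral
     (cis (of_int k * (2 * pi)) / (\<i> * of_int k) - cis (of_int k * 0) / (\<i> * of_int k))) {0..2 * pi}"
  proof (rule fundamental_theorem_of_calculus)
    fix t :: real
    have "((\<lambda>z. exp (\<i> * of_int k * z) / (\<i> * of_int k)) has_field_derivative exp (\<i> * of_int k * of_real t)) (at (of_real t))"
      using False by (auto intro!: derivative_eq_intros)
    hence "((\<lambda>t. exp (\<i> * of_int k * of_real t) / (\<i> * of_int k)) has_vector_derivative
        exp (\<i> * of_int k * of_real t)) (at t within {0..2 * pi})"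
      by (rule has_vector_derivative_real_field)
    thus "((\<lambda>t. cis (of_int k * t) / (\<i> * of_int k)) has_vector_derivative cis (of_int k * t)) (at t within {0..2 * pi})"
      by (simp add: cis_conv_exp mult_ac)
  qed auto
  moreover have "cis (of_int k * (2 * pi)) = 1"
    by (metis cis_multiple_2pi Ints_of_int mult.commute)
  ultimately have "integral {0..2 * pi} (\<lambda>t. cis t powi k) = 0"
    unfolding powi by (intro integral_unique) simp
  thus ?thesis using integral_circle_measure(1)[OF cont] False by simp
qed

lemma space_polytorus: "space polytorus = torus"
  by (auto simp: polytorus_def space_PiM space_circle_measure torus_def PiE_def)

interpretation polytorus: prob_space polytorus
  unfolding polytorus_def by (rule prob_space_PiM) (rule prob_space_circle_measure)

interpretation circle: product_prob_space "\<lambda>_::nat. circle_measure" UNIV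
  by (intro product_prob_spaceI prob_space_circle_measure)

text \<open>The index set is countable, so the coordinates generate the Borel sets of the product
  topology. This makes continuous functions on the torus measurable.\<close>

lemma sets_polytorus: "sets polytorus = sets (restrict_space borel torus)"
proof (intro equalityI subsetI)
  have *: "(\<lambda>z. z) \<in> measurable (restrict_space borel torus) polytorus"
    unfolding polytorus_def
  proof (rule measurable_PiM_single')
    fix j
    have "(\<lambda>z::nat \<Rightarrow> complex. z j) \<in> borel_measurable borel"
      by (intro borel_measurable_continuous_onI) simp
    hence "(\<lambda>z::nat \<Rightarrow> complex. z j) \<in> measurable (restrict_space borel torus) (restrict_space borel (sphere 0 1))"
      by (intro measurable_restrict_space2 measurable_restrict_space1) (auto simp: torus_def space_restrict_space)
    thus "(\<lambda>z::nat \<Rightarrow> complex. z j) \<in> measurable (restrict_space borel torus) circle_measure"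
      by (simp cong: measurable_cong_sets add: sets_circle_measure)
  qed (auto simp: space_restrict_space torus_def space_circle_measure)
  fix A assume A: "A \<in> sets polytorus"
  from measurable_sets[OF * this] sets.sets_into_space[OF this]
  show "A \<in> sets (restrict_space borel torus)"
    by (simp add: space_restrict_space space_polytorus Int_absorb2)
next
  have "(\<lambda>z. z) \<in> measurable polytorus (borel :: (nat \<Rightarrow> complex) measure)"
  proof (rule measurable_coordinatewise_then_product)
    fix j
    have "(\<lambda>z::nat \<Rightarrow> complex. z j) \<in> measurable polytorus circle_measure"
      unfolding polytorus_def by (rule measurable_component_singleton) simp
    hence "(\<lambda>z::nat \<Rightarrow> complex. z j) \<in> measurable polytorus (restrict_space borel (sphere 0 1))"
      by (simp cong: measurable_cong_sets add: sets_circle_measure)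
    thus "(\<lambda>z::nat \<Rightarrow> complex. z j) \<in> borel_measurable polytorus"
      unfolding measurable_restrict_space2_iff ..
  qed
  hence *: "(\<lambda>z. z) \<in> measurable polytorus (restrict_space borel torus)"
    by (intro measurable_restrict_space2) (simp_all add: space_polytorus)
  fix A assume A: "A \<in> sets (restrict_space borel torus)"
  from measurable_sets[OF * this] sets.sets_into_space[OF this]
  show "A \<in> sets polytorus"
    by (simp add: space_restrict_space space_polytorus Int_absorb2)
qed

lemma borel_measurable_polytorus:
  fixes f :: "_ \<Rightarrow> 'a::topological_space"
  assumes "continuous_on torus f"
  shows "f \<in> borel_measurable polytorus"
  using borel_measurable_continuous_on_restrict[OF assms]
  by (simp cong: measurable_cong_sets add: sets_polytorus)

lemma compact_torus: "compact torus"
proof -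
  have "compactin (product_topology (\<lambda>_::nat. euclidean :: complex topology) UNIV) (\<Pi>\<^sub>E j\<in>UNIV. sphere 0 1)"
    by (subst compactin_PiE) auto
  moreover have "(\<Pi>\<^sub>E j\<in>(UNIV::nat set). sphere (0::complex) 1) = torus"
    by (auto simp: torus_def PiE_def)
  ultimately show ?thesis by (simp add: euclidean_product_topology)
qed

lemma continuous_on_coordinate: "continuous_on A (\<lambda>z::nat \<Rightarrow> complex. z j)"
  by (rule continuous_on_subset[OF continuous_on_product_coordinates]) simp

lemma torus_nonzero: "z \<in> torus \<Longrightarrow> z j \<noteq> 0"
  by (auto simp: torus_def dest!: spec[of _ j])

lemma integrable_polytorus_continuous:
  fixes f :: "_ \<Rightarrow> 'a::{banach, second_countable_topology}"
  assumes "continuous_on torus f"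
  shows "integrable polytorus f"
proof -
  obtain B where "\<And>z. z \<in> torus \<Longrightarrow> norm (f z) \<le> B"
    using compact_imp_bounded[OF compact_continuous_image[OF assms compact_torus]]
    by (metis bounded_iff image_eqI)
  thus ?thesis
    by (intro polytorus.integrable_const_bound[of _ B] AE_I2 borel_measurable_polytorus assms)
       (auto simp: space_polytorus)
qed

section \<open>Monomials and their orthogonality\<close>

lemma monomial_eq_prod:
  assumes "finite J" "{j. \<kappa> j \<noteq> 0} \<subseteq> J"
  shows "monomial \<kappa> z = (\<Prod>j\<in>J. z j powi \<kappa> j)"
  unfolding monomial_def using assms by (intro prod.mono_neutral_left) auto

lemma monomial_add:
  assumes "\<kappa> \<in> fin_supp" "\<mu> \<in> fin_supp" "z \<in> torus"
  shows "monomial (\<lambda>j. \<kappa> j + \<mu> j) z = monomial \<kappa> z * monomial \<mu> z"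
proof -
  let ?J = "{j. \<kappa> j \<noteq> 0} \<union> {j. \<mu> j \<noteq> 0}"
  have J: "finite ?J" using assms by (auto simp: fin_supp_def)
  have "monomial (\<lambda>j. \<kappa> j + \<mu> j) z = (\<Prod>j\<in>?J. z j powi (\<kappa> j + \<mu> j))"
    using J by (intro monomial_eq_prod) auto
  also have "\<dots> = (\<Prod>j\<in>?J. z j powi \<kappa> j) * (\<Prod>j\<in>?J. z j powi \<mu> j)"
    unfolding prod.distrib[symmetric] using torus_nonzero[OF assms(3)]
    by (intro prod.cong refl) (simp add: power_int_add)
  also have "\<dots> = monomial \<kappa> z * monomial \<mu> z"
    using monomial_eq_prod[OF J, of \<kappa> z] monomial_eq_prod[OF J, of \<mu> z] by auto
  finally show ?thesis .
qed

lemma fin_supp_add: "\<kappa> \<in> fin_supp \<Longrightarrow> \<mu> \<in> fin_supp \<Longrightarrow> (\<lambda>j. \<kappa> j + \<mu> j) \<in> fin_supp"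
  unfolding fin_supp_def mem_Collect_eq
  by (rule finite_subset[of _ "{j. \<kappa> j \<noteq> 0} \<union> {j. \<mu> j \<noteq> 0}"]) auto

lemma fin_supp_minus: "\<kappa> \<in> fin_supp \<Longrightarrow> (\<lambda>j. - \<kappa> j) \<in> fin_supp"
  by (simp add: fin_supp_def)

lemma fin_supp_diff: "\<kappa> \<in> fin_supp \<Longrightarrow> \<mu> \<in> fin_supp \<Longrightarrow> (\<lambda>j. \<kappa> j - \<mu> j) \<in> fin_supp"
  using fin_supp_add[OF _ fin_supp_minus, of \<kappa> \<mu>] by simp

lemma fin_supp_0: "(\<lambda>_. 0) \<in> fin_supp"
  by (simp add: fin_supp_def)

lemma monomial_0: "monomial (\<lambda>_. 0) z = 1"
  by (simp add: monomial_def)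

lemma cnj_monomial:
  assumes "z \<in> torus"
  shows "cnj (monomial \<kappa> z) = monomial (\<lambda>j. - \<kappa> j) z"
proof -
  have "cnj (z j) = inverse (z j)" for j
    using assms complex_norm_square[of "z j"] by (intro inverse_unique[symmetric]) (simp add: torus_def)
  thus ?thesis by (simp add: monomial_def power_int_minus power_int_inverse)
qed

lemma continuous_on_monomial: "continuous_on torus (monomial \<kappa>)"
  unfolding monomial_def using torus_nonzero
  by (intro continuous_intros continuous_on_coordinate) auto

lemma integral_monomial:
  assumes "\<kappa> \<in> fin_supp"
  shows "integral\<^sup>L polytorus (monomial \<kappa>) = (if \<kappa> = (\<lambda>_. 0) then 1 else 0)"
proof -
  define J where "J = {j. \<kappa> j \<noteq> 0}"
  have J: "finite J" using assms by (simp add: J_def fin_supp_def)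
  have cont: "continuous_on (sphere 0 1) (\<lambda>z::complex. z powi k)" for k
    by (intro continuous_intros) auto
  have int: "integrable circle_measure (\<lambda>z. z powi k)" for k
    by (rule integral_circle_measure(2)[OF cont])
  have "integral\<^sup>L polytorus (monomial \<kappa>) = (LINT z|polytorus. (\<Prod>j\<in>J. restrict z J j powi \<kappa> j))"
    by (intro Bochner_Integration.integral_cong) (auto simp: monomial_def J_def)
  also have "\<dots> = (LINT y|distr polytorus (PiM J (\<lambda>_. circle_measure)) (\<lambda>z. restrict z J). (\<Prod>j\<in>J. y j powi \<kappa> j))"
  proof (rule integral_distr[symmetric])
    show "(\<lambda>z. restrict z J) \<in> measurable polytorus (PiM J (\<lambda>_. circle_measure))"
      unfolding polytorus_def by (rule measurable_restrict_subset) simp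
    show "(\<lambda>y. \<Prod>j\<in>J. y j powi \<kappa> j) \<in> borel_measurable (PiM J (\<lambda>_. circle_measure))"
      using borel_measurable_integrable[OF int]
      by (intro borel_measurable_prod measurable_compose[OF measurable_component_singleton]) auto
  qed
  \<comment> \<open>Only finitely many coordinates occur, and their joint law is the finite product
    measure, over which a product of functions of one variable each integrates factor by
    factor.\<close>
  also have "distr polytorus (PiM J (\<lambda>_. circle_measure)) (\<lambda>z. restrict z J) = PiM J (\<lambda>_. circle_measure)"
    unfolding polytorus_def by (rule circle.distr_PiM_restrict_finite[OF J]) simp
  also have "(LINT y|PiM J (\<lambda>_. circle_measure). (\<Prod>j\<in>J. y j powi \<kappa> j)) = (\<Prod>j\<in>J. LINT z|circle_measure. z powi \<kappa> j)"
    by (rule circle.product_integral_prod[OF J int])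
  also have "\<dots> = (if \<kappa> = (\<lambda>_. 0) then 1 else 0)"
    using J by (auto simp: integral_circle_powi prod_zero_iff J_def fun_eq_iff card_gt_0_iff)
  finally show ?thesis .
qed

section \<open>Density of trigonometric polynomials and uniqueness of Fourier coefficients\<close>

text \<open>Equality is asked for on \<open>torus\<close> only, since addition of exponents and
  inversion by conjugation are used there.\<close>

definition trig_polys :: "((nat \<Rightarrow> complex) \<Rightarrow> complex) set" where
  "trig_polys = {f. \<exists>A c. finite A \<and> A \<subseteq> fin_supp \<and> (\<forall>z\<in>torus. f z = (\<Sum>\<kappa>\<in>A. c \<kappa> * monomial \<kappa> z))}"

lemma trig_polysI:
  assumes "finite A" "A \<subseteq> fin_supp" "\<And>z. z \<in> torus \<Longrightarrow> f z = (\<Sum>\<kappa>\<in>A. c \<kappa> * monomial \<kappa> z)"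
  shows "f \<in> trig_polys"
  using assms unfolding trig_polys_def by blast

lemma trig_polysE:
  assumes "f \<in> trig_polys"
  obtains A c where "finite A" "A \<subseteq> fin_supp" "\<And>z. z \<in> torus \<Longrightarrow> f z = (\<Sum>\<kappa>\<in>A. c \<kappa> * monomial \<kappa> z)"
  using assms unfolding trig_polys_def by blast

lemma trig_polys_cong:
  assumes "f \<in> trig_polys" "\<And>z. z \<in> torus \<Longrightarrow> f z = g z"
  shows "g \<in> trig_polys"
  using assms unfolding trig_polys_def by simp

lemma trig_polys_monomial:
  assumes "\<kappa> \<in> fin_supp"
  shows "(\<lambda>z. c * monomial \<kappa> z) \<in> trig_polys"
  by (rule trig_polysI[of "{\<kappa>}" _ "\<lambda>_. c"]) (use assms in auto)

lemma trig_polys_const: "(\<lambda>_. c) \<in> trig_polys"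
  using trig_polys_monomial[OF fin_supp_0, of c] by (simp add: monomial_0)

lemma trig_polys_add:
  assumes "f \<in> trig_polys" "g \<in> trig_polys"
  shows "(\<lambda>z. f z + g z) \<in> trig_polys"
proof -
  obtain A c where A: "finite A" "A \<subseteq> fin_supp" "\<And>z. z \<in> torus \<Longrightarrow> f z = (\<Sum>\<kappa>\<in>A. c \<kappa> * monomial \<kappa> z)"
    using assms(1) by (rule trig_polysE) blast
  obtain B d where B: "finite B" "B \<subseteq> fin_supp" "\<And>z. z \<in> torus \<Longrightarrow> g z = (\<Sum>\<kappa>\<in>B. d \<kappa> * monomial \<kappa> z)"
    using assms(2) by (rule trig_polysE) blast
  have ext: "(\<Sum>\<kappa>\<in>X. e \<kappa> * monomial \<kappa> z) = (\<Sum>\<kappa>\<in>A \<union> B. (if \<kappa> \<in> X then e \<kappa> else 0) * monomial \<kappa> z)"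
    if "X = A \<or> X = B" for X e z
    using A(1) B(1) that by (intro sum.mono_neutral_cong_left) auto
  show ?thesis
  proof (rule trig_polysI[of "A \<union> B" _ "\<lambda>\<kappa>. (if \<kappa> \<in> A then c \<kappa> else 0) + (if \<kappa> \<in> B then d \<kappa> else 0)"])
    fix z assume z: "z \<in> torus"
    have "(\<Sum>\<kappa>\<in>A \<union> B. ((if \<kappa> \<in> A then c \<kappa> else 0) + (if \<kappa> \<in> B then d \<kappa> else 0)) * monomial \<kappa> z) =
       (\<Sum>\<kappa>\<in>A \<union> B. (if \<kappa> \<in> A then c \<kappa> else 0) * monomial \<kappa> z) + (\<Sum>\<kappa>\<in>A \<union> B. (if \<kappa> \<in> B then d \<kappa> else 0) * monomial \<kappa> z)"
      unfolding sum.distrib[symmetric] by (intro sum.cong refl) (simp only: distrib_right)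
    thus "f z + g z = (\<Sum>\<kappa>\<in>A \<union> B. ((if \<kappa> \<in> A then c \<kappa> else 0) + (if \<kappa> \<in> B then d \<kappa> else 0)) * monomial \<kappa> z)"
      unfolding A(3)[OF z] B(3)[OF z] using ext[of A c z] ext[of B d z] by simp
  qed (use A B in auto)
qed

lemma trig_polys_sum:
  assumes "finite I" "\<And>i. i \<in> I \<Longrightarrow> f i \<in> trig_polys"
  shows "(\<lambda>z. \<Sum>i\<in>I. f i z) \<in> trig_polys"
  using assms by (induction I rule: finite_induct) (auto intro: trig_polys_const trig_polys_add)

lemma trig_polys_mult_monomial:
  assumes "f \<in> trig_polys" and \<mu>: "\<mu> \<in> fin_supp"
  shows "(\<lambda>z. d * monomial \<mu> z * f z) \<in> trig_polys"
proof -
  obtain A c where A: "finite A" "A \<subseteq> fin_supp" "\<And>z. z \<in> torus \<Longrightarrow> f z = (\<Sum>\<kappa>\<in>A. c \<kappa> * monomial \<kappa> z)"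
    using assms(1) by (rule trig_polysE) blast
  have "(\<lambda>z. \<Sum>\<kappa>\<in>A. (d * c \<kappa>) * monomial (\<lambda>j. \<mu> j + \<kappa> j) z) \<in> trig_polys"
    using A \<mu> by (intro trig_polys_sum trig_polys_monomial fin_supp_add) auto
  thus ?thesis
  proof (rule trig_polys_cong)
    fix z assume z: "z \<in> torus"
    show "(\<Sum>\<kappa>\<in>A. (d * c \<kappa>) * monomial (\<lambda>j. \<mu> j + \<kappa> j) z) = d * monomial \<mu> z * f z"
      unfolding A(3)[OF z] sum_distrib_left
      using A(2) \<mu> z by (intro sum.cong refl) (auto simp: monomial_add mult_ac)
  qed
qed

lemma trig_polys_mult:
  assumes "f \<in> trig_polys" "g \<in> trig_polys"
  shows "(\<lambda>z. f z * g z) \<in> trig_polys"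
proof -
  obtain A c where A: "finite A" "A \<subseteq> fin_supp" "\<And>z. z \<in> torus \<Longrightarrow> f z = (\<Sum>\<kappa>\<in>A. c \<kappa> * monomial \<kappa> z)"
    using assms(1) by (rule trig_polysE) blast
  have "(\<lambda>z. \<Sum>\<kappa>\<in>A. c \<kappa> * monomial \<kappa> z * g z) \<in> trig_polys"
    using A assms(2) by (intro trig_polys_sum trig_polys_mult_monomial) auto
  thus ?thesis by (rule trig_polys_cong) (simp add: A(3) sum_distrib_right)
qed

lemma trig_polys_cnj:
  assumes "f \<in> trig_polys"
  shows "(\<lambda>z. cnj (f z)) \<in> trig_polys"
proof -
  obtain A c where A: "finite A" "A \<subseteq> fin_supp" "\<And>z. z \<in> torus \<Longrightarrow> f z = (\<Sum>\<kappa>\<in>A. c \<kappa> * monomial \<kappa> z)"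
    using assms(1) by (rule trig_polysE) blast
  have "(\<lambda>z. \<Sum>\<kappa>\<in>A. cnj (c \<kappa>) * monomial (\<lambda>j. - \<kappa> j) z) \<in> trig_polys"
    using A assms by (intro trig_polys_sum trig_polys_monomial fin_supp_minus) auto
  thus ?thesis by (rule trig_polys_cong) (simp add: A(3) cnj_monomial)
qed

lemma trig_polys_coordinate: "(\<lambda>z. z j) \<in> trig_polys"
proof -
  let ?\<kappa> = "(\<lambda>i. if i = j then 1 else 0) :: nat \<Rightarrow> int"
  have "?\<kappa> \<in> fin_supp" by (simp add: fin_supp_def)
  moreover have "monomial ?\<kappa> z = z j" for z by (subst monomial_eq_prod[of "{j}"]) auto
  ultimately show ?thesis using trig_polys_monomial[of ?\<kappa> 1] by simp
qed

lemma continuous_on_trig_poly: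
  assumes "f \<in> trig_polys"
  shows "continuous_on torus f"
proof -
  obtain A c where A: "\<And>z. z \<in> torus \<Longrightarrow> f z = (\<Sum>\<kappa>\<in>A. c \<kappa> * monomial \<kappa> z)"
    using assms(1) by (rule trig_polysE) blast
  have "continuous_on torus (\<lambda>z. \<Sum>\<kappa>\<in>A. c \<kappa> * monomial \<kappa> z)"
    by (intro continuous_intros continuous_on_monomial)
  thus ?thesis using A by (simp cong: continuous_on_cong)
qed

text \<open>Stone-Weierstrass is applied to real functions. Closure under conjugation puts the real
  and imaginary parts of the coordinates into the algebra, and these separate points.\<close>

lemma function_ring_on_trig_polys:
  "function_ring_on {f. (\<lambda>z. complex_of_real (f z)) \<in> trig_polys} torus"
proof
  show "compact torus" by (rule compact_torus)
next
  fix f :: "(nat \<Rightarrow> complex) \<Rightarrow> real"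
  assume "f \<in> {f. (\<lambda>z. complex_of_real (f z)) \<in> trig_polys}"
  from continuous_on_Re[OF continuous_on_trig_poly] this show "continuous_on torus f" by force
next
  fix x y :: "nat \<Rightarrow> complex" assume xy: "x \<in> torus" "y \<in> torus" "x \<noteq> y"
  then obtain j where j: "x j \<noteq> y j" by auto
  have cnj: "(\<lambda>z. cnj (z j)) \<in> trig_polys" by (intro trig_polys_cnj trig_polys_coordinate)
  have "(\<lambda>z. (1/2) * (z j + cnj (z j))) \<in> trig_polys"
    by (intro trig_polys_mult trig_polys_const trig_polys_add trig_polys_coordinate cnj)
  hence re: "(\<lambda>z. complex_of_real (Re (z j))) \<in> trig_polys"
    by (rule trig_polys_cong) (simp add: complex_eq_iff)
  have "(\<lambda>z. (- \<i>/2) * (z j + (-1) * cnj (z j))) \<in> trig_polys"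
    by (intro trig_polys_mult trig_polys_const trig_polys_add trig_polys_coordinate cnj)
  hence "(\<lambda>z. complex_of_real (Im (z j))) \<in> trig_polys"
    by (rule trig_polys_cong) (simp add: complex_eq_iff)
  with re show "\<exists>f\<in>{f. (\<lambda>z. complex_of_real (f z)) \<in> trig_polys}. f x \<noteq> f y"
    using j by (auto simp: complex_eq_iff)
qed (auto intro: trig_polys_add trig_polys_mult trig_polys_const)

lemma trig_polys_dense:
  fixes f :: "(nat \<Rightarrow> complex) \<Rightarrow> complex"
  assumes f: "continuous_on torus f" and e: "e > 0"
  obtains H where "H \<in> trig_polys" "\<And>z. z \<in> torus \<Longrightarrow> norm (f z - H z) < e"
proof -
  interpret function_ring_on "{f. (\<lambda>z. complex_of_real (f z)) \<in> trig_polys}" torus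
    by (rule function_ring_on_trig_polys)
  obtain g where g: "(\<lambda>z. complex_of_real (g z)) \<in> trig_polys" "\<And>z. z \<in> torus \<Longrightarrow> \<bar>Re (f z) - g z\<bar> < e / 2"
    using Stone_Weierstrass_basic[OF continuous_on_Re[OF f], of "e / 2"] e by auto
  obtain h where h: "(\<lambda>z. complex_of_real (h z)) \<in> trig_polys" "\<And>z. z \<in> torus \<Longrightarrow> \<bar>Im (f z) - h z\<bar> < e / 2"
    using Stone_Weierstrass_basic[OF continuous_on_Im[OF f], of "e / 2"] e by auto
  show thesis
  proof (rule that)
    show "(\<lambda>z. complex_of_real (g z) + \<i> * complex_of_real (h z)) \<in> trig_polys"
      by (intro trig_polys_add trig_polys_mult trig_polys_const g h)
    fix z assume "z \<in> torus"
    thus "norm (f z - (complex_of_real (g z) + \<i> * complex_of_real (h z))) < e"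
      using cmod_le[of "f z - (complex_of_real (g z) + \<i> * complex_of_real (h z))"] g(2)[of z] h(2)[of z] by simp
  qed
qed

lemma fourier_coeff_trig_poly:
  assumes "finite A" "A \<subseteq> fin_supp" "\<mu> \<in> fin_supp"
    and f: "\<And>z. z \<in> torus \<Longrightarrow> f z = (\<Sum>\<kappa>\<in>A. c \<kappa> * monomial \<kappa> z)"
  shows "fourier_coeff f \<mu> = (if \<mu> \<in> A then c \<mu> else 0)"
proof -
  have "fourier_coeff f \<mu> = (LINT z|polytorus. (\<Sum>\<kappa>\<in>A. c \<kappa> * monomial (\<lambda>j. \<kappa> j - \<mu> j) z))"
    unfolding fourier_coeff_def
  proof (rule Bochner_Integration.integral_cong[OF refl])
    fix z assume "z \<in> space polytorus"
    hence z: "z \<in> torus" by (simp add: space_polytorus)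
    have "monomial (\<lambda>j. \<kappa> j - \<mu> j) z = monomial \<kappa> z * cnj (monomial \<mu> z)" if "\<kappa> \<in> A" for \<kappa>
      using monomial_add[of \<kappa> "\<lambda>j. - \<mu> j" z] fin_supp_minus[OF assms(3)] assms(2) that z
      by (auto simp: cnj_monomial)
    thus "f z * cnj (monomial \<mu> z) = (\<Sum>\<kappa>\<in>A. c \<kappa> * monomial (\<lambda>j. \<kappa> j - \<mu> j) z)"
      by (simp add: f z sum_distrib_right mult.assoc)
  qed
  also have "\<dots> = (\<Sum>\<kappa>\<in>A. c \<kappa> * integral\<^sup>L polytorus (monomial (\<lambda>j. \<kappa> j - \<mu> j)))"
    by (subst Bochner_Integration.integral_sum)
       (auto intro!: integrable_polytorus_continuous continuous_intros continuous_on_monomial)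
  also have "\<dots> = (\<Sum>\<kappa>\<in>A. if \<kappa> = \<mu> then c \<mu> else 0)"
  proof (rule sum.cong[OF refl])
    fix \<kappa> assume "\<kappa> \<in> A"
    have diff_eq: "(\<lambda>j. \<kappa> j - \<mu> j) = (\<lambda>_. 0) \<longleftrightarrow> \<kappa> = \<mu>" by (auto simp: fun_eq_iff)
    from \<open>\<kappa> \<in> A\<close> have "(\<lambda>j. \<kappa> j - \<mu> j) \<in> fin_supp" using assms by (intro fin_supp_diff) auto
    thus "c \<kappa> * integral\<^sup>L polytorus (monomial (\<lambda>j. \<kappa> j - \<mu> j)) = (if \<kappa> = \<mu> then c \<mu> else 0)"
      by (subst integral_monomial) (simp_all add: diff_eq)
  qed
  finally show ?thesis using assms(1) by simp
qed

lemma integrable_mult_continuous: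
  fixes F f :: "_ \<Rightarrow> complex"
  assumes F: "integrable polytorus F" and f: "continuous_on torus f"
  shows "integrable polytorus (\<lambda>z. F z * f z)"
proof -
  obtain B where B: "\<And>z. z \<in> torus \<Longrightarrow> norm (f z) \<le> B"
    using compact_imp_bounded[OF compact_continuous_image[OF f compact_torus]]
    by (metis bounded_iff image_eqI)
  show ?thesis
  proof (rule Bochner_Integration.integrable_bound)
    show "integrable polytorus (\<lambda>z. B * norm (F z))" using F by (intro integrable_mult_right integrable_norm)
    show "(\<lambda>z. F z * f z) \<in> borel_measurable polytorus"
      using F borel_measurable_polytorus[OF f] by measurable
    show "AE z in polytorus. norm (F z * f z) \<le> norm (B * norm (F z))"
    proof (rule AE_I2)
      fix z assume "z \<in> space polytorus"
      hence z: "norm (f z) \<le> B" using B by (simp add: space_polytorus)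
      hence "B \<ge> 0" using norm_ge_zero order_trans by blast
      thus "norm (F z * f z) \<le> norm (B * norm (F z))"
        using mult_right_mono[OF z norm_ge_zero[of "F z"]] by (simp add: norm_mult mult.commute)
    qed
  qed
qed

lemma integral_mult_cnj_trig_poly:
  assumes "integrable polytorus F" and "finite A"
    and f: "\<And>z. z \<in> torus \<Longrightarrow> f z = (\<Sum>\<kappa>\<in>A. c \<kappa> * monomial \<kappa> z)"
  shows "(LINT z|polytorus. F z * cnj (f z)) = (\<Sum>\<kappa>\<in>A. cnj (c \<kappa>) * fourier_coeff F \<kappa>)"
proof -
  have "(LINT z|polytorus. F z * cnj (f z)) = (LINT z|polytorus. (\<Sum>\<kappa>\<in>A. cnj (c \<kappa>) * (F z * cnj (monomial \<kappa> z))))"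
    by (intro Bochner_Integration.integral_cong) (auto simp: f space_polytorus sum_distrib_left mult_ac)
  also have "\<dots> = (\<Sum>\<kappa>\<in>A. cnj (c \<kappa>) * fourier_coeff F \<kappa>)"
    unfolding fourier_coeff_def
    by (subst Bochner_Integration.integral_sum)
       (auto intro!: integrable_mult_right integrable_mult_continuous assms continuous_intros continuous_on_monomial)
  finally show ?thesis .
qed

text \<open>As \<open>F\<close> is merely integrable, orthogonality in the square-integrable
  functions is not at hand. Uniform approximation by trigonometric polynomials makes the integral of
  \<open>F\<close> against every continuous function vanish; continuous functions decrease to
  indicators of closed sets, and these sets form an intersection-stable generator of the Borel
  sets.\<close>

lemma fourier_coeff_zero_imp_AE_zero:
  assumes F: "integrable polytorus F" and zero: "\<And>\<kappa>. \<kappa> \<in> fin_supp \<Longrightarrow> fourier_coeff F \<kappa> = 0"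
  shows "AE z in polytorus. F z = 0"
proof -
  have cont: "(LINT z|polytorus. F z * f z) = 0" if f: "continuous_on torus f" for f
  proof -
    have "norm (LINT z|polytorus. F z * f z) \<le> 0 + e * (LINT z|polytorus. norm (F z))" if e: "e > 0" for e
    proof -
      obtain H where H: "H \<in> trig_polys" "\<And>z. z \<in> torus \<Longrightarrow> norm (cnj (f z) - H z) < e"
        using trig_polys_dense[OF continuous_on_cnj[OF f] e] by blast
      obtain A c where A: "finite A" "A \<subseteq> fin_supp" "\<And>z. z \<in> torus \<Longrightarrow> H z = (\<Sum>\<kappa>\<in>A. c \<kappa> * monomial \<kappa> z)"
        using H(1) by (rule trig_polysE) blast
      have contH: "continuous_on torus (\<lambda>z. cnj (H z))"
        by (intro continuous_intros continuous_on_trig_poly H)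
      have "(LINT z|polytorus. F z * cnj (H z)) = 0"
        using integral_mult_cnj_trig_poly[OF F A(1) A(3)] zero A(2) by (auto intro!: sum.neutral)
      hence "(LINT z|polytorus. F z * f z) = (LINT z|polytorus. F z * f z - F z * cnj (H z))"
        using integrable_mult_continuous[OF F f] integrable_mult_continuous[OF F contH] by simp
      also have "norm \<dots> \<le> (LINT z|polytorus. e * norm (F z))"
      proof (rule order_trans[OF integral_norm_bound integral_mono])
        fix z assume "z \<in> space polytorus"
        hence "norm (cnj (f z) - H z) < e" by (intro H) (simp add: space_polytorus)
        hence "norm (f z - cnj (H z)) \<le> e" by (metis complex_cnj_cnj complex_cnj_diff complex_mod_cnj less_imp_le)
        hence "norm (F z) * norm (f z - cnj (H z)) \<le> norm (F z) * e" by (intro mult_left_mono) auto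
        thus "norm (F z * f z - F z * cnj (H z)) \<le> e * norm (F z)"
          by (simp add: norm_mult[symmetric] right_diff_distrib mult.commute)
      qed (use F in \<open>auto intro!: integrable_mult_continuous f contH\<close>)
      finally show ?thesis by simp
    qed
    hence "norm (LINT z|polytorus. F z * f z) \<le> 0"
      by (intro tendsto_lowerbound[of "\<lambda>e. 0 + e * (LINT z|polytorus. norm (F z))" _ "at_right 0"])
         (auto intro!: tendsto_eq_intros eventually_at_right_less[THEN eventually_mono])
    thus ?thesis by simp
  qed
  have closed: "(LINT z|polytorus. indicator C z *\<^sub>R F z) = 0" if C: "closed C" for C
  \<comment> \<open>The distance to the empty set is 0 by convention, so the functions
    \<open>f n\<close> below would be constantly 1 for it.\<close>
  proof (cases "C = {}")
    case False
    define f where "f n z = max 0 (1 - real n * infdist z C)" for n z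
    have contf: "continuous_on torus (\<lambda>z. complex_of_real (f n z))" for n
      unfolding f_def by (intro continuous_intros)
    have lim: "(\<lambda>n. f n z) \<longlonglongrightarrow> indicator C z" for z
    proof (cases "z \<in> C")
      case True
      thus ?thesis by (simp add: f_def)
    next
      case False
      hence pos: "infdist z C > 0"
        using C \<open>C \<noteq> {}\<close> by (metis in_closed_iff_infdist_zero infdist_nonneg less_eq_real_def)
      obtain N where N: "1 / infdist z C < real N" using reals_Archimedean2 by blast
      have "\<forall>\<^sub>F n in sequentially. f n z = 0"
        unfolding eventually_sequentially
      proof (intro exI[of _ N] allI impI)
        fix n assume "N \<le> n"
        hence "1 / infdist z C < real n" using N by linarith
        thus "f n z = 0" using pos by (simp add: f_def field_simps)
      qed
      thus ?thesis using False by (simp add: tendsto_eventually)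
    qed
    have "(\<lambda>n. LINT z|polytorus. complex_of_real (f n z) * F z) \<longlonglongrightarrow> (LINT z|polytorus. indicator C z *\<^sub>R F z)"
    proof (rule integral_dominated_convergence[where w = "\<lambda>z. norm (F z)"])
      have ind: "(indicator C :: _ \<Rightarrow> real) \<in> borel_measurable polytorus"
      proof -
        have "(indicator C :: _ \<Rightarrow> real) \<in> borel_measurable (restrict_space borel torus)"
          using C by (intro measurable_restrict_space1) auto
        thus ?thesis by (simp cong: measurable_cong_sets add: sets_polytorus)
      qed
      show "(\<lambda>z. indicator C z *\<^sub>R F z) \<in> borel_measurable polytorus"
        using F ind by (intro borel_measurable_scaleR) auto
      show "(\<lambda>z. complex_of_real (f n z) * F z) \<in> borel_measurable polytorus" for n
        using F borel_measurable_polytorus[OF contf[of n]] by (intro borel_measurable_times) auto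
      show "AE z in polytorus. (\<lambda>n. complex_of_real (f n z) * F z) \<longlonglongrightarrow> indicator C z *\<^sub>R F z"
        by (intro AE_I2) (auto simp: scaleR_conv_of_real intro!: tendsto_intros lim)
      show "AE z in polytorus. norm (complex_of_real (f n z) * F z) \<le> norm (F z)" for n
        by (intro AE_I2) (auto simp: norm_mult f_def infdist_nonneg intro!: mult_left_le_one_le)
    qed (use F in simp)
    moreover have "(LINT z|polytorus. complex_of_real (f n z) * F z) = 0" for n
      using cont[OF contf[of n]] by (simp add: mult.commute)
    ultimately show ?thesis by (simp add: LIMSEQ_const_iff)
  qed simp
  have meas: "B \<inter> torus \<in> sets polytorus" if "B \<in> sets borel" for B
    using that by (auto simp: sets_polytorus sets_restrict_space)
  have int: "set_integrable polytorus (B \<inter> torus) F" if "B \<in> sets borel" for B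
    using F meas[OF that] by (intro integrable_mult_indicator[folded set_integrable_def]) 
  have borel: "set_lebesgue_integral polytorus (B \<inter> torus) F = 0" if "B \<in> sets borel" for B
  proof -
    have "Int_stable (Collect closed :: (nat \<Rightarrow> complex) set set)" by (auto simp: Int_stable_def)
    moreover have "Collect closed \<subseteq> Pow (UNIV :: (nat \<Rightarrow> complex) set)" by simp
    moreover have "B \<in> sigma_sets UNIV (Collect closed)" using that by (simp add: borel_eq_closed)
    ultimately show ?thesis
    proof (induction rule: sigma_sets_induct_disjoint)
      case (basic C)
      have "set_lebesgue_integral polytorus (C \<inter> torus) F = (LINT z|polytorus. indicator C z *\<^sub>R F z)"
        unfolding set_lebesgue_integral_def
        by (intro Bochner_Integration.integral_cong) (auto simp: space_polytorus indicator_def)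
      thus ?case using closed basic by simp
    next
      case (compl C)
      have C: "C \<in> sets borel" using compl(1) by (simp add: borel_eq_closed)
      have "set_lebesgue_integral polytorus (C \<inter> torus \<union> (UNIV - C) \<inter> torus) F =
        set_lebesgue_integral polytorus (C \<inter> torus) F + set_lebesgue_integral polytorus ((UNIV - C) \<inter> torus) F"
        using C by (intro set_integral_Un int) auto
      moreover have "C \<inter> torus \<union> (UNIV - C) \<inter> torus = UNIV \<inter> torus" by auto
      moreover have "set_lebesgue_integral polytorus (UNIV \<inter> torus) F = (LINT z|polytorus. indicator UNIV z *\<^sub>R F z)"
        unfolding set_lebesgue_integral_def
        by (intro Bochner_Integration.integral_cong) (auto simp: space_polytorus indicator_def)
      ultimately show ?case using compl(2) closed[of UNIV] by simp
    next
      case (union C)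
      have C: "C i \<in> sets borel" for i using union(2) by (auto simp: borel_eq_closed)
      have "set_lebesgue_integral polytorus (\<Union>i. C i \<inter> torus) F = (\<Sum>i. set_lebesgue_integral polytorus (C i \<inter> torus) F)"
      proof (rule lebesgue_integral_countable_add)
        show "set_integrable polytorus (\<Union>i. C i \<inter> torus) F"
          using int[of "\<Union>i. C i"] C by (simp add: Int_UN_distrib2 sets.countable_UN)
      qed (use meas[OF C] union(1) in \<open>auto simp: disjoint_family_on_def\<close>)
      moreover have "(\<Union>i. C i \<inter> torus) = (\<Union>i. C i) \<inter> torus" by auto
      ultimately show ?case using union(3) by simp
    qed (simp add: set_lebesgue_integral_def)
  qed
  show ?thesis
  proof (rule polytorus.density_zero[OF F])
    fix A assume "A \<in> sets polytorus"
    then obtain B where "B \<in> sets borel" "A = B \<inter> torus"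
      by (auto simp: sets_polytorus sets_restrict_space)
    thus "set_lebesgue_integral polytorus A F = 0" using borel by simp
  qed
qed

section \<open>Projections to half-spaces\<close>

text \<open>With integer \<open>l\<close> this is, up to sign, the power of the rotation parameter
  that a monomial picks up under a circle action; with real \<open>l\<close> it will be
  \<open>ln (g n)\<close>. Hence the type variable.\<close>

definition weight :: "(nat \<Rightarrow> 'a::comm_ring_1) \<Rightarrow> (nat \<Rightarrow> int) \<Rightarrow> 'a" where
  "weight l \<kappa> = (\<Sum>j\<in>{j. \<kappa> j \<noteq> 0}. l j * of_int (\<kappa> j))"

lemma prod_powi:
  fixes x :: "'a::field"
  assumes "x \<noteq> 0"
  shows "(\<Prod>j\<in>J. x powi f j) = x powi (\<Sum>j\<in>J. f j)"
  by (induction J rule: infinite_finite_induct) (use assms in \<open>auto simp: power_int_add\<close>)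

lemma monomial_rotate:
  assumes "\<zeta> \<noteq> 0"
  shows "monomial \<kappa> (\<lambda>j. z j * \<zeta> powi (- m j)) = monomial \<kappa> z * \<zeta> powi (- weight m \<kappa>)"
proof -
  have "monomial \<kappa> (\<lambda>j. z j * \<zeta> powi (- m j)) = (\<Prod>j\<in>{j. \<kappa> j \<noteq> 0}. z j powi \<kappa> j * \<zeta> powi (- (m j * \<kappa> j)))"
    unfolding monomial_def by (intro prod.cong refl) (simp add: power_int_mult_distrib flip: power_int_mult)
  also have "\<dots> = monomial \<kappa> z * (\<Prod>j\<in>{j. \<kappa> j \<noteq> 0}. \<zeta> powi (- (m j * \<kappa> j)))"
    by (simp add: prod.distrib monomial_def)
  also have "(\<Prod>j\<in>{j. \<kappa> j \<noteq> 0}. \<zeta> powi (- (m j * \<kappa> j))) = \<zeta> powi (- weight m \<kappa>)"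
    unfolding weight_def sum_negf[symmetric] by (simp add: prod_powi[OF assms])
  finally show ?thesis .
qed

lemma torus_rotate: "z \<in> torus \<Longrightarrow> norm \<zeta> = 1 \<Longrightarrow> (\<lambda>j. z j * \<zeta> powi (- m j)) \<in> torus"
  by (simp add: torus_def norm_mult norm_power_int)

lemma continuous_on_sum_monomial:
  "continuous_on torus (\<lambda>z. \<Sum>\<kappa>\<in>A. c \<kappa> * monomial \<kappa> z)"
  by (intro continuous_intros continuous_on_monomial)

text \<open>Along the orbit \<open>\<zeta> \<mapsto> (\<lambda>j. z j * \<zeta> powi (- m j))\<close> the product of the first sum with the
  conjugate of the second is a polynomial in \<open>\<zeta>\<close> that vanishes at 0. Approximating its image under
  \<open>Re_powr s\<close> by trigonometric polynomials makes the mean over orbits available without any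
  reference to the invariance of the measure.\<close>

lemma integral_Re_powr_nonneg:
  assumes s: "0 < s" "s \<le> 1" and A: "finite A" and B: "finite B"
    and le: "\<And>\<kappa>. \<kappa> \<in> A \<Longrightarrow> weight m \<kappa> \<le> (M::int)" and gt: "\<And>\<kappa>. \<kappa> \<in> B \<Longrightarrow> M < weight m \<kappa>"
  shows "0 \<le> (LINT z|polytorus. Re_powr s ((\<Sum>\<kappa>\<in>A. c \<kappa> * monomial \<kappa> z) * cnj (\<Sum>\<kappa>\<in>B. d \<kappa> * monomial \<kappa> z)))"
proof -
  define w where "w z = (\<Sum>\<kappa>\<in>A. c \<kappa> * monomial \<kappa> z)" for z
  define v where "v z = (\<Sum>\<kappa>\<in>B. d \<kappa> * monomial \<kappa> z)" for z
  define U where "U z = Re_powr s (w z * cnj (v z))" for z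
  have contU: "continuous_on torus U"
    unfolding U_def w_def v_def
    by (intro continuous_on_compose2[OF continuous_on_Re_powr[OF s(1), of UNIV]] continuous_intros continuous_on_sum_monomial) auto
  have intU: "integrable polytorus U" by (rule integrable_polytorus_continuous[OF contU])
  have "- 2 * \<epsilon> \<le> (LINT z|polytorus. U z)" if \<epsilon>: "\<epsilon> > 0" for \<epsilon>
  proof -
    have "continuous_on torus (\<lambda>z. complex_of_real (U z))" by (intro continuous_intros contU)
    then obtain T where T: "T \<in> trig_polys" "\<And>z. z \<in> torus \<Longrightarrow> norm (complex_of_real (U z) - T z) < \<epsilon>"
      using trig_polys_dense \<epsilon> by blast
    obtain D t where D: "finite D" "D \<subseteq> fin_supp" "\<And>z. z \<in> torus \<Longrightarrow> T z = (\<Sum>\<tau>\<in>D. t \<tau> * monomial \<tau> z)"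
      using T(1) by (rule trig_polysE) blast
    have intT: "integrable polytorus T"
      by (intro integrable_polytorus_continuous continuous_on_trig_poly T)
    have close: "\<bar>U z - Re (T z)\<bar> < \<epsilon>" if "z \<in> torus" for z
      using T(2)[OF that] abs_Re_le_cmod[of "complex_of_real (U z) - T z"] by simp
    have orbit: "- \<epsilon> \<le> Re (\<Sum>\<tau>\<in>D. if weight m \<tau> = 0 then t \<tau> * monomial \<tau> z else 0)" if z: "z \<in> torus" for z
    proof -
      define h where "h \<zeta> = (\<Sum>\<kappa>\<in>A. c \<kappa> * monomial \<kappa> z * \<zeta> ^ nat (M - weight m \<kappa>)) *
          (\<Sum>\<kappa>\<in>B. cnj (d \<kappa> * monomial \<kappa> z) * \<zeta> ^ nat (weight m \<kappa> - M))" for \<zeta>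
      \<comment> \<open>On the circle the terms of positive weight would carry negative powers of
        \<open>\<zeta>\<close>; conjugating them keeps the real part and makes \<open>p\<close> a
        polynomial. At 0 exactly the terms of weight 0 survive.\<close>
      define p where "p \<zeta> = (\<Sum>\<tau>\<in>D. if weight m \<tau> \<le> 0 then t \<tau> * monomial \<tau> z * \<zeta> ^ nat (- weight m \<tau>)
          else cnj (t \<tau> * monomial \<tau> z) * \<zeta> ^ nat (weight m \<tau>))" for \<zeta>
      have "- \<epsilon> \<le> Re (p 0)"
      proof (rule Re_powr_submean[OF s])
        show "h holomorphic_on UNIV" unfolding h_def by (intro holomorphic_intros)
        have "(\<lambda>\<zeta>. if weight m \<tau> \<le> 0 then t \<tau> * monomial \<tau> z * \<zeta> ^ nat (- weight m \<tau>)
          else cnj (t \<tau> * monomial \<tau> z) * \<zeta> ^ nat (weight m \<tau>)) holomorphic_on UNIV" for \<tau>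
          by (cases "weight m \<tau> \<le> 0") (auto intro!: holomorphic_intros)
        thus "p holomorphic_on UNIV" unfolding p_def by (intro holomorphic_intros)
        have "(\<Sum>\<kappa>\<in>B. cnj (d \<kappa> * monomial \<kappa> z) * 0 ^ nat (weight m \<kappa> - M)) = 0"
          using gt by (intro sum.neutral) (auto simp: zero_power)
        thus "h 0 = 0" by (simp only: h_def mult_zero_right)
        fix \<zeta> :: complex assume \<zeta>: "norm \<zeta> = 1"
        hence \<zeta>0: "\<zeta> \<noteq> 0" by auto
        define z' where "z' = (\<lambda>j. z j * \<zeta> powi (- m j))"
        have z': "z' \<in> torus" unfolding z'_def by (rule torus_rotate[OF z \<zeta>])
        have mono: "monomial \<kappa> z' = monomial \<kappa> z * \<zeta> powi (- weight m \<kappa>)" for \<kappa>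
          unfolding z'_def by (rule monomial_rotate[OF \<zeta>0])
        have cnj_powi: "cnj \<zeta> powi k = \<zeta> powi (- k)" for k
        proof -
          have "cnj \<zeta> = inverse \<zeta>"
            using complex_norm_square[of \<zeta>] \<zeta> by (intro inverse_unique[symmetric]) simp
          thus ?thesis by (simp add: power_int_minus power_int_inverse)
        qed
        \<comment> \<open>The factors \<open>\<zeta> powi M\<close> and
          \<open>\<zeta> powi (- M)\<close> cancel, but they make all exponents of the first sum
          non-negative and all exponents of the second one positive, whence
          \<open>h 0 = 0\<close>.\<close>
        have "w z' * cnj (v z') = (\<zeta> powi M * w z') * (\<zeta> powi (- M) * cnj (v z'))"
          using \<zeta>0 by (simp add: power_int_minus)
        also have "\<zeta> powi M * w z' = (\<Sum>\<kappa>\<in>A. c \<kappa> * monomial \<kappa> z * \<zeta> ^ nat (M - weight m \<kappa>))"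
          unfolding w_def sum_distrib_left mono
        proof (rule sum.cong[OF refl])
          fix \<kappa> assume "\<kappa> \<in> A"
          have "\<zeta> powi M * \<zeta> powi (- weight m \<kappa>) = \<zeta> powi (M - weight m \<kappa>)"
            using \<zeta>0 by (simp flip: power_int_add)
          also have "\<dots> = \<zeta> ^ nat (M - weight m \<kappa>)" using le[OF \<open>\<kappa> \<in> A\<close>] by (simp add: power_int_def)
          finally show "\<zeta> powi M * (c \<kappa> * (monomial \<kappa> z * \<zeta> powi (- weight m \<kappa>))) = c \<kappa> * monomial \<kappa> z * \<zeta> ^ nat (M - weight m \<kappa>)"
            by (simp add: mult_ac)
        qed
        also have "\<zeta> powi (- M) * cnj (v z') = (\<Sum>\<kappa>\<in>B. cnj (d \<kappa> * monomial \<kappa> z) * \<zeta> ^ nat (weight m \<kappa> - M))"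
          unfolding v_def cnj_sum sum_distrib_left mono
        proof (rule sum.cong[OF refl])
          fix \<kappa> assume "\<kappa> \<in> B"
          have "\<zeta> powi (- M) * \<zeta> powi (weight m \<kappa>) = \<zeta> powi (weight m \<kappa> - M)"
            using \<zeta>0 by (simp flip: power_int_add)
          also have "\<dots> = \<zeta> ^ nat (weight m \<kappa> - M)" using gt[OF \<open>\<kappa> \<in> B\<close>] by (simp add: power_int_def)
          finally show "\<zeta> powi (- M) * cnj (d \<kappa> * (monomial \<kappa> z * \<zeta> powi (- weight m \<kappa>))) =
              cnj (d \<kappa> * monomial \<kappa> z) * \<zeta> ^ nat (weight m \<kappa> - M)"
            by (simp add: cnj_powi mult_ac)
        qed
        finally have hz: "w z' * cnj (v z') = h \<zeta>" by (simp add: h_def)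
        have "Re (T z') = (\<Sum>\<tau>\<in>D. Re (t \<tau> * monomial \<tau> z'))" by (simp add: D(3)[OF z'])
        also have "\<dots> = (\<Sum>\<tau>\<in>D. Re (if weight m \<tau> \<le> 0 then t \<tau> * monomial \<tau> z * \<zeta> ^ nat (- weight m \<tau>)
          else cnj (t \<tau> * monomial \<tau> z) * \<zeta> ^ nat (weight m \<tau>)))"
        proof (rule sum.cong[OF refl])
          fix \<tau>
          show "Re (t \<tau> * monomial \<tau> z') = Re (if weight m \<tau> \<le> 0 then t \<tau> * monomial \<tau> z * \<zeta> ^ nat (- weight m \<tau>)
            else cnj (t \<tau> * monomial \<tau> z) * \<zeta> ^ nat (weight m \<tau>))"
          proof (cases "weight m \<tau> \<le> 0")
            case True
            hence "\<zeta> powi (- weight m \<tau>) = \<zeta> ^ nat (- weight m \<tau>)" by (simp add: power_int_def)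
            thus ?thesis using True by (simp only: mono if_True mult.assoc)
          next
            case False
            hence "\<zeta> powi (weight m \<tau>) = \<zeta> ^ nat (weight m \<tau>)" by (simp add: power_int_def)
            hence "cnj (t \<tau> * monomial \<tau> z) * \<zeta> ^ nat (weight m \<tau>) = cnj (t \<tau> * monomial \<tau> z')"
              by (simp add: mono cnj_powi)
            thus ?thesis using False by (simp only: if_False complex_cnj(1) cnj.simps)
          qed
        qed
        also have "\<dots> = Re (p \<zeta>)" by (simp only: p_def Re_sum)
        finally have "Re (T z') = Re (p \<zeta>)" .
        thus "Re_powr s (h \<zeta>) \<le> Re (p \<zeta>) + \<epsilon>"
          using close[OF z'] by (simp add: U_def hz)
      qed
      also have "p 0 = (\<Sum>\<tau>\<in>D. if weight m \<tau> = 0 then t \<tau> * monomial \<tau> z else 0)"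
        unfolding p_def by (intro sum.cong refl) (auto simp: zero_power)
      finally show ?thesis .
    qed
    have int_term: "integrable polytorus (\<lambda>z. if weight m \<tau> = 0 then t \<tau> * monomial \<tau> z else 0)" for \<tau>
      by (cases "weight m \<tau> = 0") (auto intro!: integrable_mult_right integrable_polytorus_continuous continuous_intros continuous_on_monomial)
    have "- \<epsilon> = (LINT z|polytorus. - \<epsilon>)" by (simp add: polytorus.prob_space)
    also have "\<dots> \<le> (LINT z|polytorus. Re (\<Sum>\<tau>\<in>D. if weight m \<tau> = 0 then t \<tau> * monomial \<tau> z else 0))"
      using orbit int_term by (intro integral_mono) (auto simp: space_polytorus simp del: Re_sum)
    also have "\<dots> = Re (LINT z|polytorus. (\<Sum>\<tau>\<in>D. if weight m \<tau> = 0 then t \<tau> * monomial \<tau> z else 0))"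
      using int_term by (intro integral_Re Bochner_Integration.integrable_sum) auto
    also have "(LINT z|polytorus. (\<Sum>\<tau>\<in>D. if weight m \<tau> = 0 then t \<tau> * monomial \<tau> z else 0)) =
        (\<Sum>\<tau>\<in>D. LINT z|polytorus. (if weight m \<tau> = 0 then t \<tau> * monomial \<tau> z else 0))"
      by (rule Bochner_Integration.integral_sum) (rule int_term)
    \<comment> \<open>Terms of non-zero weight have a non-zero frequency and integrate to 0, so they
      may be put back.\<close>
    also have "\<dots> = (\<Sum>\<tau>\<in>D. LINT z|polytorus. t \<tau> * monomial \<tau> z)"
    proof (rule sum.cong[OF refl])
      fix \<tau> assume "\<tau> \<in> D"
      hence \<tau>: "\<tau> \<in> fin_supp" using D(2) by auto
      show "(LINT z|polytorus. (if weight m \<tau> = 0 then t \<tau> * monomial \<tau> z else 0)) = (LINT z|polytorus. t \<tau> * monomial \<tau> z)"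
        using integral_monomial[OF \<tau>] by (cases "weight m \<tau> = 0") (auto simp: weight_def)
    qed
    also have "\<dots> = (LINT z|polytorus. (\<Sum>\<tau>\<in>D. t \<tau> * monomial \<tau> z))"
      by (rule Bochner_Integration.integral_sum[symmetric])
         (intro integrable_mult_right integrable_polytorus_continuous continuous_on_monomial)
    also have "\<dots> = integral\<^sup>L polytorus T"
      by (intro Bochner_Integration.integral_cong) (auto simp: space_polytorus D(3))
    also have "Re \<dots> = (LINT z|polytorus. Re (T z))"
      by (rule integral_Re[OF intT, symmetric])
    also have "\<dots> \<le> (LINT z|polytorus. U z + \<epsilon>)"
    proof (rule integral_mono)
      show "integrable polytorus (\<lambda>z. Re (T z))" using intT by (rule integrable_Re)
      show "integrable polytorus (\<lambda>z. U z + \<epsilon>)" using intU by simp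
      show "Re (T z) \<le> U z + \<epsilon>" if "z \<in> space polytorus" for z
        using close[of z] that by (simp add: space_polytorus)
    qed
    also have "\<dots> = (LINT z|polytorus. U z) + \<epsilon>" using intU by (simp add: polytorus.prob_space)
    finally have "- \<epsilon> \<le> (LINT z|polytorus. U z) + \<epsilon>" .
    thus ?thesis by linarith
  qed
  note bound = this
  have "0 \<le> (LINT z|polytorus. U z)"
  proof (rule field_le_epsilon)
    fix e :: real assume "0 < e"
    thus "0 \<le> (LINT z|polytorus. U z) + e" using bound[of "e / 2"] by simp
  qed
  thus ?thesis by (simp add: U_def w_def v_def)
qed

lemma riesz_le_2_integer:
  assumes p: "1 < p" "p \<le> 2" and A: "finite A" and B: "finite B"
    and le: "\<And>\<kappa>. \<kappa> \<in> A \<Longrightarrow> weight m \<kappa> \<le> (M::int)" and gt: "\<And>\<kappa>. \<kappa> \<in> B \<Longrightarrow> M < weight m \<kappa>"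
  shows "(LINT z|polytorus. norm (\<Sum>\<kappa>\<in>A. c \<kappa> * monomial \<kappa> z) powr p) \<le>
    (1 / sin (pi / p)) powr p * (LINT z|polytorus. norm ((\<Sum>\<kappa>\<in>A. c \<kappa> * monomial \<kappa> z) + (\<Sum>\<kappa>\<in>B. c \<kappa> * monomial \<kappa> z)) powr p)"
proof -
  define w where "w z = (\<Sum>\<kappa>\<in>A. c \<kappa> * monomial \<kappa> z)" for z
  define v where "v z = (\<Sum>\<kappa>\<in>B. c \<kappa> * monomial \<kappa> z)" for z
  define a where "a = (1 / sin (pi / p)) powr p"
  have cont: "continuous_on torus w" "continuous_on torus v"
    unfolding w_def v_def by (rule continuous_on_sum_monomial)+
  obtain b where b: "b \<ge> 0" "\<And>x y. norm x powr p \<le> a * norm (x + cnj y) powr p - b * Re_powr (p / 2) (x * y)"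
    using riesz_pointwise[OF p] unfolding a_def by blast
  have int: "integrable polytorus (\<lambda>z. norm (w z) powr p)" "integrable polytorus (\<lambda>z. norm (w z + v z) powr p)"
    "integrable polytorus (\<lambda>z. Re_powr (p / 2) (w z * cnj (v z)))"
    using p by (intro integrable_polytorus_continuous continuous_on_powr' continuous_intros cont
      continuous_on_compose2[OF continuous_on_Re_powr[of "p / 2" UNIV]]; force)+
  have "(LINT z|polytorus. norm (w z) powr p) \<le>
     (LINT z|polytorus. a * norm (w z + v z) powr p - b * Re_powr (p / 2) (w z * cnj (v z)))"
    using int b(2)[of "w _" "cnj (v _)"] by (intro integral_mono) auto
  also have "\<dots> = a * (LINT z|polytorus. norm (w z + v z) powr p) - b * (LINT z|polytorus. Re_powr (p / 2) (w z * cnj (v z)))"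
    using int by simp
  also have "\<dots> \<le> a * (LINT z|polytorus. norm (w z + v z) powr p)"
    using b(1) integral_Re_powr_nonneg[OF _ _ A B le gt, of "p / 2" c c] p by (simp add: w_def v_def)
  finally show ?thesis by (simp add: a_def w_def v_def)
qed

text \<open>Rounding \<open>N * l\<close> down changes the weights on \<open>A\<close> by at most a
  fixed \<open>B\<close>, while \<open>N\<close> times the least excess over \<open>L\<close> grows
  beyond \<open>2 * B\<close>. So the threshold \<open>N * L + B\<close> separates the same
  frequencies as \<open>L\<close> does.\<close>

lemma integer_weights:
  fixes l :: "nat \<Rightarrow> real"
  assumes A: "finite A" "A \<subseteq> fin_supp"
  obtains m :: "nat \<Rightarrow> int" and M :: int where "\<And>\<kappa>. \<kappa> \<in> A \<Longrightarrow> weight m \<kappa> \<le> M \<longleftrightarrow> weight l \<kappa> \<le> L"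
proof -
  define b where "b \<kappa> = (\<Sum>j\<in>{j. \<kappa> j \<noteq> 0}. \<bar>real_of_int (\<kappa> j)\<bar>)" for \<kappa> :: "nat \<Rightarrow> int"
  define B where "B = (\<Sum>\<kappa>\<in>A. b \<kappa>)"
  have b0: "b \<kappa> \<ge> 0" for \<kappa> by (simp add: b_def sum_nonneg)
  have bB: "b \<kappa> \<le> B" if "\<kappa> \<in> A" for \<kappa>
    unfolding B_def using that A(1) b0 by (intro member_le_sum) auto
  define \<delta> where "\<delta> = Min (insert 1 ((\<lambda>\<kappa>. weight l \<kappa> - L) ` {\<kappa>\<in>A. weight l \<kappa> > L}))"
  have \<delta>: "\<delta> > 0" using A(1) by (auto simp: \<delta>_def)
  have gap: "L + \<delta> \<le> weight l \<kappa>" if "\<kappa> \<in> A" "weight l \<kappa> > L" for \<kappa>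
  proof -
    have "\<delta> \<le> weight l \<kappa> - L" unfolding \<delta>_def using A(1) that by (intro Min_le) auto
    thus ?thesis by simp
  qed
  obtain N where N: "2 * B / \<delta> < real N" using reals_Archimedean2 by blast
  hence N: "2 * B < real N * \<delta>" using \<delta> by (simp add: field_simps)
  define m where "m j = \<lfloor>real N * l j\<rfloor>" for j
  show thesis
  proof (rule that)
    fix \<kappa> assume \<kappa>: "\<kappa> \<in> A"
    have "\<bar>real_of_int (weight m \<kappa>) - real N * weight l \<kappa>\<bar> \<le> b \<kappa>"
    proof -
      have "real_of_int (weight m \<kappa>) - real N * weight l \<kappa> = (\<Sum>j\<in>{j. \<kappa> j \<noteq> 0}. (real_of_int (m j) - real N * l j) * real_of_int (\<kappa> j))"
        by (simp add: weight_def sum_distrib_left sum_subtractf left_diff_distrib mult.assoc)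
      also have "\<bar>\<dots>\<bar> \<le> (\<Sum>j\<in>{j. \<kappa> j \<noteq> 0}. \<bar>(real_of_int (m j) - real N * l j) * real_of_int (\<kappa> j)\<bar>)"
        by (rule sum_abs)
      also have "\<dots> \<le> b \<kappa>"
        unfolding b_def abs_mult by (intro sum_mono mult_left_le_one_le) (auto simp: m_def, linarith)
      finally show ?thesis .
    qed
    hence err: "\<bar>real_of_int (weight m \<kappa>) - real N * weight l \<kappa>\<bar> \<le> B" using bB[OF \<kappa>] by linarith
    show "weight m \<kappa> \<le> \<lfloor>real N * L + B\<rfloor> \<longleftrightarrow> weight l \<kappa> \<le> L"
    proof (cases "weight l \<kappa> \<le> L")
      case True
      hence "real N * weight l \<kappa> \<le> real N * L" by (intro mult_left_mono) auto
      thus ?thesis using True err by (simp add: le_floor_iff)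
    next
      case False
      hence "real N * (L + \<delta>) \<le> real N * weight l \<kappa>" using gap[OF \<kappa>] by (intro mult_left_mono) auto
      hence "real N * L + B < real_of_int (weight m \<kappa>)" using err N by (simp add: algebra_simps abs_le_iff)
      thus ?thesis using False by (simp add: le_floor_iff)
    qed
  qed
qed

lemma riesz_le_2:
  fixes l :: "nat \<Rightarrow> real"
  assumes p: "1 < p" "p \<le> 2" and A: "finite A" "A \<subseteq> fin_supp"
  shows "(LINT z|polytorus. norm (\<Sum>\<kappa>\<in>{\<kappa>\<in>A. weight l \<kappa> \<le> L}. c \<kappa> * monomial \<kappa> z) powr p) \<le>
    (1 / sin (pi / p)) powr p * (LINT z|polytorus. norm (\<Sum>\<kappa>\<in>A. c \<kappa> * monomial \<kappa> z) powr p)"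
proof -
  obtain m and M :: int where mM: "\<And>\<kappa>. \<kappa> \<in> A \<Longrightarrow> weight m \<kappa> \<le> M \<longleftrightarrow> weight l \<kappa> \<le> L"
    using integer_weights[OF A] by metis
  have "(\<Sum>\<kappa>\<in>A. c \<kappa> * monomial \<kappa> z) =
     (\<Sum>\<kappa>\<in>{\<kappa>\<in>A. weight l \<kappa> \<le> L}. c \<kappa> * monomial \<kappa> z) + (\<Sum>\<kappa>\<in>{\<kappa>\<in>A. \<not> weight l \<kappa> \<le> L}. c \<kappa> * monomial \<kappa> z)" for z
    using A(1) by (subst sum.union_disjoint[symmetric]) (auto intro!: sum.cong)
  thus ?thesis
    using riesz_le_2_integer[OF p, of "{\<kappa>\<in>A. weight l \<kappa> \<le> L}" "{\<kappa>\<in>A. \<not> weight l \<kappa> \<le> L}" m M c] A(1) mM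
    by (auto simp: not_le[symmetric])
qed

section \<open>Duality\<close>

text \<open>Young's inequality for \<open>norm (f z) / x\<close> and \<open>norm (g z) / y\<close>,
  integrated. Positive upper bounds \<open>x\<close>, \<open>y\<close> in place of the norms avoid a
  separate case for null functions.\<close>

lemma Holder_bound:
  fixes f g :: "'a \<Rightarrow> complex"
  assumes pq: "1 < p" "1 < q" "1 / p + 1 / q = 1"
    and f: "f \<in> borel_measurable M" "integrable M (\<lambda>z. norm (f z) powr p)" "(LINT z|M. norm (f z) powr p) \<le> x powr p" "x > 0"
    and g: "g \<in> borel_measurable M" "integrable M (\<lambda>z. norm (g z) powr q)" "(LINT z|M. norm (g z) powr q) \<le> y powr q" "y > 0"
  shows "norm (LINT z|M. f z * g z) \<le> x * y"
proof -
  define h where "h z = x * y * (norm (f z) powr p / (p * x powr p) + norm (g z) powr q / (q * y powr q))" for z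
  have le: "norm (f z * g z) \<le> h z" for z
  proof -
    have "(norm (f z) / x) * (norm (g z) / y) \<le> (norm (f z) / x) powr p / p + (norm (g z) / y) powr q / q"
      using assms by (intro Youngs_inequality) auto
    hence "x * y * ((norm (f z) / x) * (norm (g z) / y)) \<le> x * y * ((norm (f z) / x) powr p / p + (norm (g z) / y) powr q / q)"
      using f g by (intro mult_left_mono) auto
    thus ?thesis using f(4) g(4) by (simp add: h_def norm_mult powr_divide field_simps)
  qed
  have inth: "integrable M h" unfolding h_def using f(2) g(2) by auto
  have int: "integrable M (\<lambda>z. f z * g z)"
  proof (rule Bochner_Integration.integrable_bound[OF inth])
    show "AE z in M. norm (f z * g z) \<le> norm (h z)"
    proof (rule AE_I2)
      fix z show "norm (f z * g z) \<le> norm (h z)" 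
        using order_trans[OF le[of z] abs_ge_self] by (simp only: real_norm_def)
    qed
  qed (use f(1) g(1) in measurable)
  have "norm (LINT z|M. f z * g z) \<le> (LINT z|M. norm (f z * g z))" by (rule integral_norm_bound)
  also have "\<dots> \<le> (LINT z|M. h z)" using le int inth by (intro integral_mono) auto
  also have "\<dots> = x * y * ((LINT z|M. norm (f z) powr p) / (p * x powr p) + (LINT z|M. norm (g z) powr q) / (q * y powr q))"
    unfolding h_def using f(2) g(2) by simp
  also have "\<dots> \<le> x * y * (x powr p / (p * x powr p) + y powr q / (q * y powr q))"
    using f g pq by (intro mult_left_mono add_mono divide_right_mono) auto
  also have "\<dots> = x * y * (1 / p + 1 / q)" using f g by simp
  finally show ?thesis using pq by simp
qed

text \<open>For \<open>q < 2\<close> the first factor is unbounded near 0, but the product has norm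
  \<open>norm u powr (q - 1)\<close>.\<close>

lemma continuous_on_powr_mult:
  assumes "1 < q"
  shows "continuous_on A (\<lambda>u::complex. complex_of_real (norm u powr (q - 2)) * u)"
proof -
  have norm: "norm (complex_of_real (norm u powr (q - 2)) * u) = norm u powr (q - 1)" for u :: complex
  proof (cases "u = 0")
    case False
    thus ?thesis using powr_add[of "norm u" "q - 2" 1] by (simp add: norm_mult algebra_simps)
  qed simp
  have "isCont (\<lambda>u::complex. complex_of_real (norm u powr (q - 2)) * u) u" for u
  proof (cases "u = 0")
    case True
    have "((\<lambda>u::complex. norm u powr (q - 1)) \<longlongrightarrow> norm (0::complex) powr (q - 1)) (at 0)"
      using assms by (intro tendsto_powr' tendsto_intros) auto
    hence "((\<lambda>u::complex. norm u powr (q - 1)) \<longlongrightarrow> 0) (at 0)" by simp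
    hence "((\<lambda>u::complex. complex_of_real (norm u powr (q - 2)) * u) \<longlongrightarrow> 0) (at 0)"
      by (rule Lim_null_comparison[rotated]) (simp only: norm, simp)
    thus ?thesis using True by (simp add: isCont_def)
  next
    case False
    have "continuous_on (- {0}) (\<lambda>u::complex. complex_of_real (norm u powr (q - 2)) * u)"
      by (intro continuous_intros) auto
    thus ?thesis using False by (simp add: continuous_on_eq_continuous_at open_Compl)
  qed
  thus ?thesis by (simp add: continuous_at_imp_continuous_on)
qed

lemma Lq_torus_imp_integrable:
  assumes "F \<in> Lq_torus q" "1 < q"
  shows "integrable polytorus F"
proof (rule Bochner_Integration.integrable_bound)
  show "integrable polytorus (\<lambda>z. 1 + norm (F z) powr q)" "F \<in> borel_measurable polytorus"
    using assms by (auto simp: Lq_torus_def)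
  show "AE z in polytorus. norm (F z) \<le> norm (1 + norm (F z) powr q)"
  proof (rule AE_I2)
    fix z
    show "norm (F z) \<le> norm (1 + norm (F z) powr q)"
    proof (cases "norm (F z) \<le> 1")
      case False
      hence "norm (F z) powr 1 \<le> norm (F z) powr q" using assms by (intro powr_mono) auto
      thus ?thesis by simp
    qed (simp add: add_increasing2)
  qed
qed

lemma continuous_in_Lq_torus:
  assumes "continuous_on torus F" "0 < q"
  shows "F \<in> Lq_torus q"
proof -
  have "continuous_on torus (\<lambda>z. norm (F z) powr q)"
    using assms by (intro continuous_on_powr' continuous_intros) auto
  thus ?thesis unfolding Lq_torus_def
    using assms by (auto intro!: borel_measurable_polytorus integrable_polytorus_continuous)
qed

definition riesz_bound :: "(nat \<Rightarrow> real) \<Rightarrow> real \<Rightarrow> real \<Rightarrow> real \<Rightarrow> bool" where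
  "riesz_bound l L p C \<longleftrightarrow> (\<forall>A c. finite A \<longrightarrow> A \<subseteq> fin_supp \<longrightarrow>
     (LINT z|polytorus. norm (\<Sum>\<kappa>\<in>{\<kappa>\<in>A. weight l \<kappa> \<le> L}. c \<kappa> * monomial \<kappa> z) powr p) \<le>
     C powr p * (LINT z|polytorus. norm (\<Sum>\<kappa>\<in>A. c \<kappa> * monomial \<kappa> z) powr p))"

text \<open>Pairing with approximations of \<open>(norm G) powr (q - 2) * G\<close>, the extremal function
  of Hoelder's inequality, moves the projection to the dual exponent.\<close>

lemma riesz_bound_dual:
  fixes l :: "nat \<Rightarrow> real"
  assumes pq: "1 < p" "1 < q" "1 / p + 1 / q = 1" and C: "C > 0" and bound: "riesz_bound l L p C"
    and F: "F \<in> Lq_torus q" and A: "finite A" "A \<subseteq> fin_supp" "\<And>\<kappa>. \<kappa> \<in> A \<Longrightarrow> weight l \<kappa> \<le> L"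
    and supp: "\<And>\<kappa>. \<kappa> \<in> fin_supp \<Longrightarrow> weight l \<kappa> \<le> L \<Longrightarrow> \<kappa> \<notin> A \<Longrightarrow> fourier_coeff F \<kappa> = 0"
  shows "(LINT z|polytorus. norm (\<Sum>\<kappa>\<in>A. fourier_coeff F \<kappa> * monomial \<kappa> z) powr q)
    \<le> C powr q * (LINT z|polytorus. norm (F z) powr q)"
proof -
  define G where "G z = (\<Sum>\<kappa>\<in>A. fourier_coeff F \<kappa> * monomial \<kappa> z)" for z
  define \<Psi> where "\<Psi> z = complex_of_real (norm (G z) powr (q - 2)) * G z" for z
  define I where "I = (LINT z|polytorus. norm (G z) powr q)"
  define J where "J = (LINT z|polytorus. norm (F z) powr q)"
  have Fint: "integrable polytorus F" by (rule Lq_torus_imp_integrable[OF F pq(2)])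
  have contG: "continuous_on torus G" unfolding G_def by (rule continuous_on_sum_monomial)
  have cont\<Psi>: "continuous_on torus \<Psi>"
    unfolding \<Psi>_def by (rule continuous_on_compose2[OF continuous_on_powr_mult[OF pq(2), of UNIV] contG]) simp
  have Gint: "integrable polytorus G" by (rule integrable_polytorus_continuous[OF contG])
  have \<Psi>p: "norm (\<Psi> z) powr p = norm (G z) powr q" for z
  proof (cases "G z = 0")
    case False
    have "(q - 1) * p = q" using pq by (simp add: field_simps)
    moreover have "norm (\<Psi> z) = norm (G z) powr (q - 1)"
      using False powr_add[of "norm (G z)" "q - 2" 1] by (simp add: \<Psi>_def norm_mult algebra_simps)
    ultimately show ?thesis by (simp add: powr_powr)
  qed (use pq in \<open>simp add: \<Psi>_def\<close>)
  have G\<Psi>: "G z * cnj (\<Psi> z) = complex_of_real (norm (G z) powr q)" for z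
  proof (cases "G z = 0")
    case False
    have "G z * cnj (\<Psi> z) = complex_of_real (norm (G z) powr (q - 2)) * (G z * cnj (G z))"
      by (simp add: \<Psi>_def)
    also have "\<dots> = complex_of_real (norm (G z) powr (q - 2) * norm (G z) powr 2)"
      by (simp add: complex_norm_square[symmetric])
    also have "norm (G z) powr (q - 2) * norm (G z) powr 2 = norm (G z) powr q"
      by (subst powr_add[symmetric]) simp
    finally show ?thesis .
  qed (simp add: \<Psi>_def)
  obtain K where K: "\<And>z. z \<in> torus \<Longrightarrow> norm (\<Psi> z) \<le> K"
    using compact_imp_bounded[OF compact_continuous_image[OF cont\<Psi> compact_torus]]
    by (metis bounded_iff image_eqI)
  obtain K' where K': "\<And>z. z \<in> torus \<Longrightarrow> norm (G z) \<le> K'"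
    using compact_imp_bounded[OF compact_continuous_image[OF contG compact_torus]]
    by (metis bounded_iff image_eqI)
  have "\<exists>H. H \<in> trig_polys \<and> (\<forall>z\<in>torus. norm (\<Psi> z - H z) < 1 / real (Suc n))" for n
    using trig_polys_dense[OF cont\<Psi>, of "1 / real (Suc n)"] by (metis of_nat_0_less_iff zero_less_Suc zero_less_divide_1_iff)
  then obtain H where H: "\<And>n. H n \<in> trig_polys" "\<And>n z. z \<in> torus \<Longrightarrow> norm (\<Psi> z - H n z) < 1 / real (Suc n)"
    by metis
  have contH: "continuous_on torus (H n)" for n by (rule continuous_on_trig_poly[OF H(1)])
  have limH: "(\<lambda>n. H n z) \<longlonglongrightarrow> \<Psi> z" if "z \<in> torus" for z
  proof -
    have "(\<lambda>n. \<Psi> z - H n z) \<longlonglongrightarrow> 0"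
    proof (rule Lim_null_comparison)
      show "\<forall>\<^sub>F n in sequentially. norm (\<Psi> z - H n z) \<le> 1 / real (Suc n)"
        using H(2)[OF that] by (intro always_eventually allI less_imp_le) auto
      show "(\<lambda>n. 1 / real (Suc n)) \<longlonglongrightarrow> 0" by (rule LIMSEQ_Suc[OF lim_1_over_n])
    qed
    from tendsto_diff[OF tendsto_const[of "\<Psi> z"] this] show ?thesis by simp
  qed
  have boundH: "norm (H n z) \<le> K + 1" if "z \<in> torus" for n z
  proof -
    have "1 / real (Suc n) \<le> 1" by simp
    moreover have "norm (H n z) - norm (\<Psi> z) \<le> norm (\<Psi> z - H n z)"
      using norm_triangle_ineq2[of "H n z" "\<Psi> z"] by (simp add: norm_minus_commute)
    ultimately show ?thesis using K[OF that] H(2)[OF that, of n] by linarith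
  qed
  have lim1: "(\<lambda>n. LINT z|polytorus. norm (H n z) powr p) \<longlonglongrightarrow> I"
    unfolding I_def \<Psi>p[symmetric]
  proof (rule integral_dominated_convergence[where w = "\<lambda>_. (K + 1) powr p"])
    show "AE z in polytorus. (\<lambda>n. norm (H n z) powr p) \<longlonglongrightarrow> norm (\<Psi> z) powr p"
      using pq by (intro AE_I2 tendsto_powr' tendsto_intros limH) (auto simp: space_polytorus)
    show "AE z in polytorus. norm (norm (H n z) powr p) \<le> (K + 1) powr p" for n
      using boundH pq by (intro AE_I2) (auto simp: space_polytorus intro!: powr_mono2)
    have "continuous_on torus (\<lambda>z. norm (f z) powr p)" if "continuous_on torus f" for f :: "_ \<Rightarrow> complex"
      using that pq by (intro continuous_on_powr' continuous_intros) auto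
    thus "(\<lambda>z. norm (\<Psi> z) powr p) \<in> borel_measurable polytorus"
      "(\<lambda>z. norm (H n z) powr p) \<in> borel_measurable polytorus" for n
      using cont\<Psi> contH by (auto intro: borel_measurable_polytorus)
  qed simp
  have lim2: "(\<lambda>n. LINT z|polytorus. G z * cnj (H n z)) \<longlonglongrightarrow> complex_of_real I"
  proof -
    have "(\<lambda>n. LINT z|polytorus. G z * cnj (H n z)) \<longlonglongrightarrow> (LINT z|polytorus. G z * cnj (\<Psi> z))"
    proof (rule integral_dominated_convergence[where w = "\<lambda>_. K' * (K + 1)"])
      show "AE z in polytorus. (\<lambda>n. G z * cnj (H n z)) \<longlonglongrightarrow> G z * cnj (\<Psi> z)"
        by (intro AE_I2 tendsto_intros limH) (auto simp: space_polytorus)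
      show "AE z in polytorus. norm (G z * cnj (H n z)) \<le> K' * (K + 1)" for n
      proof (rule AE_I2)
        fix z assume "z \<in> space polytorus"
        hence z: "z \<in> torus" by (simp add: space_polytorus)
        have "norm (G z) * norm (H n z) \<le> K' * (K + 1)"
          using K'[OF z] boundH[OF z, of n] by (intro mult_mono) (auto intro: order_trans[OF norm_ge_zero])
        thus "norm (G z * cnj (H n z)) \<le> K' * (K + 1)" by (simp add: norm_mult)
      qed
    qed (auto intro!: borel_measurable_polytorus continuous_intros cont\<Psi> contH contG)
    thus ?thesis unfolding G\<Psi> I_def by simp
  qed
  have I0: "I \<ge> 0" and J0: "J \<ge> 0" by (auto simp: I_def J_def)
  \<comment> \<open>The summand \<open>\<delta>\<close> keeps both bounds positive, as
    \<open>Holder_bound\<close> demands, even if \<open>F\<close> or \<open>H n\<close>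
    vanishes.\<close>
  have main: "norm (LINT z|polytorus. G z * cnj (H n z)) \<le>
     (J + \<delta>) powr (1 / q) * (C * ((LINT z|polytorus. norm (H n z) powr p) + \<delta>) powr (1 / p))" if \<delta>: "\<delta> > 0" for n \<delta>
  proof -
    obtain B c where B: "finite B" "B \<subseteq> fin_supp" "\<And>z. z \<in> torus \<Longrightarrow> H n z = (\<Sum>\<kappa>\<in>B. c \<kappa> * monomial \<kappa> z)"
      using H(1)[of n] by (rule trig_polysE) blast
    define B' where "B' = {\<kappa>\<in>B. weight l \<kappa> \<le> L}"
    define P where "P z = (\<Sum>\<kappa>\<in>B'. c \<kappa> * monomial \<kappa> z)" for z
    have contP: "continuous_on torus P" unfolding P_def by (rule continuous_on_sum_monomial)
    have "(LINT z|polytorus. G z * cnj (H n z)) = (\<Sum>\<kappa>\<in>B. cnj (c \<kappa>) * fourier_coeff G \<kappa>)"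
      by (rule integral_mult_cnj_trig_poly[OF Gint B(1) B(3)])
    \<comment> \<open>Up to the threshold \<open>G\<close> and \<open>F\<close> have the same
      coefficients by \<open>supp\<close>, above it \<open>G\<close> has none. So pairing
      \<open>G\<close> with \<open>H n\<close> amounts to pairing \<open>F\<close> with the
      projection of \<open>H n\<close>, to which the bound for \<open>p\<close> applies.\<close>
    also have "\<dots> = (\<Sum>\<kappa>\<in>B. if weight l \<kappa> \<le> L then cnj (c \<kappa>) * fourier_coeff F \<kappa> else 0)"
    proof (rule sum.cong[OF refl])
      fix \<kappa> assume \<kappa>: "\<kappa> \<in> B"
      have "fourier_coeff G \<kappa> = (if \<kappa> \<in> A then fourier_coeff F \<kappa> else 0)"
        by (rule fourier_coeff_trig_poly[OF A(1,2)]) (use \<kappa> B in \<open>auto simp: G_def\<close>)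
      thus "cnj (c \<kappa>) * fourier_coeff G \<kappa> = (if weight l \<kappa> \<le> L then cnj (c \<kappa>) * fourier_coeff F \<kappa> else 0)"
        using A(3)[of \<kappa>] supp[of \<kappa>] \<kappa> B(2) by auto
    qed
    also have "\<dots> = (\<Sum>\<kappa>\<in>B'. cnj (c \<kappa>) * fourier_coeff F \<kappa>)"
      unfolding B'_def using B(1) by (rule sum.inter_filter[symmetric])
    also have "\<dots> = (LINT z|polytorus. F z * cnj (P z))"
      by (rule integral_mult_cnj_trig_poly[symmetric, OF Fint]) (use B(1) in \<open>auto simp: P_def B'_def\<close>)
    finally have eq: "(LINT z|polytorus. G z * cnj (H n z)) = (LINT z|polytorus. F z * cnj (P z))" .
    define Y where "Y = (LINT z|polytorus. norm (H n z) powr p)"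
    have Y0: "Y \<ge> 0" by (simp add: Y_def)
    have "(LINT z|polytorus. norm (P z) powr p) \<le> C powr p * (LINT z|polytorus. norm (\<Sum>\<kappa>\<in>B. c \<kappa> * monomial \<kappa> z) powr p)"
      using bound B(1,2) unfolding riesz_bound_def P_def B'_def by blast
    also have "(LINT z|polytorus. norm (\<Sum>\<kappa>\<in>B. c \<kappa> * monomial \<kappa> z) powr p) = Y"
      unfolding Y_def by (intro Bochner_Integration.integral_cong) (auto simp: B(3) space_polytorus)
    also have "C powr p * Y \<le> C powr p * (Y + \<delta>)" using \<delta> by (intro mult_left_mono) auto
    also have "\<dots> = (C * (Y + \<delta>) powr (1 / p)) powr p"
      using C pq Y0 \<delta> by (simp add: powr_mult powr_powr)
    finally have Pb: "(LINT z|polytorus. norm (cnj (P z)) powr p) \<le> (C * (Y + \<delta>) powr (1 / p)) powr p" by simp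
    have Fb: "(LINT z|polytorus. norm (F z) powr q) \<le> ((J + \<delta>) powr (1 / q)) powr q"
      using J0 \<delta> pq by (simp add: powr_powr J_def)
    show ?thesis unfolding eq Y_def[symmetric]
    proof (rule Holder_bound[OF pq(2,1) _ _ _ Fb _ _ _ Pb])
      show "F \<in> borel_measurable polytorus" "integrable polytorus (\<lambda>z. norm (F z) powr q)"
        using F by (auto simp: Lq_torus_def)
      show "(\<lambda>z. cnj (P z)) \<in> borel_measurable polytorus"
        by (intro borel_measurable_polytorus continuous_intros contP)
      show "integrable polytorus (\<lambda>z. norm (cnj (P z)) powr p)"
        using pq by (intro integrable_polytorus_continuous continuous_on_powr' continuous_intros contP) auto
      show "1 / q + 1 / p = 1" using pq by simp
      show "0 < (J + \<delta>) powr (1 / q)" "0 < C * (Y + \<delta>) powr (1 / p)" using J0 Y0 \<delta> C by auto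
    qed
  qed
  have step: "I \<le> (J + \<delta>) powr (1 / q) * (C * (I + \<delta>) powr (1 / p))" if \<delta>: "\<delta> > 0" for \<delta>
  proof -
    have "norm (complex_of_real I) \<le> (J + \<delta>) powr (1 / q) * (C * (I + \<delta>) powr (1 / p))"
    proof (rule LIMSEQ_le[OF tendsto_norm[OF lim2]])
      show "(\<lambda>n. (J + \<delta>) powr (1 / q) * (C * ((LINT z|polytorus. norm (H n z) powr p) + \<delta>) powr (1 / p)))
        \<longlonglongrightarrow> (J + \<delta>) powr (1 / q) * (C * (I + \<delta>) powr (1 / p))"
        using I0 \<delta> by (intro tendsto_intros lim1) auto
    qed (use main[OF \<delta>] in auto)
    thus ?thesis using I0 by simp
  qed
  have "I \<le> (J + 0) powr (1 / q) * (C * (I + 0) powr (1 / p))"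
  proof (rule tendsto_lowerbound)
    show "((\<lambda>\<delta>. (J + \<delta>) powr (1 / q) * (C * (I + \<delta>) powr (1 / p))) \<longlongrightarrow> (J + 0) powr (1 / q) * (C * (I + 0) powr (1 / p))) (at_right 0)"
      using I0 J0 pq by (intro tendsto_powr' tendsto_intros) (auto simp: eventually_at_right_less[THEN eventually_mono])
    show "\<forall>\<^sub>F \<delta> in at_right 0. I \<le> (J + \<delta>) powr (1 / q) * (C * (I + \<delta>) powr (1 / p))"
      using step by (intro eventually_at_right_less[THEN eventually_mono]) auto
  qed simp
  hence le: "I \<le> J powr (1 / q) * C * I powr (1 / p)" by (simp add: mult.assoc)
  have "I \<le> C powr q * J"
  proof (cases "I = 0")
    case False
    hence Ipos: "I > 0" using I0 by simp
    have "I powr (1 / q) * I powr (1 / p) = I" using Ipos pq by (simp add: add.commute flip: powr_add)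
    hence "I powr (1 / q) * I powr (1 / p) \<le> J powr (1 / q) * C * I powr (1 / p)" using le by simp
    hence "I powr (1 / q) \<le> J powr (1 / q) * C" using Ipos by simp
    hence "(I powr (1 / q)) powr q \<le> (J powr (1 / q) * C) powr q" using pq by (intro powr_mono2) auto
    thus ?thesis using pq I0 J0 C by (simp add: powr_powr powr_mult mult.commute)
  qed (use J0 in simp)
  thus ?thesis by (simp add: I_def J_def G_def)
qed

lemma sin_pi_div_pos: "1 < q \<Longrightarrow> 0 < sin (pi / q)"
  using divide_strict_left_mono[of 1 q pi] by (intro sin_gt_zero) auto

text \<open>For \<open>q > 2\<close> the dual exponent \<open>p\<close> is below 2 and has the same
  constant, because \<open>pi / p = pi - pi / q\<close>.\<close>

lemma riesz_bound_all:
  assumes q: "1 < q"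
  shows "riesz_bound l L q (1 / sin (pi / q))"
proof (cases "q \<le> 2")
  case True
  thus ?thesis unfolding riesz_bound_def using riesz_le_2[OF q True] by blast
next
  case False
  define p where "p = q / (q - 1)"
  have p: "1 < p" "p \<le> 2" "1 / p + 1 / q = 1" using False q by (auto simp: p_def field_simps)
  have "pi / p = pi - pi / q" using q by (simp add: p_def field_simps)
  hence sin: "sin (pi / p) = sin (pi / q)" by simp
  have C: "1 / sin (pi / q) > 0" using sin_pi_div_pos[OF q] by simp
  have bp: "riesz_bound l L p (1 / sin (pi / q))"
    unfolding riesz_bound_def sin[symmetric] using riesz_le_2[OF p(1,2)] by blast
  show ?thesis unfolding riesz_bound_def
  proof (intro allI impI)
    fix A :: "(nat \<Rightarrow> int) set" and c :: "(nat \<Rightarrow> int) \<Rightarrow> complex" assume A: "finite A" "A \<subseteq> fin_supp"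
    define F where "F z = (\<Sum>\<kappa>\<in>A. c \<kappa> * monomial \<kappa> z)" for z
    have F: "F \<in> Lq_torus q"
      unfolding F_def using q by (intro continuous_in_Lq_torus continuous_on_sum_monomial) auto
    have fc: "fourier_coeff F \<kappa> = (if \<kappa> \<in> A then c \<kappa> else 0)" if "\<kappa> \<in> fin_supp" for \<kappa>
      by (rule fourier_coeff_trig_poly[OF A that]) (simp add: F_def)
    define A' where "A' = {\<kappa>\<in>A. weight l \<kappa> \<le> L}"
    have "(LINT z|polytorus. norm (\<Sum>\<kappa>\<in>A'. fourier_coeff F \<kappa> * monomial \<kappa> z) powr q)
       \<le> (1 / sin (pi / q)) powr q * (LINT z|polytorus. norm (F z) powr q)"
      by (rule riesz_bound_dual[OF p(1) q p(3) C bp F]) (use A fc in \<open>auto simp: A'_def\<close>)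
    also have "(\<lambda>z. \<Sum>\<kappa>\<in>A'. fourier_coeff F \<kappa> * monomial \<kappa> z) = (\<lambda>z. \<Sum>\<kappa>\<in>A'. c \<kappa> * monomial \<kappa> z)"
      using A fc by (intro ext sum.cong) (auto simp: A'_def)
    finally show "(LINT z|polytorus. norm (\<Sum>\<kappa>\<in>{\<kappa>\<in>A. weight l \<kappa> \<le> L}. c \<kappa> * monomial \<kappa> z) powr q)
       \<le> (1 / sin (pi / q)) powr q * (LINT z|polytorus. norm (\<Sum>\<kappa>\<in>A. c \<kappa> * monomial \<kappa> z) powr q)"
      by (simp add: F_def A'_def)
  qed
qed

text \<open>One dualisation of the polynomial bound at the dual exponent serves every
  \<open>q > 1\<close> here. It uses only the norm of \<open>F\<close> and its pairings with
  polynomials, so \<open>F\<close> need not be a polynomial.\<close>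

lemma riesz_projection_bound:
  fixes l :: "nat \<Rightarrow> real"
  assumes q: "1 < q" and F: "F \<in> Lq_torus q"
    and A: "finite A" "A \<subseteq> fin_supp" "\<And>\<kappa>. \<kappa> \<in> A \<Longrightarrow> weight l \<kappa> \<le> L"
    and supp: "\<And>\<kappa>. \<kappa> \<in> fin_supp \<Longrightarrow> weight l \<kappa> \<le> L \<Longrightarrow> \<kappa> \<notin> A \<Longrightarrow> fourier_coeff F \<kappa> = 0"
  shows "(LINT z|polytorus. norm (\<Sum>\<kappa>\<in>A. fourier_coeff F \<kappa> * monomial \<kappa> z) powr q)
    \<le> (1 / sin (pi / q)) powr q * (LINT z|polytorus. norm (F z) powr q)"
proof -
  define p where "p = q / (q - 1)"
  have p: "1 < p" "1 / p + 1 / q = 1" using q by (auto simp: p_def field_simps)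
  have "pi / p = pi - pi / q" using q by (simp add: p_def field_simps)
  hence sin: "sin (pi / p) = sin (pi / q)" by simp
  have C: "1 / sin (pi / q) > 0" using sin_pi_div_pos[OF q] by simp
  show ?thesis
    by (rule riesz_bound_dual[OF p(1) q p(2) C _ F A supp]) (use riesz_bound_all[OF p(1)] sin in auto)
qed

section \<open>Dirichlet series and the upper bound\<close>

abbreviation nth_prime :: "nat \<Rightarrow> nat" where
  "nth_prime \<equiv> enumerate {p. prime p}"

lemma prime_nth_prime: "prime (nth_prime j)"
  using enumerate_in_set[OF primes_infinite, of j] by simp

lemma inj_nth_prime: "inj nth_prime"
  by (rule strict_mono_imp_inj_on) (rule strict_mono_enumerate[OF primes_infinite])

lemma ex_nth_prime: "prime p \<Longrightarrow> \<exists>j. nth_prime j = p"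
  using enumerate_Ex[of "{p. prime p}" p] primes_infinite by auto

lemma kappa_fin_supp:
  assumes "n \<ge> 1"
  shows "kappa n \<in> fin_supp"
proof -
  have "{j. kappa n j \<noteq> 0} \<subseteq> nth_prime -` prime_factors n"
    using assms prime_nth_prime by (auto simp: kappa_def prime_factors_multiplicity)
  moreover have "finite (nth_prime -` prime_factors n)"
    by (rule finite_vimageI[OF _ inj_nth_prime]) simp
  ultimately show ?thesis unfolding fin_supp_def mem_Collect_eq by (rule finite_subset)
qed

lemma kappa_inj:
  assumes "m \<ge> 1" "n \<ge> 1" "kappa m = kappa n"
  shows "m = n"
proof (rule multiplicity_eq_nat)
  fix p :: nat assume "prime p"
  then obtain j where "nth_prime j = p" using ex_nth_prime by blast
  thus "multiplicity p m = multiplicity p n"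
    using fun_cong[OF assms(3), of j] by (simp add: kappa_def)
qed (use assms in auto)

lemma ex_kappa:
  assumes "\<kappa> \<in> fin_supp" "\<And>j. \<kappa> j \<ge> 0"
  shows "\<exists>n\<ge>1. kappa n = \<kappa>"
proof -
  let ?S = "{j. \<kappa> j \<noteq> 0}"
  have fin: "finite ?S" using assms(1) by (simp add: fin_supp_def)
  define f where "f p = nat (\<kappa> (inv nth_prime p))" for p
  define n where "n = (\<Prod>p\<in>nth_prime ` ?S. p ^ f p)"
  have "kappa n j = \<kappa> j" for j
  proof -
    have "multiplicity (nth_prime j) n = (if nth_prime j \<in> nth_prime ` ?S then f (nth_prime j) else 0)"
      unfolding n_def using fin prime_nth_prime by (intro multiplicity_prod_prime_powers) auto
    also have "\<dots> = nat (\<kappa> j)"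
      using inj_nth_prime by (auto simp: f_def inj_image_mem_iff)
    finally show ?thesis using assms(2)[of j] by (simp add: kappa_def)
  qed
  moreover have "n \<ge> 1"
  proof -
    have "0 < n"
      unfolding n_def using prime_gt_0_nat[OF prime_nth_prime] by (intro prod_pos) auto
    thus ?thesis by simp
  qed
  ultimately show ?thesis by blast
qed

lemma weight_superset:
  assumes "finite J" "{j. \<kappa> j \<noteq> 0} \<subseteq> J"
  shows "weight l \<kappa> = (\<Sum>j\<in>J. l j * of_int (\<kappa> j))"
  unfolding weight_def using assms by (intro sum.mono_neutral_left) auto

lemma weight_add:
  assumes "\<kappa> \<in> fin_supp" "\<mu> \<in> fin_supp"
  shows "weight l (\<lambda>j. \<kappa> j + \<mu> j) = weight l \<kappa> + weight l \<mu>"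
proof -
  let ?J = "{j. \<kappa> j \<noteq> 0} \<union> {j. \<mu> j \<noteq> 0}"
  have J: "finite ?J" using assms by (auto simp: fin_supp_def)
  have "weight l (\<lambda>j. \<kappa> j + \<mu> j) = (\<Sum>j\<in>?J. l j * of_int (\<kappa> j + \<mu> j))"
    by (rule weight_superset[OF J]) auto
  also have "\<dots> = (\<Sum>j\<in>?J. l j * of_int (\<kappa> j)) + (\<Sum>j\<in>?J. l j * of_int (\<mu> j))"
    by (simp add: sum.distrib distrib_left)
  also have "\<dots> = weight l \<kappa> + weight l \<mu>"
    using weight_superset[OF J, of \<kappa> l] weight_superset[OF J, of \<mu> l] by auto
  finally show ?thesis .
qed

lemma kappa_mult:
  assumes "m \<ge> 1" "n \<ge> 1"
  shows "kappa (m * n) = (\<lambda>j. kappa m j + kappa n j)"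
  using assms prime_nth_prime
  by (auto simp: kappa_def fun_eq_iff prime_elem_multiplicity_mult_distrib)

lemma kappa_nth_prime_power: "kappa (nth_prime i ^ k) = (\<lambda>j. if j = i then int k else 0)"
proof
  fix j
  show "kappa (nth_prime i ^ k) j = (if j = i then int k else 0)"
  proof (cases "j = i")
    case True
    have "\<not> is_unit (nth_prime i)" "nth_prime i \<noteq> 0" using prime_nth_prime[of i] by auto
    thus ?thesis using True by (simp add: kappa_def multiplicity_same_power)
  next
    case False
    hence "nth_prime j \<noteq> nth_prime i" using inj_nth_prime by (auto dest: injD)
    hence "\<not> nth_prime j dvd nth_prime i" using prime_nth_prime by (metis primes_dvd_imp_eq)
    hence "\<not> nth_prime j dvd nth_prime i ^ k" using prime_nth_prime prime_dvd_power by blast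
    thus ?thesis using False by (simp add: kappa_def not_dvd_imp_multiplicity_0)
  qed
qed

section \<open>Uniqueness of the lift\<close>

lemma integrable_fourier:
  assumes "integrable polytorus F"
  shows "integrable polytorus (\<lambda>z. F z * cnj (monomial \<kappa> z))"
  by (intro integrable_mult_continuous assms continuous_intros continuous_on_monomial)

lemma is_bohr_lift_AE_unique:
  assumes q: "1 < q" and F: "is_bohr_lift q a F" and G: "is_bohr_lift q a G"
  shows "AE z in polytorus. F z = G z"
proof -
  have int: "integrable polytorus F" "integrable polytorus G"
    using F G by (auto simp: is_bohr_lift_def Hq_torus_def intro: Lq_torus_imp_integrable[OF _ q])
  have "AE z in polytorus. F z - G z = 0"
  proof (rule fourier_coeff_zero_imp_AE_zero)
    show "integrable polytorus (\<lambda>z. F z - G z)" using int by simp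
    fix \<kappa> :: "nat \<Rightarrow> int" assume \<kappa>: "\<kappa> \<in> fin_supp"
    have "fourier_coeff F \<kappa> = fourier_coeff G \<kappa>"
    proof (cases "\<exists>j. \<kappa> j < 0")
      case True
      thus ?thesis using F G \<kappa> by (simp add: is_bohr_lift_def Hq_torus_def fin_supp_def)
    next
      case False
      then obtain n where "n \<ge> 1" "kappa n = \<kappa>" using ex_kappa[OF \<kappa>] by (auto simp: not_less)
      thus ?thesis using F G by (auto simp: is_bohr_lift_def)
    qed
    thus "fourier_coeff (\<lambda>z. F z - G z) \<kappa> = 0"
      using int by (simp add: fourier_coeff_def left_diff_distrib integrable_fourier)
  qed
  thus ?thesis by simp
qed

text \<open>Uniqueness almost everywhere makes the choice in \<open>Hq_norm\<close> harmless: any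
  lift computes the norm.\<close>

lemma Hq_norm_eq:
  assumes q: "1 < q" and F: "is_bohr_lift q a F"
  shows "Hq_norm q a = ennreal (Lq_norm q F)"
proof -
  define G where "G = (SOME F. is_bohr_lift q a F)"
  have G: "is_bohr_lift q a G" unfolding G_def by (rule someI[of _ F]) fact
  have meas: "F \<in> borel_measurable polytorus" "G \<in> borel_measurable polytorus"
    using F G by (auto simp: is_bohr_lift_def Hq_torus_def Lq_torus_def)
  have "(LINT z|polytorus. norm (F z) powr q) = (LINT z|polytorus. norm (G z) powr q)"
    using is_bohr_lift_AE_unique[OF q F G] meas by (intro integral_cong_AE) auto
  hence "Lq_norm q F = Lq_norm q G" by (simp add: Lq_norm_def)
  moreover have "a \<in> Hq_dirichlet q" using F by (auto simp: Hq_dirichlet_def)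
  ultimately show ?thesis by (simp add: Hq_norm_def G_def)
qed

lemma is_bohr_lift_polynomial:
  assumes q: "1 < q" and N: "finite N" "\<And>n. n \<in> N \<Longrightarrow> n \<ge> 1" and a: "\<And>n. n \<ge> 1 \<Longrightarrow> n \<notin> N \<Longrightarrow> a n = 0"
  shows "is_bohr_lift q a (\<lambda>z. \<Sum>n\<in>N. a n * monomial (kappa n) z)"
proof -
  define F where "F z = (\<Sum>n\<in>N. a n * monomial (kappa n) z)" for z
  define c where "c \<kappa> = a (inv_into N kappa \<kappa>)" for \<kappa>
  have inj: "inj_on kappa N" using N(2) by (auto intro!: inj_onI kappa_inj)
  have sub: "kappa ` N \<subseteq> fin_supp" using N(2) by (auto intro: kappa_fin_supp)
  have F: "F z = (\<Sum>\<kappa>\<in>kappa ` N. c \<kappa> * monomial \<kappa> z)" for z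
    unfolding F_def sum.reindex[OF inj] by (intro sum.cong) (auto simp: c_def inv_into_f_f[OF inj])
  have fc: "fourier_coeff F \<kappa> = (if \<kappa> \<in> kappa ` N then c \<kappa> else 0)" if "\<kappa> \<in> fin_supp" for \<kappa>
    by (rule fourier_coeff_trig_poly) (use N sub that F in auto)
  have "F \<in> Lq_torus q"
    unfolding F_def using q by (intro continuous_in_Lq_torus continuous_intros continuous_on_monomial) auto
  moreover have "fourier_coeff F \<kappa> = 0" if "finite {j. \<kappa> j \<noteq> 0}" "\<exists>j. \<kappa> j < 0" for \<kappa>
  proof -
    have "\<kappa> \<notin> kappa ` N" using that(2) by (auto simp: kappa_def)
    thus ?thesis using fc[of \<kappa>] that by (simp add: fin_supp_def)
  qed
  moreover have "fourier_coeff F (kappa n) = a n" if "n \<ge> 1" for n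
  proof (cases "n \<in> N")
    case True
    thus ?thesis using fc[OF kappa_fin_supp[OF that]] by (simp add: c_def inv_into_f_f[OF inj])
  next
    case False
    hence "kappa n \<notin> kappa ` N" using N(2) that kappa_inj by blast
    thus ?thesis using fc[OF kappa_fin_supp[OF that]] a[OF that False] by simp
  qed
  ultimately show ?thesis unfolding is_bohr_lift_def Hq_torus_def F_def by auto
qed

section \<open>Projections given by a completely multiplicative function\<close>

locale completely_multiplicative =
  fixes g :: "nat \<Rightarrow> real"
  assumes g_pos: "\<And>n. n \<ge> 1 \<Longrightarrow> g n > 0"
    and g_mult: "\<And>m n. m \<ge> 1 \<Longrightarrow> n \<ge> 1 \<Longrightarrow> g (m * n) = g m * g n"
    and g_lim: "filterlim g at_top sequentially"
begin

lemma g_1: "g 1 = 1"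
  using g_mult[of 1 1] g_pos[of 1] by simp

lemma g_power: "n \<ge> 1 \<Longrightarrow> g (n ^ k) = g n ^ k"
  by (induction k) (use g_1 g_mult[of n "n ^ _"] in auto)

text \<open>Otherwise the values \<open>g (n ^ k) = g n ^ k\<close> would stay bounded although
  \<open>n ^ k\<close> tends to infinity.\<close>

lemma g_gt_1:
  assumes "n \<ge> 2"
  shows "g n > 1"
proof (rule ccontr)
  assume "\<not> g n > 1"
  hence le: "g (n ^ k) \<le> 1" for k
    using g_power[of n k] g_pos[of n] assms by (simp add: power_le_one)
  have "filterlim (\<lambda>k. n ^ k) at_top sequentially"
    by (rule filterlim_subseq) (use assms in \<open>auto intro!: strict_monoI power_strict_increasing\<close>)
  from filterlim_compose[OF g_lim this] have "\<forall>\<^sub>F k in sequentially. 1 < g (n ^ k)"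
    by (simp add: filterlim_at_top_dense)
  thus False using le by (auto simp: eventually_sequentially not_less[symmetric])
qed

text \<open>Every projection therefore yields a Dirichlet polynomial, whose lift is given by a
  finite sum.\<close>

lemma finite_le: "finite {n. 1 \<le> n \<and> g n \<le> x}"
proof -
  have "\<forall>\<^sub>F n in sequentially. x < g n" using g_lim by (simp add: filterlim_at_top_dense)
  then obtain M where "\<And>n. n \<ge> M \<Longrightarrow> x < g n" by (auto simp: eventually_sequentially)
  hence "{n. 1 \<le> n \<and> g n \<le> x} \<subseteq> {..<M}" by (auto simp: not_less[symmetric])
  thus ?thesis by (rule finite_subset) simp
qed

text \<open>Complete multiplicativity becomes additivity of the weight, one prime factor at a time.
  This turns the condition \<open>g n \<le> x\<close> into a half-space of frequencies.\<close>

lemma ln_g_eq_weight: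
  assumes "n \<ge> 1"
  shows "ln (g n) = weight (\<lambda>j. ln (g (nth_prime j))) (kappa n)"
  using assms
proof (induction n rule: less_induct)
  case (less n)
  show ?case
  proof (cases "n = 1")
    case True
    have "kappa 1 = (\<lambda>_. 0)" by (simp add: kappa_def fun_eq_iff)
    thus ?thesis using True g_1 by (simp add: weight_def)
  next
    case False
    then obtain p where p: "prime p" "p dvd n" using prime_factor_nat[of n] by auto
    then obtain m where m: "n = p * m" by (auto simp: dvd_def)
    have m1: "m \<ge> 1" "p \<ge> 1" using less.prems m prime_gt_0_nat[OF p(1)] by (auto simp: Suc_le_eq intro!: Nat.gr0I)
    have mn: "m < n" using m m1 prime_gt_1_nat[OF p(1)] by simp
    obtain i where i: "nth_prime i = p" using ex_nth_prime p(1) by blast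
    have kp: "kappa p = (\<lambda>j. if j = i then 1 else 0)" using kappa_nth_prime_power[of i 1] i by auto
    have "weight (\<lambda>j. ln (g (nth_prime j))) (kappa n) =
      weight (\<lambda>j. ln (g (nth_prime j))) (kappa p) + weight (\<lambda>j. ln (g (nth_prime j))) (kappa m)"
      unfolding m kappa_mult[OF m1(2,1)] by (rule weight_add) (use m1 in \<open>auto intro: kappa_fin_supp\<close>)
    also have "weight (\<lambda>j. ln (g (nth_prime j))) (kappa p) = ln (g p)"
      by (subst weight_superset[of "{i}"]) (auto simp: kp i)
    finally show ?thesis
      using less.IH[OF mn m1(1)] g_pos[OF m1(1)] g_pos[OF m1(2)] g_mult[OF m1(2,1)] by (simp add: m ln_mult)
  qed
qed

lemma Hq_norm_proj_le:
  assumes q: "1 < q" and x: "x \<ge> 1" and F: "is_bohr_lift q a F"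
  shows "Hq_norm q (proj g x a) \<le> ennreal (1 / sin (pi / q) * Lq_norm q F)"
proof -
  define N where "N = {n. 1 \<le> n \<and> g n \<le> x}"
  define l where "l = (\<lambda>j. ln (g (nth_prime j)))"
  define G where "G z = (\<Sum>n\<in>N. proj g x a n * monomial (kappa n) z)" for z
  have G: "is_bohr_lift q (proj g x a) G"
    unfolding G_def using finite_le[of x] by (intro is_bohr_lift_polynomial q) (auto simp: N_def proj_def)
  have FL: "F \<in> Lq_torus q" and fc: "\<And>n. n \<ge> 1 \<Longrightarrow> fourier_coeff F (kappa n) = a n"
    and neg: "\<And>\<kappa>. \<kappa> \<in> fin_supp \<Longrightarrow> \<exists>j. \<kappa> j < 0 \<Longrightarrow> fourier_coeff F \<kappa> = 0"
    using F by (auto simp: is_bohr_lift_def Hq_torus_def fin_supp_def)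
  have inj: "inj_on kappa N" by (auto intro!: inj_onI kappa_inj simp: N_def)
  have GF: "G = (\<lambda>z. \<Sum>\<kappa>\<in>kappa ` N. fourier_coeff F \<kappa> * monomial \<kappa> z)"
    unfolding G_def sum.reindex[OF inj] by (intro ext sum.cong) (auto simp: N_def proj_def fc)
  have wt: "weight l (kappa n) \<le> ln x \<longleftrightarrow> n \<in> N" if "n \<ge> 1" for n
    unfolding l_def ln_g_eq_weight[OF that, symmetric] using g_pos[OF that] x that by (simp add: N_def)
  have le: "(LINT z|polytorus. norm (G z) powr q) \<le> (1 / sin (pi / q)) powr q * (LINT z|polytorus. norm (F z) powr q)"
    unfolding GF
  proof (rule riesz_projection_bound[OF q FL, of _ l "ln x"])
    show "finite (kappa ` N)" using finite_le by (simp add: N_def)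
    show "kappa ` N \<subseteq> fin_supp" by (auto simp: N_def intro: kappa_fin_supp)
    show "weight l \<kappa> \<le> ln x" if "\<kappa> \<in> kappa ` N" for \<kappa> using that wt by (auto simp: N_def)
    fix \<kappa> assume \<kappa>: "\<kappa> \<in> fin_supp" "weight l \<kappa> \<le> ln x" "\<kappa> \<notin> kappa ` N"
    show "fourier_coeff F \<kappa> = 0"
    \<comment> \<open>The half-space also contains frequencies with negative entries; there the
      coefficients vanish because the lift lies in \<open>Hq_torus q\<close>. The other frequencies
      belong to integers, and for these the half-space is \<open>N\<close>.\<close>
    proof (cases "\<exists>j. \<kappa> j < 0")
      case False
      then obtain n where "n \<ge> 1" "kappa n = \<kappa>" using ex_kappa[OF \<kappa>(1)] by (auto simp: not_less)
      thus ?thesis using wt[of n] \<kappa> by auto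
    qed (use neg \<kappa> in auto)
  qed
  have s: "sin (pi / q) > 0" by (rule sin_pi_div_pos[OF q])
  have "Lq_norm q G \<le> ((1 / sin (pi / q)) powr q * (LINT z|polytorus. norm (F z) powr q)) powr (1 / q)"
    unfolding Lq_norm_def using q le by (intro powr_mono2) auto
  also have "\<dots> = 1 / sin (pi / q) * Lq_norm q F"
    using q s by (simp add: powr_mult powr_powr Lq_norm_def)
  finally show ?thesis unfolding Hq_norm_eq[OF q G] by (rule ennreal_leI)
qed

lemma Hq_opnorm_proj_le:
  assumes q: "1 < q" and x: "x \<ge> 1"
  shows "Hq_opnorm q (proj g x) \<le> ennreal (1 / sin (pi / q))"
  unfolding Hq_opnorm_def
proof (rule SUP_least)
  fix a assume "a \<in> {a \<in> Hq_dirichlet q. Hq_norm q a \<le> 1}"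
  then obtain F where F: "is_bohr_lift q a F" and le: "Hq_norm q a \<le> 1" by (auto simp: Hq_dirichlet_def)
  have "Lq_norm q F \<le> 1" using le unfolding Hq_norm_eq[OF q F] by simp
  hence "1 / sin (pi / q) * Lq_norm q F \<le> 1 / sin (pi / q) * 1"
    using sin_pi_div_pos[OF q] by (intro mult_left_mono) auto
  from order_trans[OF Hq_norm_proj_le[OF q x F] ennreal_leI[OF this]]
  show "Hq_norm q (proj g x a) \<le> ennreal (1 / sin (pi / q))" by simp
qed

end

section \<open>The lower bound\<close>

lemma integral_coordinate_polytorus:
  fixes f :: "complex \<Rightarrow> real"
  assumes "continuous_on (sphere 0 1) f"
  shows "(LINT z|polytorus. f (z i)) = integral\<^sup>L circle_measure f"
proof -
  have f: "f \<in> borel_measurable circle_measure"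
    using borel_measurable_continuous_on_restrict[OF assms]
    by (simp cong: measurable_cong_sets add: sets_circle_measure)
  have "integral\<^sup>L circle_measure f = integral\<^sup>L (distr polytorus circle_measure (\<lambda>z. z i)) f"
    unfolding polytorus_def by (subst circle.PiM_component) auto
  also have "\<dots> = (LINT z|polytorus. f (z i))"
    unfolding polytorus_def by (rule integral_distr) (use f in auto)
  finally show ?thesis by simp
qed

lemma continuous_on_norm_powr:
  fixes f :: "'a::topological_space \<Rightarrow> 'b::real_normed_vector"
  assumes "continuous_on A f" "0 < q"
  shows "continuous_on A (\<lambda>x. norm (f x) powr q)"
  using assms by (intro continuous_on_powr' continuous_intros) auto

context completely_multiplicative
begin

lemma proj_circle_bound_normalized:
  assumes q: "1 < q" and B: "B \<ge> 0" and bound: "\<And>x. x \<ge> 1 \<Longrightarrow> Hq_opnorm q (proj g x) \<le> ennreal B"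
    and le1: "(LINT \<zeta>|circle_measure. norm (\<Sum>k\<le>2*N. b k * \<zeta> ^ k) powr q) \<le> 1"
  shows "(LINT \<zeta>|circle_measure. norm (\<Sum>k\<le>N. b k * \<zeta> ^ k) powr q) \<le> B powr q"
proof -
  obtain i where i: "nth_prime i = 2" using ex_nth_prime[of 2] by auto
  define X where "X = (\<lambda>k. 2 ^ k :: nat) ` {..2*N}"
  define a where "a n = (if n \<in> X then b (multiplicity 2 n) else 0)" for n :: nat
  have inj: "inj_on (\<lambda>k. 2 ^ k :: nat) A" for A by (auto intro!: inj_onI)
  have mult2: "multiplicity 2 (2 ^ k :: nat) = k" for k by (simp add: multiplicity_same_power')
  have mono: "monomial (kappa (2 ^ k)) z = z i ^ k" for k z
    using kappa_nth_prime_power[of i k] unfolding i by (subst monomial_eq_prod[of "{i}"]) auto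
  define F where "F z = (\<Sum>n\<in>X. a n * monomial (kappa n) z)" for z
  have F: "F z = (\<Sum>k\<le>2*N. b k * z i ^ k)" for z
    unfolding F_def X_def sum.reindex[OF inj] by (intro sum.cong) (auto simp: a_def X_def mult2 mono)
  have lift: "is_bohr_lift q a F"
    unfolding F_def by (intro is_bohr_lift_polynomial q) (auto simp: X_def a_def)
  \<comment> \<open>Since \<open>g 2 > 1\<close>, the condition \<open>g (2 ^ k) \<le> x\<close>
    means \<open>k \<le> N\<close>, so this projection is the \<open>N\<close>-th partial
    sum.\<close>
  define x where "x = g 2 ^ N"
  have g2: "g 2 > 1" by (rule g_gt_1) simp
  have x: "x \<ge> 1" unfolding x_def using g2 by simp
  define G where "G z = (\<Sum>n\<in>X. proj g x a n * monomial (kappa n) z)" for z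
  have G: "G z = (\<Sum>k\<le>N. b k * z i ^ k)" for z
  proof -
    have "G z = (\<Sum>k\<le>2*N. if k \<le> N then b k * z i ^ k else 0)"
      unfolding G_def X_def sum.reindex[OF inj] using g2
      by (intro sum.cong) (auto simp: a_def X_def mult2 mono proj_def g_power x_def)
    also have "\<dots> = (\<Sum>k\<in>{k\<in>{..2*N}. k \<le> N}. b k * z i ^ k)"
      by (rule sum.inter_filter[symmetric]) simp
    also have "{k\<in>{..2*N}. k \<le> N} = {..N}" by auto
    finally show ?thesis .
  qed
  have liftG: "is_bohr_lift q (proj g x a) G"
    unfolding G_def by (intro is_bohr_lift_polynomial q) (auto simp: X_def a_def proj_def)
  have cont: "continuous_on (sphere 0 1) (\<lambda>\<zeta>. norm (\<Sum>k\<le>M. b k * \<zeta> ^ k) powr q)" for M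
    using q by (intro continuous_on_norm_powr continuous_intros) auto
  have "Lq_norm q F \<le> 1 powr (1 / q)"
    unfolding Lq_norm_def F using q le1
    by (subst integral_coordinate_polytorus[OF cont]) (intro powr_mono2, auto)
  hence "Hq_norm q a \<le> 1" unfolding Hq_norm_eq[OF q lift] by simp
  moreover have "a \<in> Hq_dirichlet q" using lift by (auto simp: Hq_dirichlet_def)
  ultimately have "Hq_norm q (proj g x a) \<le> Hq_opnorm q (proj g x)"
    unfolding Hq_opnorm_def by (intro SUP_upper) auto
  also have "\<dots> \<le> ennreal B" by (rule bound[OF x])
  finally have "Lq_norm q G \<le> B" unfolding Hq_norm_eq[OF q liftG] using B by simp
  hence "Lq_norm q G powr q \<le> B powr q" using q by (intro powr_mono2) (auto simp: Lq_norm_def)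
  moreover have "Lq_norm q G powr q = (LINT \<zeta>|circle_measure. norm (\<Sum>k\<le>N. b k * \<zeta> ^ k) powr q)"
    unfolding Lq_norm_def G using q by (subst integral_coordinate_polytorus[OF cont]) (simp add: powr_powr)
  ultimately show ?thesis by simp
qed

lemma proj_circle_bound:
  assumes q: "1 < q" and B: "B \<ge> 0" and bound: "\<And>x. x \<ge> 1 \<Longrightarrow> Hq_opnorm q (proj g x) \<le> ennreal B"
  shows "(LINT \<zeta>|circle_measure. norm (\<Sum>k\<le>N. b k * \<zeta> ^ k) powr q) \<le>
    B powr q * (LINT \<zeta>|circle_measure. norm (\<Sum>k\<le>2*N. b k * \<zeta> ^ k) powr q)"
proof -
  define I where "I = (LINT \<zeta>|circle_measure. norm (\<Sum>k\<le>N. b k * \<zeta> ^ k) powr q)"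
  define J where "J = (LINT \<zeta>|circle_measure. norm (\<Sum>k\<le>2*N. b k * \<zeta> ^ k) powr q)"
  have J0: "J \<ge> 0" by (simp add: J_def)
  have scale: "(LINT \<zeta>|circle_measure. norm (\<Sum>k\<le>M. (complex_of_real t * b k) * \<zeta> ^ k) powr q) =
      t powr q * (LINT \<zeta>|circle_measure. norm (\<Sum>k\<le>M. b k * \<zeta> ^ k) powr q)" if "t > 0" for t M
  proof -
    have "norm (\<Sum>k\<le>M. (complex_of_real t * b k) * \<zeta> ^ k) powr q = t powr q * norm (\<Sum>k\<le>M. b k * \<zeta> ^ k) powr q" for \<zeta>
      using that by (simp add: mult.assoc sum_distrib_left[symmetric] norm_mult powr_mult)
    thus ?thesis by simp
  qed
  have "I \<le> B powr q * J + e" if e: "e > 0" for e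
  proof -
    \<comment> \<open>Normalising by \<open>J + \<delta>\<close> instead of \<open>J\<close> covers
      the case \<open>J = 0\<close>, and this size of \<open>\<delta>\<close> keeps
      \<open>B powr q * \<delta>\<close> below \<open>e\<close>.\<close>
    define \<delta> where "\<delta> = e / (B powr q + 1)"
    have \<delta>: "\<delta> > 0" using e by (simp add: \<delta>_def add_nonneg_pos)
    define t where "t = (J + \<delta>) powr (- 1 / q)"
    have t: "t > 0" "t powr q = 1 / (J + \<delta>)"
    proof -
      have "t powr q = (J + \<delta>) powr (- 1)" using q by (simp add: t_def powr_powr)
      thus "t powr q = 1 / (J + \<delta>)" using J0 \<delta> by (simp add: powr_minus_divide)
    qed (use J0 \<delta> in \<open>simp add: t_def\<close>)
    have "t powr q * I \<le> B powr q"
      unfolding I_def scale[OF t(1), symmetric]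
    proof (rule proj_circle_bound_normalized[OF q B bound])
      show "(LINT \<zeta>|circle_measure. norm (\<Sum>k\<le>2*N. (complex_of_real t * b k) * \<zeta> ^ k) powr q) \<le> 1"
        unfolding scale[OF t(1)] t(2) J_def[symmetric] using J0 \<delta> by simp
    qed
    hence "I \<le> B powr q * (J + \<delta>)" using J0 \<delta> by (simp add: t(2) field_simps)
    also have "\<dots> \<le> B powr q * J + e"
    proof -
      have "B powr q * \<delta> = e * (B powr q / (B powr q + 1))" by (simp add: \<delta>_def)
      also have "\<dots> \<le> e * 1" using e by (intro mult_left_mono) (auto simp: divide_le_eq_1 add_nonneg_pos)
      finally have "B powr q * \<delta> \<le> e" by simp
      thus ?thesis by (simp add: distrib_left)
    qed
    finally show ?thesis .
  qed
  hence "I \<le> B powr q * J" by (rule field_le_epsilon)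
  thus ?thesis by (simp add: I_def J_def)
qed

end

section \<open>From polynomials to functions holomorphic beyond the closed disc\<close>

lemma holomorphic_uniform_limit_taylor:
  assumes f: "f holomorphic_on ball 0 R" and R: "1 < R"
  obtains \<tau> where "\<tau> 0 = f 0" "uniform_limit (sphere 0 1) (\<lambda>N \<zeta>. \<Sum>k\<le>N. \<tau> k * \<zeta> ^ k) f sequentially"
proof
  define \<tau> where "\<tau> n = (deriv ^^ n) f 0 / fact n" for n
  show "\<tau> 0 = f 0" by (simp add: \<tau>_def)
  have sums: "(\<lambda>n. \<tau> n * z ^ n) sums f z" if "z \<in> ball 0 R" for z
    using holomorphic_power_series[OF f that] by (simp add: \<tau>_def)
  define \<rho> where "\<rho> = (1 + R) / 2"
  have \<rho>: "1 < \<rho>" "\<rho> < R" using R by (auto simp: \<rho>_def)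
  hence "complex_of_real \<rho> \<in> ball 0 R" by simp
  from sums_summable[OF sums[OF this]] have "conv_radius \<tau> \<ge> norm (complex_of_real \<rho>)"
    by (rule conv_radius_geI)
  moreover have "ereal 1 < norm (complex_of_real \<rho>)" using \<rho> by simp
  ultimately have cr: "ereal 1 < conv_radius \<tau>" by (rule less_le_trans[rotated])
  have "uniform_limit (cball 0 1) (\<lambda>n z. \<Sum>i<n. \<tau> i * (z - 0) ^ i) (\<lambda>z. \<Sum>i. \<tau> i * (z - 0) ^ i) sequentially"
    by (rule powser_uniform_limit[OF cr])
  hence "uniform_limit (sphere 0 1) (\<lambda>n z. \<Sum>i<n. \<tau> i * z ^ i) (\<lambda>z. \<Sum>i. \<tau> i * z ^ i) sequentially"
    using uniform_limit_on_subset[OF _ sphere_cball] by auto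
  also have "?this \<longleftrightarrow> uniform_limit (sphere 0 1) (\<lambda>n z. \<Sum>i<n. \<tau> i * z ^ i) f sequentially"
    using R by (intro uniform_limit_cong' sums_unique[OF sums, symmetric]) auto
  finally have "uniform_limit (sphere 0 1) (\<lambda>n z. \<Sum>i<n. \<tau> i * z ^ i) f sequentially" .
  from filterlim_compose[OF this filterlim_Suc]
  show "uniform_limit (sphere 0 1) (\<lambda>N \<zeta>. \<Sum>k\<le>N. \<tau> k * \<zeta> ^ k) f sequentially"
    by (simp add: lessThan_Suc_atMost)
qed

lemma integral_circle_uniform_limit:
  fixes u :: "nat \<Rightarrow> complex \<Rightarrow> complex" and \<phi> :: "complex \<Rightarrow> real"
  assumes lim: "uniform_limit (sphere 0 1) u f sequentially"
    and u: "\<And>n. continuous_on (sphere 0 1) (u n)" and \<phi>: "continuous_on UNIV \<phi>"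
  shows "(\<lambda>n. LINT \<zeta>|circle_measure. \<phi> (u n \<zeta>)) \<longlonglongrightarrow> (LINT \<zeta>|circle_measure. \<phi> (f \<zeta>))"
proof -
  interpret c: prob_space circle_measure by (rule prob_space_circle_measure)
  have f: "continuous_on (sphere 0 1) f"
    by (rule uniform_limit_theorem[OF _ lim]) (use u in auto)
  have meas: "(\<lambda>\<zeta>. \<phi> (v \<zeta>)) \<in> borel_measurable circle_measure" if "continuous_on (sphere 0 1) v" for v
  proof -
    have "continuous_on (sphere 0 1) (\<lambda>\<zeta>. \<phi> (v \<zeta>))"
      by (rule continuous_on_compose2[OF \<phi> that]) simp
    from borel_measurable_integrable[OF integral_circle_measure(2)[OF this]] show ?thesis .
  qed
  obtain K where K: "\<And>\<zeta>. \<zeta> \<in> sphere 0 1 \<Longrightarrow> norm (f \<zeta>) \<le> K"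
    using compact_imp_bounded[OF compact_continuous_image[OF f compact_sphere]]
    by (metis bounded_iff image_eqI)
  obtain B where B: "\<And>v. v \<in> cball 0 (K + 1) \<Longrightarrow> norm (\<phi> v) \<le> B"
    using compact_imp_bounded[OF compact_continuous_image[OF continuous_on_subset[OF \<phi> subset_UNIV] compact_cball]]
    by (metis bounded_iff image_eqI)
  obtain M where M: "\<And>n \<zeta>. n \<ge> M \<Longrightarrow> \<zeta> \<in> sphere 0 1 \<Longrightarrow> dist (u n \<zeta>) (f \<zeta>) < 1"
    using uniform_limitD[OF lim, of 1] unfolding eventually_sequentially by (metis zero_less_one)
  show ?thesis
  \<comment> \<open>The constant \<open>B\<close> dominates only from index \<open>M\<close> on,
    where \<open>u n\<close> is within distance 1 of \<open>f\<close>.\<close>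
  proof (rule LIMSEQ_offset[of _ M], rule integral_dominated_convergence[where w = "\<lambda>_. B"])
    show "AE \<zeta> in circle_measure. (\<lambda>n. \<phi> (u (n + M) \<zeta>)) \<longlonglongrightarrow> \<phi> (f \<zeta>)"
    proof (rule AE_I2)
      fix \<zeta> assume "\<zeta> \<in> space circle_measure"
      hence "(\<lambda>n. u n \<zeta>) \<longlonglongrightarrow> f \<zeta>" using tendsto_uniform_limitI[OF lim] by (simp add: space_circle_measure)
      hence "(\<lambda>n. u (n + M) \<zeta>) \<longlonglongrightarrow> f \<zeta>" by (rule LIMSEQ_ignore_initial_segment)
      thus "(\<lambda>n. \<phi> (u (n + M) \<zeta>)) \<longlonglongrightarrow> \<phi> (f \<zeta>)"
        using \<phi> by (intro isCont_tendsto_compose[of _ \<phi>]) (auto simp: continuous_on_eq_continuous_at)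
    qed
    show "AE \<zeta> in circle_measure. norm (\<phi> (u (n + M) \<zeta>)) \<le> B" for n
    proof (rule AE_I2, rule B)
      fix \<zeta> assume "\<zeta> \<in> space circle_measure"
      hence z: "\<zeta> \<in> sphere 0 1" by (simp add: space_circle_measure)
      have "norm (u (n + M) \<zeta>) \<le> norm (f \<zeta>) + dist (u (n + M) \<zeta>) (f \<zeta>)"
        by (metis dist_norm norm_triangle_sub)
      thus "u (n + M) \<zeta> \<in> cball 0 (K + 1)" using K[OF z] M[OF _ z, of "n + M"] by simp
    qed
  qed (use meas u f in auto)
qed

text \<open>The mean value property, obtained from the Taylor polynomials. It keeps the mean of
  \<open>Re (cayley r \<zeta>)\<close> at 1 for all \<open>r\<close>.\<close>

lemma integral_circle_Re_holomorphic:
  assumes f: "f holomorphic_on ball 0 R" and R: "1 < R"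
  shows "(LINT \<zeta>|circle_measure. Re (f \<zeta>)) = Re (f 0)"
proof -
  obtain \<tau> where \<tau>: "\<tau> 0 = f 0" "uniform_limit (sphere 0 1) (\<lambda>N \<zeta>. \<Sum>k\<le>N. \<tau> k * \<zeta> ^ k) f sequentially"
    using holomorphic_uniform_limit_taylor[OF f R] by blast
  have "(\<lambda>N. LINT \<zeta>|circle_measure. Re (\<Sum>k\<le>N. \<tau> k * \<zeta> ^ k)) \<longlonglongrightarrow> (LINT \<zeta>|circle_measure. Re (f \<zeta>))"
    by (rule integral_circle_uniform_limit[OF \<tau>(2)]) (intro continuous_intros)+
  moreover have "(LINT \<zeta>|circle_measure. Re (\<Sum>k\<le>N. \<tau> k * \<zeta> ^ k)) = Re (f 0)" for N
  proof -
    have int: "integrable circle_measure (\<lambda>\<zeta>. \<tau> k * \<zeta> ^ k)" for k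
      by (intro integral_circle_measure(2) continuous_intros)
    have "(LINT \<zeta>|circle_measure. Re (\<Sum>k\<le>N. \<tau> k * \<zeta> ^ k)) = Re (LINT \<zeta>|circle_measure. (\<Sum>k\<le>N. \<tau> k * \<zeta> ^ k))"
      using int by (intro integral_Re Bochner_Integration.integrable_sum) auto
    also have "(LINT \<zeta>|circle_measure. (\<Sum>k\<le>N. \<tau> k * \<zeta> ^ k)) = (\<Sum>k\<le>N. LINT \<zeta>|circle_measure. \<tau> k * \<zeta> ^ k)"
      by (rule Bochner_Integration.integral_sum) (rule int)
    also have "\<dots> = (\<Sum>k\<le>N. if k = 0 then \<tau> 0 else 0)"
      using integral_circle_powi[of "int _"] by (intro sum.cong refl) (auto simp: power_int_of_nat)
    finally show ?thesis by (simp add: \<tau>(1))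
  qed
  ultimately show ?thesis by (simp add: LIMSEQ_const_iff)
qed

context completely_multiplicative
begin

text \<open>Multiplying by \<open>\<zeta> ^ N\<close> turns \<open>cnj (f \<zeta>) - c * f \<zeta>\<close>, with \<open>f\<close> a polynomial of degree \<open>N\<close>,
  into an analytic polynomial whose \<open>N\<close>-th partial sum is \<open>\<zeta> ^ N\<close> times the projection
  to the non-positive frequencies.\<close>

lemma holomorphic_circle_bound:
  fixes c :: real
  assumes q: "1 < q" and B: "B \<ge> 0" and bound: "\<And>x. x \<ge> 1 \<Longrightarrow> Hq_opnorm q (proj g x) \<le> ennreal B"
    and f: "f holomorphic_on ball 0 R" and R: "1 < R" and f0: "f 0 = 1"
  shows "(LINT \<zeta>|circle_measure. norm (cnj (f \<zeta>) - of_real c) powr q) \<le>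
    B powr q * (LINT \<zeta>|circle_measure. norm (cnj (f \<zeta>) - of_real c * f \<zeta>) powr q)"
proof -
  obtain \<tau> where \<tau>: "\<tau> 0 = f 0" "uniform_limit (sphere 0 1) (\<lambda>N \<zeta>. \<Sum>k\<le>N. \<tau> k * \<zeta> ^ k) f sequentially"
    using holomorphic_uniform_limit_taylor[OF f R] by blast
  define P where "P N \<zeta> = (\<Sum>k\<le>N. \<tau> k * \<zeta> ^ k)" for N \<zeta>
  have le: "(LINT \<zeta>|circle_measure. norm (cnj (P N \<zeta>) - of_real c) powr q) \<le>
    B powr q * (LINT \<zeta>|circle_measure. norm (cnj (P N \<zeta>) - of_real c * P N \<zeta>) powr q)" for N
  proof -
    \<comment> \<open>The two ranges overlap at \<open>j = N\<close>. Stopping the sum there retains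
      the constant term of \<open>c * f\<close>, which is \<open>c\<close> because
      \<open>f 0 = 1\<close>; hence the \<open>c\<close> on the left side of the claim.\<close>
    define b where "b j = (if j \<le> N then cnj (\<tau> (N - j)) else 0) - (if N \<le> j then of_real c * \<tau> (j - N) else 0)" for j
    have low: "(\<Sum>j\<le>N. cnj (\<tau> (N - j)) * \<zeta> ^ j) = \<zeta> ^ N * cnj (P N \<zeta>)" if "norm \<zeta> = 1" for \<zeta>
    proof -
      have "\<zeta> ^ N * cnj (P N \<zeta>) = (\<Sum>k\<le>N. cnj (\<tau> k) * \<zeta> ^ (N - k))"
        unfolding P_def cnj_sum sum_distrib_left
      proof (rule sum.cong[OF refl])
        fix k assume "k \<in> {..N}"
        hence "\<zeta> ^ N = \<zeta> ^ (N - k) * \<zeta> ^ k" by (simp flip: power_add)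
        moreover have "\<zeta> ^ k * cnj (\<zeta> ^ k) = 1"
          using that by (simp add: complex_norm_square[symmetric] norm_power del: complex_cnj_power)
        ultimately show "\<zeta> ^ N * cnj (\<tau> k * \<zeta> ^ k) = cnj (\<tau> k) * \<zeta> ^ (N - k)"
          by (simp add: mult.assoc mult.left_commute del: complex_cnj_power)
      qed
      also have "\<dots> = (\<Sum>j\<le>N. cnj (\<tau> (N - j)) * \<zeta> ^ j)"
        by (rule sum.reindex_bij_witness[of _ "\<lambda>j. N - j" "\<lambda>j. N - j"]) auto
      finally show ?thesis by simp
    qed
    have "(\<Sum>j\<le>N. b j * \<zeta> ^ j) = (\<Sum>j\<le>N. cnj (\<tau> (N - j)) * \<zeta> ^ j) - (\<Sum>j\<le>N. if j = N then of_real c * \<tau> 0 * \<zeta> ^ N else 0)" for \<zeta>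
      unfolding sum_subtractf[symmetric] by (intro sum.cong refl) (auto simp: b_def left_diff_distrib)
    hence 1: "(\<Sum>j\<le>N. b j * \<zeta> ^ j) = \<zeta> ^ N * (cnj (P N \<zeta>) - of_real c)" if "norm \<zeta> = 1" for \<zeta>
      using low[OF that] \<tau>(1) f0 by (simp add: algebra_simps)
    have 2: "(\<Sum>j\<le>2*N. b j * \<zeta> ^ j) = \<zeta> ^ N * (cnj (P N \<zeta>) - of_real c * P N \<zeta>)" if "norm \<zeta> = 1" for \<zeta>
    proof -
      have "(\<Sum>j\<le>2*N. b j * \<zeta> ^ j) = (\<Sum>j\<le>2*N. if j \<le> N then cnj (\<tau> (N - j)) * \<zeta> ^ j else 0)
         - (\<Sum>j\<le>2*N. if N \<le> j then of_real c * \<tau> (j - N) * \<zeta> ^ j else 0)"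
        unfolding sum_subtractf[symmetric] by (intro sum.cong refl) (simp add: b_def left_diff_distrib)
      also have "(\<Sum>j\<le>2*N. if j \<le> N then cnj (\<tau> (N - j)) * \<zeta> ^ j else 0) = (\<Sum>j\<in>{j\<in>{..2*N}. j \<le> N}. cnj (\<tau> (N - j)) * \<zeta> ^ j)"
        by (rule sum.inter_filter[symmetric]) simp
      also have "{j\<in>{..2*N}. j \<le> N} = {..N}" by auto
      also have "(\<Sum>j\<le>2*N. if N \<le> j then of_real c * \<tau> (j - N) * \<zeta> ^ j else 0) = (\<Sum>j\<in>{j\<in>{..2*N}. N \<le> j}. of_real c * \<tau> (j - N) * \<zeta> ^ j)"
        by (rule sum.inter_filter[symmetric]) simp
      also have "\<dots> = (\<Sum>k\<le>N. of_real c * \<tau> k * \<zeta> ^ (N + k))"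
        by (rule sum.reindex_bij_witness[of _ "\<lambda>k. N + k" "\<lambda>j. j - N"]) auto
      also have "\<dots> = \<zeta> ^ N * (of_real c * P N \<zeta>)"
        by (simp add: P_def sum_distrib_left power_add mult_ac)
      finally show ?thesis using low[OF that] by (simp add: right_diff_distrib)
    qed
    have "norm (\<Sum>j\<le>N. b j * \<zeta> ^ j) = norm (cnj (P N \<zeta>) - of_real c)"
      "norm (\<Sum>j\<le>2*N. b j * \<zeta> ^ j) = norm (cnj (P N \<zeta>) - of_real c * P N \<zeta>)" if "\<zeta> \<in> space circle_measure" for \<zeta>
      using that 1[of \<zeta>] 2[of \<zeta>] by (auto simp: space_circle_measure norm_mult norm_power)
    thus ?thesis
      using proj_circle_bound[OF q B bound, where b = b and N = N] by (simp cong: Bochner_Integration.integral_cong)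
  qed
  have contP: "continuous_on (sphere 0 1) (P N)" for N
    unfolding P_def by (intro continuous_intros)
  have lim: "uniform_limit (sphere 0 1) P f sequentially"
    unfolding P_def[abs_def] by (rule \<tau>(2))
  have lims: "(\<lambda>N. LINT \<zeta>|circle_measure. norm (cnj (P N \<zeta>) - of_real c) powr q) \<longlonglongrightarrow>
      (LINT \<zeta>|circle_measure. norm (cnj (f \<zeta>) - of_real c) powr q)"
    "(\<lambda>N. LINT \<zeta>|circle_measure. norm (cnj (P N \<zeta>) - of_real c * P N \<zeta>) powr q) \<longlonglongrightarrow>
      (LINT \<zeta>|circle_measure. norm (cnj (f \<zeta>) - of_real c * f \<zeta>) powr q)"
    using q by (intro integral_circle_uniform_limit[OF lim contP, where \<phi> = "\<lambda>u. norm (cnj u - of_real c) powr q"]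
      integral_circle_uniform_limit[OF lim contP, where \<phi> = "\<lambda>u. norm (cnj u - of_real c * u) powr q"]
      continuous_on_norm_powr continuous_intros; simp)+
  show ?thesis
    by (rule LIMSEQ_le[OF lims(1) tendsto_mult[OF tendsto_const lims(2)]]) (use le in auto)
qed

end

text \<open>With \<open>t powr q = 1 - \<eta>\<close>, the triangle inequality gives
  \<open>t * norm u \<le> norm (u - v)\<close> as soon as \<open>norm u\<close> exceeds
  \<open>1 / (1 - t)\<close>. For smaller \<open>u\<close> the constant makes the left side
  non-positive.\<close>

lemma powr_shift_lower_bound:
  fixes q \<eta> :: real
  assumes q: "0 < q" and \<eta>: "0 < \<eta>" "\<eta> < 1"
  obtains K where "K \<ge> 0" "\<And>u v :: complex. norm v \<le> 1 \<Longrightarrow> (1 - \<eta>) * norm u powr q - K \<le> norm (u - v) powr q"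
proof
  define t where "t = (1 - \<eta>) powr (1 / q)"
  have t: "0 < t" "t < 1"
    using q \<eta> powr_less_mono2[of "1 / q" "1 - \<eta>" 1] by (auto simp: t_def)
  have tq: "t powr q = 1 - \<eta>" using q \<eta> by (simp add: t_def powr_powr)
  define X where "X = 1 / (1 - t)"
  show "X powr q \<ge> 0" by simp
  fix u v :: complex assume v: "norm v \<le> 1"
  show "(1 - \<eta>) * norm u powr q - X powr q \<le> norm (u - v) powr q"
  proof (cases "norm u \<le> X")
    case True
    have "(1 - \<eta>) * norm u powr q \<le> 1 * norm u powr q" using \<eta> by (intro mult_right_mono) auto
    also have "\<dots> \<le> X powr q" using True q by (auto intro: powr_mono2)
    finally show ?thesis using powr_ge_zero[of "norm (u - v)" q] by linarith
  next
    case False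
    hence "1 \<le> (1 - t) * norm u" using t by (simp add: X_def field_simps)
    hence "t * norm u \<le> norm u - norm v" using v by (simp add: left_diff_distrib)
    also have "\<dots> \<le> norm (u - v)" by (rule norm_triangle_ineq2)
    finally have "(t * norm u) powr q \<le> norm (u - v) powr q" using q t by (intro powr_mono2) auto
    hence "(1 - \<eta>) * norm u powr q \<le> norm (u - v) powr q" using t tq by (simp add: powr_mult)
    thus ?thesis using powr_ge_zero[of X q] by linarith
  qed
qed

text \<open>Close to the ends of the interval continuity suffices; elsewhere \<open>cos t\<close> is
  bounded away from 0 and a large multiple of it absorbs \<open>M\<close>. The cosine is the right
  correction because \<open>norm w * cos t\<close> is the real part of a number \<open>w\<close> of
  argument \<open>t\<close>, and this part will have a bounded mean.\<close>

lemma continuous_le_add_cos: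
  fixes m :: "real \<Rightarrow> real"
  assumes cont: "isCont m (pi / 2)" and even: "\<And>t. m (- t) = m t" and bd: "\<And>t. m t \<le> M" and \<eta>: "0 < \<eta>"
  obtains K where "K \<ge> 0" "\<And>t. \<bar>t\<bar> \<le> pi / 2 \<Longrightarrow> m t \<le> m (pi / 2) + \<eta> + K * cos t"
proof -
  have "\<forall>\<^sub>F t in at (pi / 2). m t < m (pi / 2) + \<eta>"
    using cont \<eta> by (intro order_tendstoD(2)[of _ "m (pi / 2)"]) (auto simp: isCont_def)
  then obtain d where d: "d > 0" "\<And>t. t \<noteq> pi / 2 \<Longrightarrow> dist t (pi / 2) < d \<Longrightarrow> m t < m (pi / 2) + \<eta>"
    unfolding eventually_at by auto
  define e where "e = min d (pi / 2) / 2"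
  have e: "0 < e" "e < pi / 2" "e < d" using d by (auto simp: e_def min_def)
  have se: "sin e > 0" using e by (intro sin_gt_zero) auto
  define K where "K = (\<bar>M\<bar> + \<bar>m (pi / 2)\<bar>) / sin e"
  show thesis
  proof
    show "K \<ge> 0" using se by (simp add: K_def)
    fix t :: real assume t: "\<bar>t\<bar> \<le> pi / 2"
    have mt: "m t = m \<bar>t\<bar>" using even[of t] by (auto simp: abs_if)
    have ct: "cos t = cos \<bar>t\<bar>" by (simp add: abs_if)
    show "m t \<le> m (pi / 2) + \<eta> + K * cos t"
    proof (cases "\<bar>t\<bar> > pi / 2 - e")
      case True
      have "m \<bar>t\<bar> \<le> m (pi / 2) + \<eta>"
      proof (cases "\<bar>t\<bar> = pi / 2")
        case True
        show ?thesis using \<eta> by (simp only: True)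
      next
        case False
        thus ?thesis using d(2)[of "\<bar>t\<bar>"] \<open>\<bar>t\<bar> > pi / 2 - e\<close> t e by (auto simp: dist_real_def)
      qed
      moreover have "0 \<le> K * cos t" using \<open>K \<ge> 0\<close> t unfolding ct by (intro mult_nonneg_nonneg cos_ge_zero) auto
      ultimately show ?thesis using mt by simp
    next
      case False
      have "sin e = cos (pi / 2 - e)" by (simp add: cos_diff)
      also have "\<dots> \<le> cos \<bar>t\<bar>" using False e by (intro cos_monotone_0_pi_le) auto
      finally have "K * sin e \<le> K * cos t" using \<open>K \<ge> 0\<close> unfolding ct by (intro mult_left_mono)
      moreover have "K * sin e = \<bar>M\<bar> + \<bar>m (pi / 2)\<bar>" using se by (simp add: K_def)
      ultimately show ?thesis using bd[of t] \<eta> by linarith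
    qed
  qed
qed

text \<open>The map of the disc to the right half-plane, dilated by \<open>r\<close>; its real part
  on the circle is the Poisson kernel. As \<open>r\<close> tends to 1 the mean of the real part
  stays 1 while that of the modulus diverges.\<close>

definition cayley :: "real \<Rightarrow> complex \<Rightarrow> complex" where
  "cayley r \<zeta> = (1 + of_real r * \<zeta>) / (1 - of_real r * \<zeta>)"

lemma cayley_denominator:
  fixes \<zeta> :: complex
  assumes "0 < r" "\<zeta> \<in> ball 0 (1 / r)"
  shows "1 - of_real r * \<zeta> \<noteq> 0"
proof
  assume "1 - of_real r * \<zeta> = 0"
  hence "norm (of_real r * \<zeta>) = 1" by simp
  thus False using assms by (simp add: norm_mult field_simps)
qed

lemma Re_cayley_pos:
  assumes r: "0 < r" "\<zeta> \<in> ball 0 (1 / r)"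
  shows "0 < Re (cayley r \<zeta>)"
proof -
  define v where "v = of_real r * \<zeta>"
  have "norm v < 1" using r by (simp add: v_def norm_mult field_simps)
  hence "(norm v)^2 < 1" by (simp add: power_less_one_iff)
  hence "0 < 1 - (Re v)^2 - (Im v)^2" by (simp add: cmod_power2)
  moreover have "Re ((1 + v) * cnj (1 - v)) = 1 - (Re v)^2 - (Im v)^2"
    by (simp add: power2_eq_square algebra_simps)
  moreover have "1 - v \<noteq> 0" using cayley_denominator[OF r] by (simp add: v_def)
  ultimately show ?thesis
    by (simp add: cayley_def v_def[symmetric] complex_div_cnj[of "1 + v"] Re_divide_of_real del: times_complex.simps complex_cnj_diff)
qed

lemma cayley_holomorphic:
  assumes "0 < r"
  shows "cayley r holomorphic_on ball 0 (1 / r)"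
  unfolding cayley_def using cayley_denominator[OF assms] by (intro holomorphic_intros) auto

text \<open>For angles between 0 and 1 the numerator has modulus at least 1, as the cosine is
  non-negative, and the denominator at most \<open>(1 - r) + t\<close>. Integration gives the
  logarithm.\<close>

lemma integral_norm_cayley_lower_bound:
  assumes r: "0 < r" "r < 1"
  shows "ln (1 / (1 - r)) / (2 * pi) \<le> (LINT \<zeta>|circle_measure. norm (cayley r \<zeta>))"
proof -
  have sub: "sphere 0 1 \<subseteq> ball (0::complex) (1 / r)" using r by (auto simp: field_simps)
  have cont: "continuous_on (sphere 0 1) (\<lambda>\<zeta>. norm (cayley r \<zeta>))"
    by (intro continuous_intros continuous_on_subset[OF holomorphic_on_imp_continuous_on[OF cayley_holomorphic[OF r(1)]] sub])
  have cont': "continuous_on A (\<lambda>t. norm (cayley r (cis t)))" for A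
    by (rule continuous_on_compose2[OF cont]) (auto intro!: continuous_intros)
  have "((\<lambda>t. 1 / ((1 - r) + t)) has_integral (ln ((1 - r) + 1) - ln ((1 - r) + 0))) {0..1}"
    by (rule fundamental_theorem_of_calculus)
       (use r in \<open>auto intro!: derivative_eq_intros simp: has_real_derivative_iff_has_vector_derivative[symmetric]\<close>)
  note int = this
  have "ln (1 / (1 - r)) \<le> ln ((1 - r) + 1) - ln ((1 - r) + 0)"
    using r by (simp add: ln_div)
  also have "\<dots> = integral {0..1} (\<lambda>t. 1 / ((1 - r) + t))" using int by (simp add: integral_unique)
  also have "\<dots> \<le> integral {0..1} (\<lambda>t. norm (cayley r (cis t)))"
  proof (rule integral_le)
    show "(\<lambda>t. 1 / ((1 - r) + t)) integrable_on {0..1}" using int by blast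
    show "(\<lambda>t. norm (cayley r (cis t))) integrable_on {0..1}"
      by (rule integrable_continuous_real[OF cont'])
    fix t :: real assume t: "t \<in> {0..1}"
    have "cos t \<ge> 0" using t pi_gt3 by (intro cos_ge_zero) auto
    hence "1 \<le> Re (1 + of_real r * cis t)" using r by simp
    also have "\<dots> \<le> norm (1 + of_real r * cis t)" by (rule complex_Re_le_cmod)
    finally have num: "1 \<le> norm (1 + of_real r * cis t)" .
    have "norm (1 - cis t) \<le> \<bar>t\<bar>"
      using dist_exp_i_1[of t] abs_sin_x_le_abs_x[of "t / 2"] by (simp add: cis_conv_exp norm_minus_commute)
    hence "norm (of_real r * (1 - cis t)) \<le> 1 * t" using r t unfolding norm_mult by (intro mult_mono) auto
    moreover have "norm (1 - of_real r * cis t) \<le> norm (of_real (1 - r) :: complex) + norm (of_real r * (1 - cis t))"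
      by (rule order_trans[OF _ norm_triangle_ineq]) (simp add: algebra_simps)
    moreover have "norm (of_real (1 - r) :: complex) = 1 - r" using r by (simp only: norm_of_real)
    ultimately have den: "norm (1 - of_real r * cis t) \<le> (1 - r) + t" by linarith
    have "cis t \<in> ball 0 (1 / r)" using r by (simp add: field_simps)
    hence "norm (1 - of_real r * cis t) > 0" using cayley_denominator[OF r(1)] by simp
    thus "1 / ((1 - r) + t) \<le> norm (cayley r (cis t))"
      unfolding cayley_def norm_divide using num den r t by (intro frac_le) auto
  qed
  also have "\<dots> \<le> integral {0..2 * pi} (\<lambda>t. norm (cayley r (cis t)))"
    using pi_gt3 by (intro integral_subset_le integrable_continuous_real cont') auto
  also have "\<dots> = 2 * pi * (LINT \<zeta>|circle_measure. norm (cayley r \<zeta>))"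
    unfolding integral_circle_measure(1)[OF cont] real_scaleR_def by simp
  finally show ?thesis by (simp add: field_simps)
qed

context completely_multiplicative
begin

text \<open>Let \<open>W\<close> be the mean of \<open>norm (cayley r \<zeta>)\<close>, which is
  also that of \<open>norm (f \<zeta>) powr q\<close>. The test functions give \<open>(1 - \<eta>) *
  W - K' \<le> B powr q * ((S powr q + \<eta>) * W + K)\<close> with \<open>K\<close> and
  \<open>K'\<close> independent of \<open>r\<close>. Since \<open>W\<close> is unbounded, the
  coefficients of \<open>W\<close> satisfy the same inequality; then \<open>\<eta>\<close> tends to
  0.\<close>

lemma opnorm_lower_bound:
  assumes q: "1 < q" and B: "B \<ge> 0" and bound: "\<And>x. x \<ge> 1 \<Longrightarrow> Hq_opnorm q (proj g x) \<le> ennreal B"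
  shows "1 / sin (pi / q) \<le> B"
proof -
  define c where "c = cos (pi / q)"
  define S where "S = sin (pi / q)"
  have S: "S > 0" unfolding S_def by (rule sin_pi_div_pos[OF q])
  \<comment> \<open>This is \<open>norm (cnj u - c * u) powr q\<close> for
    \<open>u = cis (t / q)\<close>. At \<open>t = pi / 2\<close> the base is
    \<open>1 - c^2 = S^2\<close>.\<close>
  define m where "m t = (1 + c^2 - 2 * c * cos (2 * t / q)) powr (q / 2)" for t
  have m_nonneg: "0 \<le> 1 + c^2 - 2 * c * cos u" for u
    using quadratic_cos_nonneg[of "- c" u] by simp
  have m_pi: "m (pi / 2) = S powr q"
  proof -
    have "1 + c^2 - 2 * c * cos (2 * (pi / 2) / q) = S^2"
      using sin_squared_eq[of "pi / q"] by (simp add: c_def S_def power2_eq_square)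
    thus ?thesis using S by (simp add: m_def powr_powr flip: powr_numeral)
  qed
  have m_le: "m t \<le> 4 powr (q / 2)" for t
  proof -
    have "\<bar>c\<bar> \<le> 1" by (simp add: c_def)
    hence "\<bar>c * cos (2 * t / q)\<bar> \<le> 1 * 1" unfolding abs_mult by (intro mult_mono) auto
    moreover have "c^2 \<le> 1" using \<open>\<bar>c\<bar> \<le> 1\<close> by (simp add: abs_square_le_1)
    ultimately have "1 + c^2 - 2 * c * cos (2 * t / q) \<le> 4" by linarith
    thus ?thesis unfolding m_def using q m_nonneg by (intro powr_mono2) auto
  qed
  have m_cont: "isCont m (pi / 2)"
  proof -
    have "continuous_on UNIV m"
      unfolding m_def using q m_nonneg by (intro continuous_on_powr' continuous_intros) auto
    thus ?thesis by (simp add: continuous_on_eq_continuous_at)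
  qed
  have main: "1 - \<eta> \<le> B powr q * (S powr q + \<eta>)" if \<eta>: "0 < \<eta>" "\<eta> < 1" for \<eta>
  proof (rule ccontr)
    assume contra: "\<not> ?thesis"
    obtain K where K: "K \<ge> 0" "\<And>t. \<bar>t\<bar> \<le> pi / 2 \<Longrightarrow> m t \<le> S powr q + \<eta> + K * cos t"
      using continuous_le_add_cos[OF m_cont _ m_le \<eta>(1)] unfolding m_pi by (auto simp: m_def)
    obtain K' where K': "K' \<ge> 0" "\<And>u v :: complex. norm v \<le> 1 \<Longrightarrow> (1 - \<eta>) * norm u powr q - K' \<le> norm (u - v) powr q"
      using powr_shift_lower_bound[of q \<eta>] q \<eta> by auto
    define D where "D = 1 - \<eta> - B powr q * (S powr q + \<eta>)"
    have D: "D > 0" using contra by (simp add: D_def)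
    have W_bound: "D * (LINT \<zeta>|circle_measure. norm (cayley r \<zeta>)) \<le> K' + B powr q * K" if r: "0 < r" "r < 1" for r
    proof -
      define W where "W = (LINT \<zeta>|circle_measure. norm (cayley r \<zeta>))"
      define f where "f \<zeta> = exp (of_real (1 / q) * Ln (cayley r \<zeta>))" for \<zeta>
      have R: "1 < 1 / r" using r by simp
      have sub: "sphere 0 1 \<subseteq> ball (0::complex) (1 / r)" using r by (auto simp: field_simps)
      have holf: "f holomorphic_on ball 0 (1 / r)"
        unfolding f_def
        by (intro holomorphic_intros cayley_holomorphic[OF r(1)])
           (use Re_cayley_pos[OF r(1)] in \<open>force simp: complex_nonpos_Reals_iff\<close>)
      have contf: "continuous_on (sphere 0 1) f" and contw: "continuous_on (sphere 0 1) (cayley r)"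
        by (rule continuous_on_subset[OF holomorphic_on_imp_continuous_on sub], rule holf)
           (rule continuous_on_subset[OF holomorphic_on_imp_continuous_on[OF cayley_holomorphic[OF r(1)]] sub])
      have f0: "f 0 = 1" by (simp add: f_def cayley_def)
      have normf: "norm (f \<zeta>) powr q = norm (cayley r \<zeta>)" if "\<zeta> \<in> sphere 0 1" for \<zeta>
      proof -
        have "cayley r \<zeta> \<noteq> 0" using Re_cayley_pos[OF r(1), of \<zeta>] sub that by auto
        thus ?thesis using q by (simp add: f_def norm_exp_eq_Re exp_powr_real)
      qed
      have int: "integrable circle_measure (\<lambda>\<zeta>. norm (cnj (f \<zeta>) - of_real c) powr q)"
        "integrable circle_measure (\<lambda>\<zeta>. norm (cnj (f \<zeta>) - of_real c * f \<zeta>) powr q)"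
        "integrable circle_measure (\<lambda>\<zeta>. norm (cayley r \<zeta>))" "integrable circle_measure (\<lambda>\<zeta>. Re (cayley r \<zeta>))"
        using q by (intro integral_circle_measure(2) continuous_on_norm_powr continuous_intros contf contw; simp)+
      have "(1 - \<eta>) * W - K' = (LINT \<zeta>|circle_measure. (1 - \<eta>) * norm (cayley r \<zeta>) - K')"
        using int by (simp add: W_def prob_space.prob_space[OF prob_space_circle_measure])
      also have "\<dots> \<le> (LINT \<zeta>|circle_measure. norm (cnj (f \<zeta>) - of_real c) powr q)"
      proof (rule integral_mono)
        fix \<zeta> assume "\<zeta> \<in> space circle_measure"
        hence z: "\<zeta> \<in> sphere 0 1" by (simp add: space_circle_measure)
        have "norm (of_real c :: complex) \<le> 1" by (simp add: c_def)
        from K'(2)[OF this, of "cnj (f \<zeta>)"]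
        show "(1 - \<eta>) * norm (cayley r \<zeta>) - K' \<le> norm (cnj (f \<zeta>) - of_real c) powr q"
          using normf[OF z] by simp
      qed (use int in auto)
      also have "\<dots> \<le> B powr q * (LINT \<zeta>|circle_measure. norm (cnj (f \<zeta>) - of_real c * f \<zeta>) powr q)"
        by (rule holomorphic_circle_bound[OF q B bound holf R f0])
      also have "\<dots> \<le> B powr q * (LINT \<zeta>|circle_measure. (S powr q + \<eta>) * norm (cayley r \<zeta>) + K * Re (cayley r \<zeta>))"
      proof (rule mult_left_mono[OF integral_mono])
        fix \<zeta> assume "\<zeta> \<in> space circle_measure"
        hence z: "\<zeta> \<in> sphere 0 1" by (simp add: space_circle_measure)
        define t where "t = Im (Ln (cayley r \<zeta>))"
        have pos: "0 < Re (cayley r \<zeta>)" using Re_cayley_pos[OF r(1), of \<zeta>] sub z by auto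
        hence nz: "cayley r \<zeta> \<noteq> 0" by auto
        have t: "\<bar>t\<bar> \<le> pi / 2" using Re_Ln_pos_lt[OF nz] pos by (simp add: t_def)
        have "cayley r \<zeta> = exp (Ln (cayley r \<zeta>))" using nz by simp
        hence Re: "Re (cayley r \<zeta>) = norm (cayley r \<zeta>) * cos t"
          by (metis Re_exp norm_exp_eq_Re t_def)
        define y where "y = norm (f \<zeta>)"
        have fy: "f \<zeta> = of_real y * cis (t / q)"
          unfolding y_def by (simp add: f_def exp_eq_polar t_def norm_mult)
        have "cnj (f \<zeta>) - of_real c * f \<zeta> = of_real y * (cnj (cis (t / q)) - of_real c * cis (t / q))"
          unfolding fy by (simp only: complex_cnj_mult complex_cnj_complex_of_real right_diff_distrib mult.left_commute)
        hence "norm (cnj (f \<zeta>) - of_real c * f \<zeta>) = y * norm (cnj (cis (t / q)) - of_real c * cis (t / q))"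
          by (simp only: norm_mult norm_of_real y_def abs_norm_cancel)
        also have "norm (cnj (cis (t / q)) - of_real c * cis (t / q)) = (1 + c^2 - 2 * c * cos (2 * t / q)) powr (1 / 2)"
        proof -
          have "(norm (cnj (cis (t / q)) - of_real c * cis (t / q)))^2 = 1 + c^2 - 2 * c * cos (2 * (t / q))"
            unfolding cmod_power2 cos_double sin_squared_eq[of "t / q"]
            by (simp add: power2_eq_square algebra_simps sin_squared_eq[unfolded power2_eq_square])
          hence "norm (cnj (cis (t / q)) - of_real c * cis (t / q)) = sqrt (1 + c^2 - 2 * c * cos (2 * (t / q)))"
            by (metis abs_norm_cancel real_sqrt_abs)
          thus ?thesis using m_nonneg by (simp add: powr_half_sqrt)
        qed
        finally have "norm (cnj (f \<zeta>) - of_real c * f \<zeta>) powr q = norm (cayley r \<zeta>) * m t"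
          using normf[OF z] by (simp add: powr_mult powr_powr m_def y_def)
        also have "\<dots> \<le> norm (cayley r \<zeta>) * (S powr q + \<eta> + K * cos t)"
          using K(2)[OF t] by (intro mult_left_mono) auto
        also have "\<dots> = (S powr q + \<eta>) * norm (cayley r \<zeta>) + K * Re (cayley r \<zeta>)"
          by (simp add: Re algebra_simps)
        finally show "norm (cnj (f \<zeta>) - of_real c * f \<zeta>) powr q \<le> (S powr q + \<eta>) * norm (cayley r \<zeta>) + K * Re (cayley r \<zeta>)" .
      qed (use int in auto)
      \<comment> \<open>The mean of the real part is \<open>Re (cayley r 0) = 1\<close>, so the
        correction contributes exactly \<open>K\<close> for every \<open>r\<close>.\<close>
      also have "(LINT \<zeta>|circle_measure. (S powr q + \<eta>) * norm (cayley r \<zeta>) + K * Re (cayley r \<zeta>)) = (S powr q + \<eta>) * W + K"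
        using int integral_circle_Re_holomorphic[OF cayley_holomorphic[OF r(1)] R] by (simp add: W_def cayley_def)
      finally have "D * W \<le> K' + B powr q * K" by (simp add: D_def algebra_simps)
      thus ?thesis by (simp add: W_def)
    qed
    \<comment> \<open>\<open>X\<close> exceeds by 1 what \<open>W_bound\<close> allows for the mean
      of the modulus, and \<open>r\<close> is chosen such that the logarithmic lower bound for this
      mean equals \<open>X\<close>.\<close>
    define X where "X = (K' + B powr q * K) / D + 1"
    have X: "X > 0" using K K' D by (simp add: X_def add_nonneg_pos)
    define r where "r = 1 - exp (- (2 * pi * X))"
    have r: "0 < r" "r < 1" using X by (auto simp: r_def)
    have "X = ln (1 / (1 - r)) / (2 * pi)" by (simp add: r_def ln_div)
    also have "\<dots> \<le> (LINT \<zeta>|circle_measure. norm (cayley r \<zeta>))"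
      by (rule integral_norm_cayley_lower_bound[OF r])
    finally have "D * X \<le> K' + B powr q * K" using W_bound[OF r] D by (smt (verit) mult_left_mono)
    thus False using D mult_pos_pos[OF D D] by (simp add: X_def field_simps)
  qed
  have "1 - 0 \<le> B powr q * (S powr q + 0)"
  proof (rule tendsto_le)
    show "((\<lambda>\<eta>. B powr q * (S powr q + \<eta>)) \<longlongrightarrow> B powr q * (S powr q + 0)) (at_right 0)" by (intro tendsto_intros)
    show "((\<lambda>\<eta>. 1 - \<eta>) \<longlongrightarrow> 1 - 0) (at_right (0::real))" by (intro tendsto_intros)
    show "\<forall>\<^sub>F \<eta> in at_right 0. 1 - \<eta> \<le> B powr q * (S powr q + \<eta>)"
      unfolding eventually_at_right_field using main by (intro exI[of _ 1]) auto
  qed simp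
  hence "1 powr (1 / q) \<le> ((B * S) powr q) powr (1 / q)" using q S B by (intro powr_mono2) (auto simp: powr_mult)
  hence "1 \<le> B * S" using q S B by (simp add: powr_powr)
  thus ?thesis using S by (simp add: S_def field_simps)
qed

end

theorem theorem5p1:
  fixes g :: "nat \<Rightarrow> real" and q :: real
  assumes g_pos: "\<And>n. n \<ge> 1 \<Longrightarrow> g n > 0"
    and g_mult: "\<And>m n. m \<ge> 1 \<Longrightarrow> n \<ge> 1 \<Longrightarrow> g (m * n) = g m * g n"
    and g_lim: "filterlim g at_top sequentially"
    and q: "1 < q"
  shows "(SUP x\<in>{1..}. Hq_opnorm q (proj g x)) = ennreal (1 / sin (pi / q))"
proof -
  interpret completely_multiplicative g
    using g_pos g_mult g_lim by unfold_locales
  show ?thesis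
  proof (rule antisym)
    show "(SUP x\<in>{1..}. Hq_opnorm q (proj g x)) \<le> ennreal (1 / sin (pi / q))"
      using Hq_opnorm_proj_le[OF q] by (intro SUP_least) auto
    show "ennreal (1 / sin (pi / q)) \<le> (SUP x\<in>{1..}. Hq_opnorm q (proj g x))"
    \<comment> \<open>A finite supremum serves as the constant \<open>B\<close>; an infinite one
      leaves nothing to prove.\<close>
    proof (cases "(SUP x\<in>{1..}. Hq_opnorm q (proj g x))")
      case (real B)
      have "Hq_opnorm q (proj g x) \<le> ennreal B" if "x \<ge> 1" for x
        unfolding real(2)[symmetric] using that by (intro SUP_upper) auto
      from opnorm_lower_bound[OF q real(1) this] show ?thesis unfolding real(2) by (rule ennreal_leI)
    next
      case top
      show ?thesis unfolding top by simp
    qed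
  qed
qed

end
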